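(* Let $n\ge 2$ and $b\in(1,n)$. Then there exist constants $C>c>0$, independent of $g$, such that for every $g\in L^2(S^{n-1})$, $$c\,\|g\|_{L^2(S^{n-1})}\le \Big\|\Lambda_\omega^{\frac{b-1}{2}}\,|x|^{-\frac b2}\,\widehat{g\,d\sigma}(x)\Big\|_{L^2(\mathbb{R}^n_x)}\le C\,\|g\|_{L^2(S^{n-1})}.$$
   Context: $d\sigma$ is the surface measure on the unit sphere $S^{n-1}\subset\mathbb{R}^n$, and $\widehat{g\,d\sigma}(x)=\int_{S^{n-1}}e^{-ix\cdot\omega}g(\omega)\,d\sigma(\omega)$ is the Fourier transform of the measure $g\,d\sigma$. Write $x=r\omega$ with $r=|x|\ge0$, $\omega\in S^{n-1}$. $\Delta_\omega=\sum_{1\le i<j\le n}\Omega_{ij}^2$, $\Omega_{ij}=x_i\partial_j-x_j\partial_i$, is the Laplace–Beltrami operator on $S^{n-1}$, and $\Lambda_\omega=\sqrt{1-\Delta_\omega}$. Real powers $\Lambda_\omega^s$ are defined spectrally via spherical harmonics and act on functions on $\mathbb{R}^n$ in the angular variable $\omega$, for each fixed $r$. *)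

theory Defs
  imports "HOL-Analysis.Analysis"
begin

text \<open>Square-integrable complex functions are represented by Borel functions.\<close>

definition L2 :: "'a measure \<Rightarrow> ('a \<Rightarrow> complex) set" where
  "L2 M = {f \<in> borel_measurable M. integrable M (\<lambda>x. (cmod (f x))\<^sup>2)}"

definition L2_norm :: "'a measure \<Rightarrow> ('a \<Rightarrow> complex) \<Rightarrow> real" where
  "L2_norm M f = sqrt (\<integral>x. (cmod (f x))\<^sup>2 \<partial>M)"

text \<open>
  The surface measure of the unit sphere, normalised so that Lebesgue measure is
  \<open>r\<^sup>n\<^sup>-\<^sup>1 dr d\<sigma>\<close> in polar coordinates: \<open>\<sigma>(A)\<close> is \<open>n\<close> times the volume of the cone
  \<open>{t \<omega> | 0 < t \<le> 1, \<omega> \<in> A}\<close>.  Note that \<open>sgn x = x / |x|\<close>.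
\<close>

definition surface_measure :: "(real ^ 'n) measure" where
  "surface_measure =
     scale_measure (of_nat CARD('n))
       (distr (restrict_space lborel (cball 0 1 - {0}))
              (restrict_space borel (sphere 0 1)) sgn)"

definition sphere_fourier :: "(real ^ 'n \<Rightarrow> complex) \<Rightarrow> real ^ 'n \<Rightarrow> complex" where
  "sphere_fourier g x =
     (\<integral>\<omega>. exp (- \<i> * complex_of_real (x \<bullet> \<omega>)) * g \<omega> \<partial>surface_measure)"

definition partial_deriv :: "'n \<Rightarrow> (real ^ 'n \<Rightarrow> complex) \<Rightarrow> real ^ 'n \<Rightarrow> complex" where
  "partial_deriv i u x = frechet_derivative u (at x) (axis i 1)"

definition Omega :: "'n \<Rightarrow> 'n \<Rightarrow> (real ^ 'n \<Rightarrow> complex) \<Rightarrow> real ^ 'n \<Rightarrow> complex" where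
  "Omega i j u x =
     complex_of_real (x $ i) * partial_deriv j u x - complex_of_real (x $ j) * partial_deriv i u x"

text \<open>
  The index type carries no order, so the sum over \<open>i < j\<close> is written as half of the sum
  over all pairs; \<open>Omega i j\<close> is antisymmetric in \<open>i, j\<close>.
\<close>

definition angular_laplacian :: "(real ^ 'n \<Rightarrow> complex) \<Rightarrow> real ^ 'n \<Rightarrow> complex" where
  "angular_laplacian u x = (\<Sum>i\<in>UNIV. \<Sum>j\<in>UNIV. Omega i j (Omega i j u) x) / 2"

text \<open>
  Spherical harmonics of degree \<open>k\<close> are represented by the homogeneous harmonic polynomials
  on the whole space whose restrictions to the sphere they are.
\<close>

definition spherical_harmonics :: "nat \<Rightarrow> (real ^ 'n \<Rightarrow> complex) set" where
  "spherical_harmonics k =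
     {p. polynomial_function p \<and>
         (\<forall>t x. p (t *\<^sub>R x) = complex_of_real (t ^ k) * p x) \<and>
         (\<forall>x. (\<Sum>i\<in>UNIV. partial_deriv i (partial_deriv i p) x) = 0)}"

text \<open>
  \<open>sphere_Lambda_power s f h\<close> says that \<open>h = \<Lambda>\<^sup>s f\<close> on the sphere:  \<open>f = \<Sum>\<^sub>k Y\<^sub>k\<close> is the
  \<open>L\<^sup>2\<close>-convergent expansion of \<open>f\<close> into spherical harmonics, \<open>-\<mu>\<^sub>k\<close> is the eigenvalue of the
  angular Laplacian at \<open>Y\<^sub>k\<close>, and the series \<open>\<Sum>\<^sub>k (sqrt (1 + \<mu>\<^sub>k))\<^sup>s Y\<^sub>k\<close> converges to \<open>h\<close>
  in \<open>L\<^sup>2\<close>.  If \<open>Y\<^sub>k = 0\<close>, then \<open>\<mu>\<^sub>k\<close> is arbitrary, but the \<open>k\<close>-th term vanishes anyway.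
\<close>

definition sphere_Lambda_power ::
  "real \<Rightarrow> (real ^ 'n \<Rightarrow> complex) \<Rightarrow> (real ^ 'n \<Rightarrow> complex) \<Rightarrow> bool" where
  "sphere_Lambda_power s f h \<longleftrightarrow>
     f \<in> L2 surface_measure \<and> h \<in> L2 surface_measure \<and>
     (\<exists>Y \<mu>.
        (\<forall>k. Y k \<in> spherical_harmonics k \<and>
             (\<forall>\<omega>\<in>sphere 0 1. angular_laplacian (Y k) \<omega> = - complex_of_real (\<mu> k) * Y k \<omega>)) \<and>
        (\<lambda>N. L2_norm surface_measure (\<lambda>\<omega>. f \<omega> - (\<Sum>k<N. Y k \<omega>))) \<longlonglongrightarrow> 0 \<and>
        (\<lambda>N. L2_norm surface_measure
           (\<lambda>\<omega>. h \<omega> - (\<Sum>k<N. complex_of_real (sqrt (1 + \<mu> k) powr s) * Y k \<omega>)))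
          \<longlonglongrightarrow> 0)"

text \<open>
  \<open>H = \<Lambda>\<^sub>\<omega>\<^sup>s F\<close> for functions on the whole space, the operator acting in the angular variable
  for (almost) every fixed radius.  As \<open>H\<close> is an \<open>L\<^sup>2\<close>-type object, determined only up to null
  sets, this is a relation between \<open>F\<close> and its representatives \<open>H\<close>.
\<close>

definition angular_Lambda_power ::
  "real \<Rightarrow> (real ^ 'n \<Rightarrow> complex) \<Rightarrow> (real ^ 'n \<Rightarrow> complex) \<Rightarrow> bool" where
  "angular_Lambda_power s F H \<longleftrightarrow>
     H \<in> borel_measurable lborel \<and>
     (AE r in lborel. 0 < r \<longrightarrow>
        sphere_Lambda_power s (\<lambda>\<omega>. F (r *\<^sub>R \<omega>)) (\<lambda>\<omega>. H (r *\<^sub>R \<omega>)))"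

end

theory Submission
  imports Defs
begin

text \<open>
  Expand \<open>g = \<Sum>\<^sub>k Y\<^sub>k\<close> in spherical harmonics.  The Fourier transform of \<open>Y\<^sub>k d\<sigma>\<close> is a radial profile
  times \<open>Y\<^sub>k\<close>, so both operators act diagonally, and it suffices to show that
  \<open>(1 + k (k + n - 2))\<^bsup>(b - 1) / 2\<^esup>\<close> times the squared weighted \<open>L\<^sup>2\<close>-norm of the \<open>k\<close>-th profile is bounded
  above and below uniformly in \<open>k\<close>.  For this, write \<open>|x|\<^bsup>-b\<^esup>\<close> as a superposition of Gaussians
  \<open>exp (- |x|\<^sup>2 / (2 u))\<close>.  For each \<open>u\<close>, the Gaussian-weighted energy of the transform is a double
  integral over the sphere with kernel \<open>exp (u \<eta> \<bullet> \<omega>)\<close>, which \<open>Y\<^sub>k\<close> diagonalises; its eigenvalue is a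
  power series in \<open>u\<close> whose coefficients come from Gaussian integration by parts.  Integrating in \<open>u\<close>
  leaves a series \<open>S\<^sub>k\<close> of Gamma values with \<open>(k + p) S\<^sub>k = (k + n - 1 - p) S\<^sub>k\<^sub>+\<^sub>1\<close>, \<open>p = (n - b) / 2\<close>.
  Hence \<open>S\<^sub>k\<close> is of the order \<open>k\<^bsup>1 - b\<^esup>\<close>, and this is cancelled by the angular multiplier.
\<close>

section \<open>Complex polynomials and spherical harmonics\<close>

text \<open>The power series of a profile in r, \<open>harmonic_bessel\<close> at -i r, alternates
  and cannot be integrated termwise against r^(n-1-b). The Gaussians repair this: they replace -i r
  by a positive u, so every series integrated against a weight has nonnegative terms and the
  interchanges are of Tonelli type. With p = (n-b)/2 and q = n-1-p, the condition b < n says p > 0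
  (integrability in u at 0, felt at k = 0), and b > 1 says p < (n-1)/2, which makes
  \<open>weber_sum\<close> converge. Its recurrence yields a quotient of rising factorials of p and
  q with decay exponent q - p = b - 1; as 1 + k (k+n-2) is of order k^2, its power (b-1)/2
  compensates this exactly. \<open>sphere_Lambda_power\<close> leaves the expansion and the
  eigenvalues existentially quantified, so any admissible H must be shown to have the right norm
  whatever was chosen, and an H that is measurable on the whole space must be constructed. Only
  norms of the harmonic parts are compared, and factors such as the area of the sphere stay
  symbolic.\<close>

inductive cpoly :: "(real ^ 'n \<Rightarrow> complex) \<Rightarrow> bool" where
  const: "cpoly (\<lambda>x. c)"
| coord: "cpoly (\<lambda>x. complex_of_real (x $ i))"
| add: "cpoly p \<Longrightarrow> cpoly q \<Longrightarrow> cpoly (\<lambda>x. p x + q x)"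
| mult: "cpoly p \<Longrightarrow> cpoly q \<Longrightarrow> cpoly (\<lambda>x. p x * q x)"

lemma bounded_linear_of_real_nth: "bounded_linear (\<lambda>x :: real ^ 'n. complex_of_real (x $ i))"
  by (rule bounded_linear_compose[OF bounded_linear_of_real bounded_linear_vec_nth])

lemma cpoly_uminus: "cpoly p \<Longrightarrow> cpoly (\<lambda>x. - p x)"
  using cpoly.mult[OF cpoly.const[of "-1"], of p] by simp

lemma cpoly_diff: "cpoly p \<Longrightarrow> cpoly q \<Longrightarrow> cpoly (\<lambda>x. p x - q x)"
  using cpoly.add[OF _ cpoly_uminus, of p q] by simp

lemma cpoly_sum: "(\<And>i. i \<in> I \<Longrightarrow> cpoly (p i)) \<Longrightarrow> cpoly (\<lambda>x. \<Sum>i\<in>I. p i x)"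
  by (induction I rule: infinite_finite_induct) (auto intro: cpoly.intros)

lemma cpoly_power: "cpoly p \<Longrightarrow> cpoly (\<lambda>x. p x ^ m)"
  by (induction m) (auto intro: cpoly.intros)

lemma cpoly_inner: "cpoly (\<lambda>y. complex_of_real (x \<bullet> y))"
proof -
  have "cpoly (\<lambda>y. \<Sum>i\<in>UNIV. complex_of_real (x $ i) * complex_of_real (y $ i))"
    by (intro cpoly_sum cpoly.intros)
  then show ?thesis by (simp add: inner_vec_def)
qed

lemma cpoly_norm_sq: "cpoly (\<lambda>y :: real ^ 'n. (complex_of_real (norm y))\<^sup>2)"
proof -
  have "cpoly (\<lambda>y :: real ^ 'n. \<Sum>i\<in>UNIV. (complex_of_real (y $ i))^2)"
    by (intro cpoly_sum cpoly_power cpoly.intros)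
  moreover have "(complex_of_real (norm y))\<^sup>2 = (\<Sum>i\<in>UNIV. (complex_of_real (y $ i))^2)"
    for y :: "real ^ 'n"
    by (simp add: norm_vec_def L2_set_def sum_nonneg flip: of_real_power of_real_sum)
  ultimately show ?thesis by simp
qed

lemma cpoly_cnj: "cpoly p \<Longrightarrow> cpoly (\<lambda>x. cnj (p x))"
  by (induction rule: cpoly.induct) (auto intro: cpoly.intros)

lemma linear_eq_sum_axis:
  fixes x :: "real ^ 'n"
  assumes "linear f"
  shows "f x = (\<Sum>i\<in>UNIV. (x $ i) *\<^sub>R f (axis i 1))"
proof -
  have x: "(\<Sum>i\<in>UNIV. (x $ i) *\<^sub>R axis i 1) = x"
    using basis_expansion[of x] by (simp add: scalar_mult_eq_scaleR)
  have "f (\<Sum>i\<in>UNIV. (x $ i) *\<^sub>R axis i 1) = (\<Sum>i\<in>UNIV. (x $ i) *\<^sub>R f (axis i 1))"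
    using assms by (simp add: linear_sum linear_cmul)
  then show ?thesis
    unfolding x .
qed

lemma cpoly_of_real_polynomial:
  "real_polynomial_function f \<Longrightarrow> cpoly (\<lambda>x :: real ^ 'n. complex_of_real (f x))"
proof (induction rule: real_polynomial_function.induct)
  case (linear f)
  have "(\<lambda>x. complex_of_real (f x)) =
      (\<lambda>x. \<Sum>i\<in>UNIV. complex_of_real (x $ i) * complex_of_real (f (axis i 1)))"
    by (rule ext, subst linear_eq_sum_axis[OF bounded_linear.linear[OF linear]]) simp
  moreover have "cpoly (\<lambda>x. \<Sum>i\<in>UNIV. complex_of_real (x $ i) * complex_of_real (f (axis i 1)))"
    by (intro cpoly_sum cpoly.intros)
  ultimately show ?case by (simp only:)
qed (auto intro: cpoly.intros)

lemma polynomial_function_complex_iff: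
  "polynomial_function p \<longleftrightarrow>
    real_polynomial_function (\<lambda>x. Re (p x)) \<and> real_polynomial_function (\<lambda>x. Im (p x))"
  by (simp add: polynomial_function_iff_Basis_inner Basis_complex_def)

lemma cpoly_imp_polynomial_function: "cpoly p \<Longrightarrow> polynomial_function p"
proof (induction rule: cpoly.induct)
  case (coord i)
  show ?case
    by (rule polynomial_function_bounded_linear[OF bounded_linear_of_real_nth])
next
  case (mult p q)
  then show ?case
    unfolding polynomial_function_complex_iff times_complex.simps
    by (intro conjI real_polynomial_function_diff real_polynomial_function.intros(3,4)) blast+
qed (rule polynomial_function_const polynomial_function_add; assumption)+

text \<open>\<open>polynomial_function\<close> is phrased through real linear functionals of the
  value, \<open>cpoly\<close> through complex sums and products of coordinates. The equivalence
  gives rule induction for the polynomials in \<open>spherical_harmonics\<close>, and carries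
  Stone-Weierstrass over to \<open>cpoly\<close>.\<close>

lemma cpoly_iff_polynomial_function: "cpoly p \<longleftrightarrow> polynomial_function p"
proof
  assume "polynomial_function p"
  then have "cpoly (\<lambda>x. complex_of_real (Re (p x)) + \<i> * complex_of_real (Im (p x)))"
    unfolding polynomial_function_complex_iff
    by (intro cpoly.add cpoly.mult cpoly.const cpoly_of_real_polynomial) blast+
  moreover have "(\<lambda>x. complex_of_real (Re (p x)) + \<i> * complex_of_real (Im (p x))) = p"
    by (rule ext) (rule complex_eq[symmetric])
  ultimately show "cpoly p" by (rule back_subst[of cpoly])
qed (rule cpoly_imp_polynomial_function)

lemma cpoly_differentiable: "cpoly p \<Longrightarrow> p differentiable (at x)"
proof (induction rule: cpoly.induct)
  case (coord i)
  show ?case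
    by (rule bounded_linear_imp_differentiable) (rule bounded_linear_of_real_nth)
qed (rule differentiable_const differentiable_add differentiable_mult; assumption)+

lemma cpoly_continuous: "cpoly p \<Longrightarrow> continuous_on A p"
  by (intro continuous_at_imp_continuous_on ballI differentiable_imp_continuous_within cpoly_differentiable)

lemma cpoly_measurable: "cpoly p \<Longrightarrow> p \<in> borel_measurable borel"
  by (intro borel_measurable_continuous_onI cpoly_continuous)

section \<open>Partial derivatives of complex polynomials\<close>

lemma partial_deriv_eqI: "(p has_derivative D) (at x) \<Longrightarrow> partial_deriv i p x = D (axis i 1)"
  unfolding partial_deriv_def by (simp add: frechet_derivative_at[symmetric])

lemma partial_deriv_const [simp]: "partial_deriv i (\<lambda>x. c) = (\<lambda>x. 0)"
  using partial_deriv_eqI[OF has_derivative_const] by fastforce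

lemma partial_deriv_coord [simp]:
  "partial_deriv i (\<lambda>x. complex_of_real (x $ j)) = (\<lambda>x. if i = j then 1 else 0)"
proof
  fix x :: "real ^ 'a"
  have "((\<lambda>x. complex_of_real (x $ j)) has_derivative (\<lambda>x. complex_of_real (x $ j))) (at x)"
    by (intro bounded_linear_imp_has_derivative bounded_linear_of_real_nth)
  from partial_deriv_eqI[OF this]
  show "partial_deriv i (\<lambda>x. complex_of_real (x $ j)) x = (if i = j then 1 else 0)"
    by (auto simp: axis_def)
qed

lemma partial_deriv_add:
  "cpoly p \<Longrightarrow> cpoly q \<Longrightarrow> partial_deriv i (\<lambda>x. p x + q x) = (\<lambda>x. partial_deriv i p x + partial_deriv i q x)"
proof
  fix x assume "cpoly p" "cpoly q"
  then have "((\<lambda>x. p x + q x) has_derivative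
      (\<lambda>h. frechet_derivative p (at x) h + frechet_derivative q (at x) h)) (at x)"
    by (intro has_derivative_add) (auto simp: cpoly_differentiable simp flip: frechet_derivative_works)
  from partial_deriv_eqI[OF this]
  show "partial_deriv i (\<lambda>x. p x + q x) x = partial_deriv i p x + partial_deriv i q x"
    by (simp add: partial_deriv_def)
qed

lemma partial_deriv_mult:
  "cpoly p \<Longrightarrow> cpoly q \<Longrightarrow>
    partial_deriv i (\<lambda>x. p x * q x) = (\<lambda>x. p x * partial_deriv i q x + partial_deriv i p x * q x)"
proof
  fix x assume "cpoly p" "cpoly q"
  then have "((\<lambda>x. p x * q x) has_derivative
      (\<lambda>h. p x * frechet_derivative q (at x) h + frechet_derivative p (at x) h * q x)) (at x)"
    by (intro has_derivative_mult) (auto simp: cpoly_differentiable simp flip: frechet_derivative_works)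
  from partial_deriv_eqI[OF this]
  show "partial_deriv i (\<lambda>x. p x * q x) x = p x * partial_deriv i q x + partial_deriv i p x * q x"
    by (simp add: partial_deriv_def)
qed

lemma cpoly_partial_deriv: "cpoly p \<Longrightarrow> cpoly (partial_deriv i p)"
  by (induction rule: cpoly.induct)
    (auto simp: partial_deriv_add partial_deriv_mult intro: cpoly.intros)

lemma partial_deriv_cmult:
  "cpoly p \<Longrightarrow> partial_deriv i (\<lambda>x. c * p x) = (\<lambda>x. c * partial_deriv i p x)"
  by (subst partial_deriv_mult) (auto intro: cpoly.intros)

lemma partial_deriv_uminus:
  "cpoly p \<Longrightarrow> partial_deriv i (\<lambda>x. - p x) = (\<lambda>x. - partial_deriv i p x)"
  using partial_deriv_cmult[of p i "-1"] by simp

lemma partial_deriv_diff: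
  "cpoly p \<Longrightarrow> cpoly q \<Longrightarrow> partial_deriv i (\<lambda>x. p x - q x) = (\<lambda>x. partial_deriv i p x - partial_deriv i q x)"
  using partial_deriv_add[OF _ cpoly_uminus, of p q i] by (simp add: partial_deriv_uminus)

lemma partial_deriv_sum:
  "finite I \<Longrightarrow> (\<And>j. j \<in> I \<Longrightarrow> cpoly (p j)) \<Longrightarrow>
    partial_deriv i (\<lambda>x. \<Sum>j\<in>I. p j x) = (\<lambda>x. \<Sum>j\<in>I. partial_deriv i (p j) x)"
  by (induction I rule: finite_induct) (simp_all add: partial_deriv_add cpoly_sum)

lemma partial_deriv_power:
  "cpoly p \<Longrightarrow> partial_deriv i (\<lambda>x. p x ^ m) = (\<lambda>x. of_nat m * p x ^ (m - 1) * partial_deriv i p x)"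
proof (induction m)
  case (Suc m)
  then show ?case
    by (cases m) (auto simp: partial_deriv_mult cpoly_power cpoly.mult algebra_simps fun_eq_iff)
qed simp

lemma partial_deriv_inner: "partial_deriv i (\<lambda>y. complex_of_real (x \<bullet> y)) = (\<lambda>y. x $ i)"
proof
  fix y :: "real ^ 'a"
  have "((\<lambda>y. complex_of_real (x \<bullet> y)) has_derivative (\<lambda>y. complex_of_real (x \<bullet> y))) (at y)"
    by (intro bounded_linear_imp_has_derivative
        bounded_linear_compose[OF bounded_linear_of_real bounded_linear_inner_right])
  from partial_deriv_eqI[OF this]
  show "partial_deriv i (\<lambda>y. complex_of_real (x \<bullet> y)) y = x $ i"
    by (simp add: inner_axis)
qed

lemma partial_deriv_norm_sq:
  "partial_deriv i (\<lambda>y. (complex_of_real (norm y))\<^sup>2) = (\<lambda>y. 2 * complex_of_real (y $ i))"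
proof
  fix y :: "real ^ 'a"
  have "((\<lambda>y. complex_of_real (y \<bullet> y)) has_derivative (\<lambda>h. complex_of_real (y \<bullet> h + h \<bullet> y))) (at y)"
    by (auto intro!: derivative_eq_intros)
  from partial_deriv_eqI[OF this]
  show "partial_deriv i (\<lambda>y. (complex_of_real (norm y))\<^sup>2) y = 2 * complex_of_real (y $ i)"
    by (simp add: inner_axis inner_axis' power2_norm_eq_inner flip: of_real_power)
qed

lemma partial_deriv_cnj: "cpoly p \<Longrightarrow> partial_deriv i (\<lambda>x. cnj (p x)) = (\<lambda>x. cnj (partial_deriv i p x))"
  by (induction rule: cpoly.induct)
    (auto simp: partial_deriv_add partial_deriv_mult cpoly_cnj fun_eq_iff)

lemma partial_deriv_commute:
  "cpoly p \<Longrightarrow> partial_deriv i (partial_deriv j p) = partial_deriv j (partial_deriv i p)"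
proof (induction rule: cpoly.induct)
  case (mult p q)
  then show ?case
    by (simp add: partial_deriv_mult partial_deriv_add cpoly_partial_deriv cpoly.mult algebra_simps)
next
  case (coord k)
  show ?case by (auto simp: if_distrib[of "\<lambda>c. partial_deriv _ (\<lambda>x. c)"])
qed (simp_all add: partial_deriv_add cpoly_partial_deriv)

section \<open>The Laplacian and the spaces of spherical harmonics\<close>

definition laplacian :: "(real ^ 'n \<Rightarrow> complex) \<Rightarrow> real ^ 'n \<Rightarrow> complex" where
  "laplacian p x = (\<Sum>i\<in>UNIV. partial_deriv i (partial_deriv i p) x)"

lemma laplacian_add:
  "cpoly p \<Longrightarrow> cpoly q \<Longrightarrow> laplacian (\<lambda>x. p x + q x) x = laplacian p x + laplacian q x"
  by (simp add: laplacian_def partial_deriv_add cpoly_partial_deriv sum.distrib)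

lemma laplacian_diff:
  "cpoly p \<Longrightarrow> cpoly q \<Longrightarrow> laplacian (\<lambda>x. p x - q x) x = laplacian p x - laplacian q x"
  by (simp add: laplacian_def partial_deriv_diff cpoly_partial_deriv sum_subtractf)

lemma laplacian_cmult: "cpoly p \<Longrightarrow> laplacian (\<lambda>x. c * p x) x = c * laplacian p x"
  by (simp add: laplacian_def partial_deriv_cmult cpoly_partial_deriv sum_distrib_left)

lemma laplacian_mult:
  assumes "cpoly p" "cpoly q"
  shows "laplacian (\<lambda>x. p x * q x) x = p x * laplacian q x
    + 2 * (\<Sum>i\<in>UNIV. partial_deriv i p x * partial_deriv i q x) + laplacian p x * q x"
  using assms
  by (simp add: laplacian_def partial_deriv_mult partial_deriv_add cpoly_partial_deriv cpoly.mult
      sum.distrib sum_distrib_left sum_distrib_right algebra_simps)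

lemma spherical_harmonicsI:
  "cpoly p \<Longrightarrow> (\<And>t x. p (t *\<^sub>R x) = complex_of_real (t ^ k) * p x) \<Longrightarrow> (\<And>x. laplacian p x = 0)
    \<Longrightarrow> p \<in> spherical_harmonics k"
  by (simp add: spherical_harmonics_def cpoly_iff_polynomial_function laplacian_def)

lemma spherical_harmonicsD:
  assumes "p \<in> spherical_harmonics k"
  shows "cpoly p" "p (t *\<^sub>R x) = complex_of_real (t ^ k) * p x" "laplacian p x = 0"
  using assms by (auto simp add: spherical_harmonics_def cpoly_iff_polynomial_function laplacian_def)

lemma spherical_harmonics_zero: "(\<lambda>x. 0) \<in> spherical_harmonics k"
  by (rule spherical_harmonicsI) (auto intro: cpoly.intros simp: laplacian_def)

lemma spherical_harmonics_add:
  "p \<in> spherical_harmonics k \<Longrightarrow> q \<in> spherical_harmonics k \<Longrightarrow> (\<lambda>x. p x + q x) \<in> spherical_harmonics k"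
  by (rule spherical_harmonicsI)
    (auto intro: cpoly.intros simp: laplacian_add spherical_harmonicsD algebra_simps)

lemma spherical_harmonics_cmult:
  "p \<in> spherical_harmonics k \<Longrightarrow> (\<lambda>x. c * p x) \<in> spherical_harmonics k"
  by (rule spherical_harmonicsI)
    (auto intro: cpoly.intros simp: laplacian_cmult spherical_harmonicsD algebra_simps)

lemma spherical_harmonics_diff:
  "p \<in> spherical_harmonics k \<Longrightarrow> q \<in> spherical_harmonics k \<Longrightarrow> (\<lambda>x. p x - q x) \<in> spherical_harmonics k"
  by (rule spherical_harmonicsI)
    (auto intro: cpoly_diff simp: laplacian_diff spherical_harmonicsD algebra_simps)

lemma spherical_harmonics_cnj:
  "p \<in> spherical_harmonics k \<Longrightarrow> (\<lambda>x. cnj (p x)) \<in> spherical_harmonics k"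
proof (rule spherical_harmonicsI)
  fix x assume p: "p \<in> spherical_harmonics k"
  have "laplacian (\<lambda>x. cnj (p x)) x = cnj (laplacian p x)"
    using p by (simp add: laplacian_def partial_deriv_cnj cpoly_partial_deriv spherical_harmonicsD)
  then show "laplacian (\<lambda>x. cnj (p x)) x = 0"
    using p by (simp add: spherical_harmonicsD)
qed (auto simp: cpoly_cnj spherical_harmonicsD)

lemma spherical_harmonics_const: "(\<lambda>x. c) \<in> spherical_harmonics 0"
  by (rule spherical_harmonicsI) (auto intro: cpoly.intros simp: laplacian_def)

lemma spherical_harmonics_0D:
  assumes "p \<in> spherical_harmonics 0"
  shows "p = (\<lambda>x. p 0)"
proof
  fix x show "p x = p 0"
    using spherical_harmonicsD(2)[OF assms, of 0 x] by simp
qed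

section \<open>Homogeneity: Euler's identity and derivatives of harmonics\<close>

text \<open>Differentiate p (t x) in t at t = 1, once by the chain rule and once by
  homogeneity.\<close>

lemma euler_identity:
  assumes "cpoly p" and hom: "\<And>t x. p (t *\<^sub>R x) = complex_of_real (t ^ k) * p x"
  shows "(\<Sum>i\<in>UNIV. complex_of_real (x $ i) * partial_deriv i p x) = of_nat k * p x"
proof -
  let ?D = "frechet_derivative p (at x)"
  have D: "(p has_derivative ?D) (at x)"
    using assms(1) by (simp add: cpoly_differentiable flip: frechet_derivative_works)
  have "((\<lambda>t. t *\<^sub>R x) has_derivative (\<lambda>t. t *\<^sub>R x)) (at (1::real))"
    by (auto intro!: derivative_eq_intros)
  then have "((\<lambda>t. p (t *\<^sub>R x)) has_derivative (\<lambda>t. ?D (t *\<^sub>R x))) (at 1)"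
    by (rule has_derivative_compose) (simp add: D)
  moreover have "((\<lambda>t. complex_of_real (t ^ k) * p x) has_derivative
      (\<lambda>t. complex_of_real (of_nat k * t) * p x)) (at 1)"
    by (auto intro!: derivative_eq_intros simp: fun_eq_iff)
  ultimately have "(\<lambda>t. ?D (t *\<^sub>R x)) = (\<lambda>t. complex_of_real (of_nat k * t) * p x)"
    unfolding hom by (rule has_derivative_unique)
  from fun_cong[OF this, of 1] have "?D x = of_nat k * p x"
    by simp
  moreover have "?D x = (\<Sum>i\<in>UNIV. (x $ i) *\<^sub>R ?D (axis i 1))"
    using D by (intro linear_eq_sum_axis) (auto dest: has_derivative_linear)
  ultimately show ?thesis
    by (simp add: partial_deriv_def scaleR_conv_of_real)
qed

lemma spherical_harmonics_euler:
  "p \<in> spherical_harmonics k \<Longrightarrow>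
    (\<Sum>i\<in>UNIV. complex_of_real (x $ i) * partial_deriv i p x) = of_nat k * p x"
  by (rule euler_identity) (auto simp: spherical_harmonicsD)

text \<open>The chain rule for p (s x) yields the claim multiplied by s, which can be cancelled only
  for s \<noteq> 0. At 0 both sides are limits of the identity for s \<rightarrow> 0, since the
  derivative is again a polynomial and hence continuous.\<close>

lemma partial_deriv_homogeneous:
  assumes "cpoly p" and hom: "\<And>t x. p (t *\<^sub>R x) = complex_of_real (t ^ Suc k) * p x"
  shows "partial_deriv i p (t *\<^sub>R x) = complex_of_real (t ^ k) * partial_deriv i p x"
proof -
  let ?q = "partial_deriv i p"
  have nz: "?q (s *\<^sub>R x) = complex_of_real (s ^ k) * ?q x" if "s \<noteq> 0" for s x
  proof -
    let ?D = "frechet_derivative p (at (s *\<^sub>R x))" and ?E = "frechet_derivative p (at x)"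
    have D: "(p has_derivative ?D) (at (s *\<^sub>R x))" and E: "(p has_derivative ?E) (at x)"
      using assms(1) by (simp_all add: cpoly_differentiable flip: frechet_derivative_works)
    have "((\<lambda>x. s *\<^sub>R x) has_derivative (\<lambda>x. s *\<^sub>R x)) (at x)"
      by (auto intro!: derivative_eq_intros)
    then have "((\<lambda>x. p (s *\<^sub>R x)) has_derivative (\<lambda>h. ?D (s *\<^sub>R h))) (at x)"
      by (rule has_derivative_compose) (simp add: D)
    moreover have "((\<lambda>x. complex_of_real (s ^ Suc k) * p x) has_derivative
        (\<lambda>h. complex_of_real (s ^ Suc k) * ?E h)) (at x)"
      using E by (rule has_derivative_mult_right)
    ultimately have "(\<lambda>h. ?D (s *\<^sub>R h)) = (\<lambda>h. complex_of_real (s ^ Suc k) * ?E h)"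
      unfolding hom by (rule has_derivative_unique)
    moreover have "?D (s *\<^sub>R h) = s *\<^sub>R ?D h" for h
      using D by (simp add: linear_cmul has_derivative_linear)
    ultimately have "s *\<^sub>R ?D (axis i 1) = complex_of_real (s ^ Suc k) * ?E (axis i 1)"
      by (metis (no_types, lifting))
    then show ?thesis
      using that by (simp add: partial_deriv_def scaleR_conv_of_real)
  qed
  show ?thesis
  proof (cases "t = 0")
    case True
    have c: "isCont ?q y" for y
      using cpoly_continuous[OF cpoly_partial_deriv[OF assms(1)], of UNIV i] by (simp add: continuous_on_eq_continuous_at)
    have "((\<lambda>s. ?q (s *\<^sub>R x)) \<longlongrightarrow> ?q (0 *\<^sub>R x)) (at (0::real))"
      by (rule isCont_tendsto_compose[OF c]) (auto intro!: tendsto_eq_intros)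
    moreover have "((\<lambda>s. complex_of_real (s ^ k) * ?q x) \<longlongrightarrow> complex_of_real (0 ^ k) * ?q x) (at (0::real))"
      by (intro tendsto_intros)
    moreover have "\<forall>\<^sub>F s in at (0::real). complex_of_real (s ^ k) * ?q x = ?q (s *\<^sub>R x)"
      unfolding eventually_at_filter by (intro always_eventually allI impI nz[symmetric])
    ultimately have "((\<lambda>s. ?q (s *\<^sub>R x)) \<longlongrightarrow> ?q (0 *\<^sub>R x)) (at (0::real))"
      and "((\<lambda>s. ?q (s *\<^sub>R x)) \<longlongrightarrow> complex_of_real (0 ^ k) * ?q x) (at (0::real))"
      by (blast, blast intro: Lim_transform_eventually)
    then have "?q (0 *\<^sub>R x) = complex_of_real (0 ^ k) * ?q x"
      by (intro tendsto_unique[OF trivial_limit_at])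
    then show ?thesis using True by simp
  qed (use nz in auto)
qed

lemma laplacian_partial_deriv:
  assumes "cpoly p" shows "laplacian (partial_deriv i p) x = partial_deriv i (laplacian p) x"
proof -
  have "laplacian p = (\<lambda>x. \<Sum>j\<in>UNIV. partial_deriv j (partial_deriv j p) x)"
    by (auto simp: laplacian_def)
  then have "partial_deriv i (laplacian p) x = (\<Sum>j\<in>UNIV. partial_deriv i (partial_deriv j (partial_deriv j p)) x)"
    using assms by (simp add: partial_deriv_sum cpoly_partial_deriv)
  also have "\<dots> = laplacian (partial_deriv i p) x"
    unfolding laplacian_def
    using assms by (intro sum.cong refl) (metis partial_deriv_commute cpoly_partial_deriv)
  finally show ?thesis ..
qed

lemma spherical_harmonics_partial_deriv:
  assumes "p \<in> spherical_harmonics (Suc k)"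
  shows "partial_deriv i p \<in> spherical_harmonics k"
proof (rule spherical_harmonicsI)
  have "laplacian p = (\<lambda>x. 0)"
    using assms by (auto simp: spherical_harmonicsD)
  then show "laplacian (partial_deriv i p) x = 0" for x
    using assms by (simp add: laplacian_partial_deriv spherical_harmonicsD)
qed (use spherical_harmonicsD(1,2)[OF assms] in \<open>simp_all only: cpoly_partial_deriv partial_deriv_homogeneous\<close>)

section \<open>Polynomials restricted to the sphere as finite sums of harmonics\<close>

lemma laplacian_norm_sq:
  "laplacian (\<lambda>y. (complex_of_real (norm y))\<^sup>2) x = 2 * of_nat CARD('n)" for x :: "real ^ 'n"
  by (simp add: laplacian_def partial_deriv_norm_sq partial_deriv_cmult cpoly.coord)

text \<open>The Laplacian of x_i Y is twice the i-th derivative of Y, a harmonic of degree k - 1,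
  and the Laplacian of |x|^2 times a harmonic is a multiple of that harmonic. So a suitable |x|^2 q
  removes the defect: multiplication by a coordinate moves a harmonic one degree up and one degree
  down.\<close>

lemma coord_mult_spherical_harmonics:
  assumes Y: "Y \<in> spherical_harmonics k"
  shows "\<exists>p q. p \<in> spherical_harmonics (k + 1) \<and> q \<in> spherical_harmonics (k - 1) \<and>
    (\<forall>x :: real ^ 'n. complex_of_real (x $ i) * Y x = p x + (complex_of_real (norm x))\<^sup>2 * q x)"
proof (cases k)
  case 0
  \<comment> \<open>For constant Y there is nothing to correct. The witness q = 0 lies in every
    degree, so the truncated \<open>k - 1\<close> is harmless.\<close>
  then have Y0: "Y = (\<lambda>x. Y 0)" using spherical_harmonics_0D Y by blast
  have "(\<lambda>x. complex_of_real (x $ i) * Y 0) \<in> spherical_harmonics (k + 1)"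
    using 0 by (intro spherical_harmonicsI)
      (auto intro!: cpoly.intros simp: laplacian_mult cpoly.intros, auto simp: laplacian_def if_distrib[of "\<lambda>c. partial_deriv _ (\<lambda>x. c)"])
  moreover have "complex_of_real (x $ i) * Y x = complex_of_real (x $ i) * Y 0 + (complex_of_real (norm x))\<^sup>2 * 0" for x
    using fun_cong[OF Y0, of x] by simp
  ultimately show ?thesis
    using spherical_harmonics_zero by (intro exI[of _ "(\<lambda>x. complex_of_real (x $ i) * Y 0)"] exI[of _ "\<lambda>x. 0"]) auto
next
  case (Suc m)
  \<comment> \<open>For q of degree m, Euler's identity makes the Laplacian of |x|^2 q equal to (4 m
    + 2 n) q = 2 D q, to be matched with twice the derivative of Y.\<close>
  define D :: complex where "D = of_nat (CARD('n) + 2 * m)"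
  have D: "D \<noteq> 0" unfolding D_def of_nat_eq_0_iff by simp
  define q where "q = (\<lambda>x. inverse D * partial_deriv i Y x)"
  have q: "q \<in> spherical_harmonics m"
    unfolding q_def using Y Suc by (intro spherical_harmonics_cmult spherical_harmonics_partial_deriv) auto
  have cY: "cpoly Y" and cq: "cpoly q" and cn: "cpoly (\<lambda>x::real^'n. (complex_of_real (norm x))\<^sup>2)"
    using Y q by (auto simp: spherical_harmonicsD cpoly_norm_sq)
  define p where "p = (\<lambda>x. complex_of_real (x $ i) * Y x - (complex_of_real (norm x))\<^sup>2 * q x)"
  have lap: "laplacian p x = 0" for x
  proof -
    have "laplacian (\<lambda>x. complex_of_real (x $ i)) x = 0"
      by (simp add: laplacian_def if_distrib[of "\<lambda>c. partial_deriv _ (\<lambda>x. c)"] cong: if_cong)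
    then have "laplacian (\<lambda>x. complex_of_real (x $ i) * Y x) x = 2 * partial_deriv i Y x"
      using Y by (simp add: laplacian_mult cpoly.intros cY spherical_harmonicsD if_distrib[of "\<lambda>c. c * _"] cong: if_cong)
    moreover have "laplacian (\<lambda>x. (complex_of_real (norm x))\<^sup>2 * q x) x
       = 4 * (\<Sum>i\<in>UNIV. complex_of_real (x $ i) * partial_deriv i q x) + 2 * of_nat CARD('n) * q x"
      using q by (simp add: laplacian_mult cn cq spherical_harmonicsD laplacian_norm_sq partial_deriv_norm_sq
          sum_distrib_left mult_ac)
    moreover have "\<dots> = 2 * D * q x"
      unfolding spherical_harmonics_euler[OF q] D_def by (simp add: algebra_simps)
    ultimately show ?thesis
      unfolding p_def laplacian_diff[OF cpoly.mult[OF cpoly.coord cY] cpoly.mult[OF cn cq]]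
      using D by (simp add: q_def)
  qed
  have "p \<in> spherical_harmonics (k + 1)"
  proof (rule spherical_harmonicsI[OF _ _ lap], unfold p_def)
    show "cpoly (\<lambda>x. complex_of_real (x $ i) * Y x - (complex_of_real (norm x))\<^sup>2 * q x)"
      by (intro cpoly_diff cpoly.mult cpoly.coord cY cq cn)
    show "complex_of_real ((t *\<^sub>R x) $ i) * Y (t *\<^sub>R x) - (complex_of_real (norm (t *\<^sub>R x)))\<^sup>2 * q (t *\<^sub>R x) =
      complex_of_real (t ^ (k + 1)) * (complex_of_real (x $ i) * Y x - (complex_of_real (norm x))\<^sup>2 * q x)" for t x
    proof -
      have "(complex_of_real (norm (t *\<^sub>R x)))\<^sup>2 = (complex_of_real t)\<^sup>2 * (complex_of_real (norm x))\<^sup>2"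
        by (simp add: power_mult_distrib flip: of_real_power)
      then show ?thesis
        unfolding spherical_harmonicsD(2)[OF Y] spherical_harmonicsD(2)[OF q]
        by (simp only: Suc vector_scaleR_component real_scaleR_def) (simp add: algebra_simps power2_eq_square)
    qed
  qed
  with q Suc show ?thesis
    by (intro exI[of _ p] exI[of _ q]) (auto simp: p_def)
qed

text \<open>Equality is demanded on the unit sphere only: there |x|^2 = 1, so the term |x|^2 q of
  \<open>coord_mult_spherical_harmonics\<close> is itself a harmonic, and the notion becomes stable
  under multiplication by coordinates.\<close>

definition harmonic_sum :: "(real ^ 'n \<Rightarrow> complex) \<Rightarrow> bool" where
  "harmonic_sum p \<longleftrightarrow> (\<exists>N Y. (\<forall>k. Y k \<in> spherical_harmonics k) \<and>
     (\<forall>x\<in>sphere 0 1. p x = (\<Sum>k<N. Y k x)))"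

lemma harmonic_sum_spherical_harmonics:
  assumes "Y \<in> spherical_harmonics k" shows "harmonic_sum Y"
  unfolding harmonic_sum_def
  by (rule exI[of _ "Suc k"], rule exI[of _ "\<lambda>l. if l = k then Y else (\<lambda>x. 0)"])
    (use assms spherical_harmonics_zero in \<open>auto simp: if_distrib[of "\<lambda>f. f _"] cong: if_cong\<close>)

lemma harmonic_sum_cong:
  assumes "harmonic_sum p" and "\<And>x. x \<in> sphere 0 1 \<Longrightarrow> p x = q x"
  shows "harmonic_sum q"
proof -
  obtain N Y where "\<forall>k. Y k \<in> spherical_harmonics k" "\<forall>x\<in>sphere 0 1. p x = (\<Sum>k<N. Y k x)"
    using assms(1) unfolding harmonic_sum_def by blast
  then show ?thesis
    unfolding harmonic_sum_def using assms(2) by (intro exI[of _ N] exI[of _ Y]) simp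
qed

lemma harmonic_sum_add:
  assumes "harmonic_sum p" "harmonic_sum q"
  shows "harmonic_sum (\<lambda>x. p x + q x)"
proof -
  from assms obtain N Y M X where
    Y: "\<forall>k. Y k \<in> spherical_harmonics k" "\<forall>x\<in>sphere 0 1. p x = (\<Sum>k<N. Y k x)" and
    X: "\<forall>k. X k \<in> spherical_harmonics k" "\<forall>x\<in>sphere 0 1. q x = (\<Sum>k<M. X k x)"
    unfolding harmonic_sum_def by metis
  define W where "W k = (\<lambda>x. (if k < N then 1 else 0) * Y k x + (if k < M then 1 else 0) * X k x)" for k
  have "W k \<in> spherical_harmonics k" for k
    unfolding W_def using X Y by (intro spherical_harmonics_add spherical_harmonics_cmult) auto
  moreover have "(\<Sum>k<N + M. W k x) = (\<Sum>k<N. Y k x) + (\<Sum>k<M. X k x)" for x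
  proof -
    have "(\<Sum>k<N + M. (if k < N then 1 else 0) * Y k x) = (\<Sum>k<N. Y k x)"
      by (rule sum.mono_neutral_cong_right) auto
    moreover have "(\<Sum>k<N + M. (if k < M then 1 else 0) * X k x) = (\<Sum>k<M. X k x)"
      by (rule sum.mono_neutral_cong_right) auto
    ultimately show ?thesis
      unfolding W_def by (simp add: sum.distrib)
  qed
  ultimately show ?thesis
    unfolding harmonic_sum_def using X Y by (intro exI[of _ "N + M"] exI[of _ W]) auto
qed

lemma harmonic_sum_sum:
  "finite I \<Longrightarrow> (\<And>i. i \<in> I \<Longrightarrow> harmonic_sum (p i)) \<Longrightarrow> harmonic_sum (\<lambda>x. \<Sum>i\<in>I. p i x)"
  by (induction I rule: finite_induct)
    (auto intro: harmonic_sum_add harmonic_sum_spherical_harmonics spherical_harmonics_const)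

lemma harmonic_sum_multiplier:
  assumes "\<And>k Y. Y \<in> spherical_harmonics k \<Longrightarrow> harmonic_sum (\<lambda>x. q x * Y x)" and "harmonic_sum p"
  shows "harmonic_sum (\<lambda>x. q x * p x)"
proof -
  obtain N Y where Y: "\<forall>k. Y k \<in> spherical_harmonics k" "\<forall>x\<in>sphere 0 1. p x = (\<Sum>k<N. Y k x)"
    using assms(2) unfolding harmonic_sum_def by metis
  have "harmonic_sum (\<lambda>x. \<Sum>k<N. q x * Y k x)"
    using assms(1) Y(1) by (intro harmonic_sum_sum) auto
  then show ?thesis
    by (rule harmonic_sum_cong) (simp add: Y(2) sum_distrib_left)
qed

text \<open>Induction on the multiplier with p arbitrary: a product of multipliers is applied one
  factor after the other, and only a coordinate requires work.\<close>

lemma harmonic_sum_cpoly_mult: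
  "cpoly q \<Longrightarrow> harmonic_sum p \<Longrightarrow> harmonic_sum (\<lambda>x. q x * p x)"
proof (induction arbitrary: p rule: cpoly.induct)
  case (const c)
  show ?case
    by (rule harmonic_sum_multiplier[OF _ const])
      (auto intro: harmonic_sum_spherical_harmonics spherical_harmonics_cmult)
next
  case (coord i)
  show ?case
  proof (rule harmonic_sum_multiplier[OF _ coord])
    fix k and Y :: "real ^ 'a \<Rightarrow> complex" assume "Y \<in> spherical_harmonics k"
    from coord_mult_spherical_harmonics[OF this, of i] obtain p q where
      "p \<in> spherical_harmonics (k + 1)" "q \<in> spherical_harmonics (k - 1)"
      and eq: "\<And>x. complex_of_real (x $ i) * Y x = p x + (complex_of_real (norm x))\<^sup>2 * q x"
      by blast
    then have "harmonic_sum (\<lambda>x. p x + q x)"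
      by (intro harmonic_sum_add) (auto intro: harmonic_sum_spherical_harmonics)
    then show "harmonic_sum (\<lambda>x. complex_of_real (x $ i) * Y x)"
      by (rule harmonic_sum_cong) (simp add: eq)
  qed
next
  case (add q1 q2)
  then show ?case by (auto simp: distrib_right intro!: harmonic_sum_add)
next
  case (mult q1 q2)
  then show ?case by (auto simp: mult.assoc)
qed

lemma harmonic_sum_cpoly: "cpoly p \<Longrightarrow> harmonic_sum p"
  using harmonic_sum_cpoly_mult[OF _ harmonic_sum_spherical_harmonics[OF spherical_harmonics_const[of 1]], of p]
  by simp

text \<open>With \<open>E\<close> the sum of x_i d_i Y and \<open>H\<close> the sum of x_i x_j d_i
  d_j Y, expanding both rotations gives |x|^2 times the Laplacian, minus H, minus (n - 1) E. The
  Laplacian vanishes, and Euler's identity for Y and for its derivatives gives E = k Y and H = (k -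
  1) E.\<close>

lemma angular_laplacian_spherical_harmonics:
  fixes Y :: "real ^ 'n \<Rightarrow> complex"
  assumes Y: "Y \<in> spherical_harmonics k"
  shows "angular_laplacian Y x = - of_nat (k * (k + CARD('n) - 2)) * Y x"
proof -
  let ?x = "\<lambda>i. complex_of_real (x $ i)" and ?d = "\<lambda>i. partial_deriv i Y"
  let ?dd = "\<lambda>i j. partial_deriv i (partial_deriv j Y) x"
  have cY: "cpoly Y" using Y by (simp add: spherical_harmonicsD)
  have cd: "cpoly (?d i)" for i using cY by (rule cpoly_partial_deriv)
  have pO: "partial_deriv l (Omega i j Y) x = ?x i * ?dd l j + (if l = i then 1 else 0) * ?d j x
     - (?x j * ?dd l i + (if l = j then 1 else 0) * ?d i x)" for i j l
    unfolding Omega_def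
    by (simp add: partial_deriv_diff partial_deriv_mult cpoly.intros cd)
  define E where "E = (\<Sum>i\<in>UNIV. ?x i * ?d i x)"
  define H where "H = (\<Sum>i\<in>UNIV. \<Sum>j\<in>UNIV. ?x i * (?x j * ?dd i j))"
  have E: "E = of_nat k * Y x"
    unfolding E_def by (rule spherical_harmonics_euler[OF Y])
  \<comment> \<open>Euler's identity in degree k - 1. For k = 0 the derivatives of Y vanish, so the
    truncated subtraction does no harm.\<close>
  have Hj: "(\<Sum>i\<in>UNIV. ?x i * ?dd i j) = of_nat (k - 1) * ?d j x" for j
  proof (cases k)
    case 0
    then have "Y = (\<lambda>x. Y 0)" using spherical_harmonics_0D Y by blast
    then have "?d j = (\<lambda>x. 0)" by (metis partial_deriv_const)
    then show ?thesis by simp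
  next
    case (Suc m)
    then show ?thesis using spherical_harmonics_euler[OF spherical_harmonics_partial_deriv, of Y m x j] Y by simp
  qed
  have "H = (\<Sum>j\<in>UNIV. \<Sum>i\<in>UNIV. ?x i * (?x j * ?dd i j))"
    unfolding H_def by (rule sum.swap)
  also have "\<dots> = (\<Sum>j\<in>UNIV. ?x j * (\<Sum>i\<in>UNIV. ?x i * ?dd i j))"
    by (simp add: sum_distrib_left mult_ac)
  also have "\<dots> = of_nat (k - 1) * E"
    by (simp add: Hj E_def sum_distrib_left mult_ac)
  finally have H: "H = of_nat (k - 1) * E" .
  have H': "(\<Sum>i\<in>UNIV. \<Sum>j\<in>UNIV. ?x i * (?x j * ?dd j i)) = H"
    unfolding H_def by (subst sum.swap) (simp add: mult_ac)
  have lap: "(\<Sum>j\<in>UNIV. ?dd j j) = 0"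
    using spherical_harmonicsD(3)[OF Y, of x] by (simp add: laplacian_def)
  have "(\<Sum>i\<in>UNIV. \<Sum>j\<in>UNIV. ?x i * (?x i * ?dd j j)) = (\<Sum>i\<in>UNIV. ?x i * (?x i * (\<Sum>j\<in>UNIV. ?dd j j)))"
    by (simp only: sum_distrib_left)
  then have L: "(\<Sum>i\<in>UNIV. \<Sum>j\<in>UNIV. ?x i * (?x i * ?dd j j)) = 0"
    unfolding lap by simp
  then have L': "(\<Sum>i\<in>UNIV. \<Sum>j\<in>UNIV. ?x j * (?x j * ?dd i i)) = 0"
    by (subst sum.swap)
  have delta: "(\<Sum>j\<in>UNIV. (if j = i then 1 else 0) * f j) = f i" for f :: "'n \<Rightarrow> complex" and i
    by (simp add: if_distrib[of "\<lambda>c. c * _"] cong: if_cong)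
  have E1: "(\<Sum>i\<in>UNIV. \<Sum>j\<in>(UNIV :: 'n set). ?x i * ?d i x) = of_nat CARD('n) * E"
    by (simp add: E_def sum_distrib_left)
  have E2: "(\<Sum>i\<in>(UNIV :: 'n set). \<Sum>j\<in>UNIV. ?x j * ?d j x) = of_nat CARD('n) * E"
    by (simp add: E_def)
  have "(\<Sum>i\<in>UNIV. \<Sum>j\<in>UNIV. Omega i j (Omega i j Y) x) =
     (\<Sum>i\<in>UNIV. \<Sum>j\<in>UNIV. ?x i * (?x i * ?dd j j) + (if j = i then 1 else 0) * (?x i * ?d j x)
        - ?x i * (?x j * ?dd j i) - ?x i * ?d i x
        - (?x i * (?x j * ?dd i j) + ?x j * ?d j x - ?x j * (?x j * ?dd i i) - (if j = i then 1 else 0) * (?x j * ?d i x)))"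
    by (intro sum.cong refl, subst (1) Omega_def) (auto simp add: pO algebra_simps)
  also have "\<dots> = 2 * E - 2 * H - 2 * of_nat CARD('n) * E"
    unfolding sum.distrib sum_subtractf L L' H' E1 E2 delta H_def[symmetric] E_def[symmetric] by simp
  finally have "angular_laplacian Y x = E - H - of_nat CARD('n) * E"
    unfolding angular_laplacian_def by simp
  also have "\<dots> = (1 - of_nat (k - 1) - of_nat CARD('n)) * of_nat k * Y x"
    by (simp add: H E algebra_simps)
  also have "\<dots> = - of_nat (k * (k + CARD('n) - 2)) * Y x"
  \<comment> \<open>The eigenvalue contains a subtraction of natural numbers. It does not truncate
    for k \<ge> 1, and for k = 0 it is multiplied by 0.\<close>
  proof (cases k)
    case (Suc m)
    have "Suc m + CARD('n) - 2 = m + (CARD('n) - 1)" by simp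
    moreover have "of_nat (CARD('n) - 1) = (of_nat CARD('n) - 1 :: complex)"
      by (subst of_nat_diff) (simp_all add: Suc_le_eq)
    ultimately have w: "(of_nat (Suc m + CARD('n) - 2) :: complex) = of_nat m + of_nat CARD('n) - 1"
      by (simp only: of_nat_add add_diff_eq)
    show ?thesis
      unfolding Suc of_nat_mult w by (simp add: algebra_simps)
  qed simp
  finally show ?thesis .
qed

section \<open>Surface measure and polar coordinates\<close>

lemma sets_surface_measure [measurable_cong]:
  "sets surface_measure = sets (restrict_space borel (sphere 0 1))"
  by (simp add: surface_measure_def)

lemma space_surface_measure: "space surface_measure = sphere 0 1"
  by (simp add: surface_measure_def space_scale_measure space_restrict_space)

lemma borel_measurable_surface_measure:
  "f \<in> borel_measurable borel \<Longrightarrow> f \<in> borel_measurable surface_measure"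
  by (subst measurable_cong_sets[OF sets_surface_measure refl]) (rule measurable_restrict_space1)

lemma measurable_ident_surface_measure: "(\<lambda>x. x) \<in> surface_measure \<rightarrow>\<^sub>M borel"
  by (rule borel_measurable_surface_measure) simp

lemma sgn_borel_measurable [measurable]:
  "(sgn :: real ^ 'n \<Rightarrow> real ^ 'n) \<in> borel_measurable borel"
proof -
  have "(\<lambda>x :: real ^ 'n. x /\<^sub>R norm x) \<in> borel_measurable borel" by measurable
  then show ?thesis by (simp add: sgn_div_norm[abs_def])
qed

lemma measurable_sgn_surface_measure:
  "sgn \<in> restrict_space lborel (A - {0 :: real ^ 'n}) \<rightarrow>\<^sub>M surface_measure"
proof (subst measurable_cong_sets[OF refl sets_surface_measure], rule measurable_restrict_space2)
  show "sgn \<in> space (restrict_space lborel (A - {0})) \<rightarrow> sphere (0 :: real ^ 'n) 1"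
    by (auto simp: space_restrict_space norm_sgn)
  show "sgn \<in> restrict_space lborel (A - {0}) \<rightarrow>\<^sub>M (borel :: (real ^ 'n) measure)"
    by (rule measurable_restrict_space1) (simp add: sgn_borel_measurable)
qed

lemma sets_surface_measure_borel: "B \<in> sets surface_measure \<Longrightarrow> B \<in> sets borel"
  by (auto simp: sets_surface_measure sets_restrict_space)

lemma emeasure_surface_measure:
  fixes B :: "(real ^ 'n) set"
  assumes B: "B \<in> sets surface_measure"
  shows "emeasure surface_measure B = of_nat CARD('n) * emeasure lborel {x. x \<noteq> 0 \<and> norm x \<le> 1 \<and> sgn x \<in> B}"
proof -
  let ?R = "restrict_space lborel (cball 0 1 - {0 :: real ^ 'n})"
  have sgn: "sgn \<in> ?R \<rightarrow>\<^sub>M restrict_space borel (sphere 0 1)"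
    using measurable_sgn_surface_measure[of "cball 0 1"]
    by (simp add: measurable_cong_sets[OF refl sets_surface_measure])
  have "emeasure surface_measure B = of_nat CARD('n) * emeasure (distr ?R (restrict_space borel (sphere 0 1)) sgn) B"
    by (simp add: surface_measure_def)
  also have "emeasure (distr ?R (restrict_space borel (sphere 0 1)) sgn) B = emeasure ?R (sgn -` B \<inter> space ?R)"
    using B by (intro emeasure_distr sgn) (simp add: sets_surface_measure)
  also have "\<dots> = emeasure lborel (sgn -` B \<inter> space ?R)"
    by (intro emeasure_restrict_space) (auto simp: space_restrict_space)
  also have "sgn -` B \<inter> space ?R = {x. x \<noteq> 0 \<and> norm x \<le> 1 \<and> sgn x \<in> B}"
    by (auto simp: space_restrict_space)
  finally show ?thesis .
qed

lemma finite_measure_surface_measure: "finite_measure surface_measure"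
proof
  have "emeasure surface_measure (space surface_measure :: (real ^ 'a) set)
      \<le> of_nat CARD('a) * emeasure lborel (cball (0 :: real ^ 'a) 1)"
    by (subst emeasure_surface_measure) (auto intro!: mult_left_mono emeasure_mono)
  also have "\<dots> < \<infinity>"
    using emeasure_compact_finite[of "cball (0 :: real ^ 'a) 1"]
    by (auto simp: ennreal_mult_less_top ennreal_of_nat_eq_real_of_nat)
  finally show "emeasure surface_measure (space surface_measure :: (real ^ 'a) set) \<noteq> \<infinity>"
    by simp
qed

interpretation surface: finite_measure surface_measure
  by (rule finite_measure_surface_measure)

section \<open>Lebesgue measure in polar coordinates\<close>

definition radial_measure :: "nat \<Rightarrow> real measure" where
  "radial_measure d = density lborel (\<lambda>r. ennreal (indicator {0<..} r * r ^ (d - 1)))"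

lemma sets_radial_measure [simp, measurable_cong]: "sets (radial_measure d) = sets borel"
  by (simp add: radial_measure_def)

lemma sigma_finite_radial_measure: "sigma_finite_measure (radial_measure d)"
  unfolding radial_measure_def by (subst sigma_finite_measure.sigma_finite_iff_density_finite[OF sigma_finite_lborel]) auto

lemma emeasure_radial_measure_atMost:
  assumes "0 < d" "0 \<le> r"
  shows "emeasure (radial_measure d) {..r} = ennreal (r ^ d / d)"
proof -
  have "emeasure (radial_measure d) {..r}
      = (\<integral>\<^sup>+x. ennreal (indicator {0<..} x * x ^ (d - 1)) * indicator {..r} x \<partial>lborel)"
    unfolding radial_measure_def by (subst emeasure_density) auto
  also have "\<dots> = (\<integral>\<^sup>+x. ennreal (x ^ (d - 1)) * indicator {0..r} x \<partial>lborel)"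
    using AE_lborel_singleton[of "0 :: real"]
    by (intro nn_integral_cong_AE) (auto elim!: eventually_mono simp: indicator_def)
  also have "\<dots> = ennreal (r ^ d / d - 0 ^ d / d)"
    using assms by (intro nn_integral_FTC_Icc) (auto intro!: derivative_eq_intros)
  finally show ?thesis using assms by (simp add: power_0_left)
qed

lemma emeasure_lborel_scaleR:
  fixes B :: "(real ^ 'n) set"
  assumes "0 < c" "B \<in> sets borel"
  shows "emeasure lborel B = ennreal (c ^ CARD('n)) * emeasure lborel {x. c *\<^sub>R x \<in> B}"
proof -
  have "emeasure lborel B = emeasure (density (distr lborel borel (\<lambda>x. 0 + c *\<^sub>R x)) (\<lambda>_. \<bar>c\<bar>^DIM(real ^ 'n))) B"
    using assms by (subst lborel_affine[of c 0]) auto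
  also have "\<dots> = ennreal (c ^ CARD('n)) * emeasure (distr lborel borel (\<lambda>x. c *\<^sub>R x)) B"
    using assms by (simp add: emeasure_density_const)
  also have "emeasure (distr lborel borel (\<lambda>x. c *\<^sub>R x)) B = emeasure lborel {x. c *\<^sub>R x \<in> B}"
    using assms by (subst emeasure_distr) (auto simp: vimage_def)
  finally show ?thesis .
qed

text \<open>Dilation by r carries the unit sector to the sector of radius r; dividing by the
  dimension undoes the normalising factor in \<open>surface_measure\<close>.\<close>

lemma emeasure_lborel_sector:
  fixes B :: "(real ^ 'n) set"
  assumes B: "B \<in> sets surface_measure" and r: "0 \<le> r"
  shows "emeasure lborel {x. x \<noteq> 0 \<and> norm x \<le> r \<and> sgn x \<in> B}
    = ennreal (r ^ CARD('n) / CARD('n)) * emeasure surface_measure B"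
proof (cases "r = 0")
  case False
  then have r: "0 < r" using r by simp
  let ?P = "\<lambda>r. {x :: real ^ 'n. x \<noteq> 0 \<and> norm x \<le> r \<and> sgn x \<in> B}"
  have [measurable]: "B \<in> sets borel" using B by (rule sets_surface_measure_borel)
  have P: "?P r \<in> sets borel" by measurable
  have "{x. r *\<^sub>R x \<in> ?P r} = ?P 1"
    using r by (auto simp: sgn_scaleR)
  with emeasure_lborel_scaleR[OF r P] have "emeasure lborel (?P r) = ennreal (r ^ CARD('n)) * emeasure lborel (?P 1)"
    by simp
  moreover have "ennreal (r ^ CARD('n) / CARD('n)) * (of_nat CARD('n) * e) = ennreal (r ^ CARD('n)) * e" for e
    using r by (simp add: mult.assoc[symmetric] ennreal_of_nat_eq_real_of_nat flip: ennreal_mult)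
  ultimately show ?thesis
    by (simp add: emeasure_surface_measure[OF B])
next
  case True
  then have "{x. x \<noteq> 0 \<and> norm x \<le> r \<and> sgn x \<in> B} = {}" by auto
  with True show ?thesis by (simp only: emeasure_empty) (simp add: power_0_left)
qed

text \<open>A product of \<sigma>-finite measures is determined by its values on rectangles A
  \<times> B. For fixed B both sides are measures in A, which are compared on half-lines {..r},
  where each is the volume of a sector. The origin is removed because \<open>sgn 0\<close> does not
  lie on the sphere.\<close>

lemma polar_pair_measure:
  "radial_measure CARD('n) \<Otimes>\<^sub>M surface_measure =
    distr (restrict_space lborel (UNIV - {0})) (radial_measure CARD('n) \<Otimes>\<^sub>M surface_measure)
      (\<lambda>x :: real ^ 'n. (norm x, sgn x))"
proof (rule pair_measure_eqI)
  let ?L = "restrict_space lborel (UNIV - {0 :: real ^ 'n})"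
  let ?N = "radial_measure CARD('n) \<Otimes>\<^sub>M (surface_measure :: (real ^ 'n) measure)"
  have nm: "norm \<in> ?L \<rightarrow>\<^sub>M radial_measure CARD('n)"
    by (subst measurable_cong_sets[OF refl sets_radial_measure]) (rule measurable_restrict_space1, simp)
  have [measurable]: "(\<lambda>x. (norm x, sgn x)) \<in> ?L \<rightarrow>\<^sub>M ?N"
    using nm measurable_sgn_surface_measure[of UNIV] by (rule measurable_Pair)
  fix A :: "real set" and B :: "(real ^ 'n) set"
  assume A: "A \<in> sets (radial_measure CARD('n))" and B: "B \<in> sets surface_measure"
  have [measurable]: "B \<in> sets borel" using B by (rule sets_surface_measure_borel)
  define S where "S = UNIV \<inter> {x :: real ^ 'n. x \<noteq> 0 \<and> sgn x \<in> B}"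
  have S [measurable]: "S \<in> sets borel" unfolding S_def by measurable
  let ?M = "density (distr (restrict_space lborel S) borel norm) (\<lambda>_. 1)"
  have eq: "scale_measure (emeasure surface_measure B) (radial_measure CARD('n)) = distr (restrict_space lborel S) borel norm"
  proof (rule measure_eqI_generator_eq[where \<Omega> = UNIV and E = "range (\<lambda>a :: real. {..a})" and A = "\<lambda>i. {..real i}"])
    have atMost: "emeasure (distr (restrict_space lborel S) borel norm) {..r}
        = emeasure lborel {x. x \<noteq> 0 \<and> norm x \<le> r \<and> sgn x \<in> B}" for r
    proof -
      have "emeasure (distr (restrict_space lborel S) borel norm) {..r}
        = emeasure (restrict_space lborel S) (norm -` {..r} \<inter> space (restrict_space lborel S))"
        by (rule emeasure_distr) (auto intro: measurable_restrict_space1)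
      also have "\<dots> = emeasure lborel (norm -` {..r} \<inter> space (restrict_space lborel S))"
        by (rule emeasure_restrict_space) (auto simp: space_restrict_space)
      also have "norm -` {..r} \<inter> space (restrict_space lborel S) = {x. x \<noteq> 0 \<and> norm x \<le> r \<and> sgn x \<in> B}"
        by (auto simp: space_restrict_space S_def)
      finally show ?thesis .
    qed
    fix X assume "X \<in> range (\<lambda>a :: real. {..a})"
    then obtain r where X: "X = {..r}" by auto
    show "emeasure (scale_measure (emeasure surface_measure B) (radial_measure CARD('n))) X
      = emeasure (distr (restrict_space lborel S) borel norm) X"
    proof (cases "0 \<le> r")
      case True
      then show ?thesis
        unfolding X atMost by (simp add: emeasure_lborel_sector[OF B] emeasure_radial_measure_atMost mult.commute)
    next
      case False
      have "emeasure lborel {x. x \<noteq> 0 \<and> norm x \<le> r \<and> sgn x \<in> B} = emeasure lborel ({} :: (real ^ 'n) set)"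
        by (intro arg_cong[where f = "emeasure lborel"]) (use False order_trans[OF norm_ge_zero] in auto)
      moreover have "emeasure (radial_measure CARD('n)) {..r} \<le> emeasure (radial_measure CARD('n)) {..0}"
        using False by (intro emeasure_mono) auto
      then have "emeasure (radial_measure CARD('n)) {..r} = 0"
        by (simp add: emeasure_radial_measure_atMost power_0_left)
      ultimately show ?thesis
        unfolding X atMost by simp
    qed
  next
    fix i
    show "emeasure (scale_measure (emeasure surface_measure B) (radial_measure CARD('n))) {..real i} \<noteq> \<infinity>"
      by (simp add: emeasure_radial_measure_atMost ennreal_mult_eq_top_iff)
  next
    show "(\<Union>i. {..real i}) = UNIV" using real_arch_simple by auto
    show "Int_stable (range (\<lambda>a :: real. {..a}))"
      by (auto simp: Int_stable_def)
  qed (auto simp: borel_eq_atMost)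
  have "emeasure (radial_measure CARD('n)) A * emeasure surface_measure B
    = emeasure (distr (restrict_space lborel S) borel norm) A"
    unfolding eq[symmetric] by (simp add: mult.commute)
  also have "\<dots> = emeasure (restrict_space lborel S) (norm -` A \<inter> space (restrict_space lborel S))"
    using A by (intro emeasure_distr) (auto intro: measurable_restrict_space1)
  also have "\<dots> = emeasure lborel (norm -` A \<inter> space (restrict_space lborel S))"
    by (rule emeasure_restrict_space) (auto simp: space_restrict_space)
  also have "norm -` A \<inter> space (restrict_space lborel S) = (\<lambda>x. (norm x, sgn x)) -` (A \<times> B) \<inter> space ?L"
    by (auto simp: space_restrict_space S_def)
  also have "emeasure lborel \<dots> = emeasure ?L \<dots>"
    by (rule emeasure_restrict_space[symmetric]) (auto simp: space_restrict_space)
  also have "\<dots> = emeasure (distr ?L ?N (\<lambda>x. (norm x, sgn x))) (A \<times> B)"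
    using A B by (intro emeasure_distr[symmetric]) auto
  finally show "emeasure (radial_measure CARD('n)) A * emeasure surface_measure B = \<dots>" .
qed (simp_all add: sigma_finite_radial_measure surface.sigma_finite_measure_axioms)

interpretation polar: pair_sigma_finite "radial_measure d" surface_measure
  by (simp add: pair_sigma_finite_def sigma_finite_radial_measure surface.sigma_finite_measure_axioms)

lemma measurable_polar [measurable]:
  "(\<lambda>(r, \<omega> :: real ^ 'n). r *\<^sub>R \<omega>) \<in> radial_measure d \<Otimes>\<^sub>M surface_measure \<rightarrow>\<^sub>M borel"
proof -
  have [measurable]: "fst \<in> radial_measure d \<Otimes>\<^sub>M (surface_measure :: (real ^ 'n) measure) \<rightarrow>\<^sub>M borel"
    using measurable_fst[of "radial_measure d"] by (simp cong: measurable_cong_sets)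
  have [measurable]: "snd \<in> radial_measure d \<Otimes>\<^sub>M (surface_measure :: (real ^ 'n) measure) \<rightarrow>\<^sub>M borel"
    by (rule measurable_compose[OF measurable_snd measurable_ident_surface_measure])
  show ?thesis unfolding split_beta' by measurable
qed

text \<open>Scaling inverts the map of \<open>polar_pair_measure\<close>, since |x| sgn x = x. The
  composed push-forward is therefore Lebesgue measure off the origin, and the origin is a null
  set.\<close>

lemma lborel_polar:
  "distr (radial_measure CARD('n) \<Otimes>\<^sub>M surface_measure) borel (\<lambda>(r, \<omega>). r *\<^sub>R \<omega>) = (lborel :: (real ^ 'n) measure)"
proof (rule measure_eqI)
  let ?L = "restrict_space lborel (UNIV - {0 :: real ^ 'n})"
  let ?N = "radial_measure CARD('n) \<Otimes>\<^sub>M (surface_measure :: (real ^ 'n) measure)"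
  have nm: "norm \<in> ?L \<rightarrow>\<^sub>M radial_measure CARD('n)"
    by (subst measurable_cong_sets[OF refl sets_radial_measure]) (rule measurable_restrict_space1, simp)
  have p: "(\<lambda>x. (norm x, sgn x)) \<in> ?L \<rightarrow>\<^sub>M ?N"
    using nm measurable_sgn_surface_measure[of UNIV] by (rule measurable_Pair)
  fix X assume "X \<in> sets (distr ?N borel (\<lambda>(r, \<omega>). r *\<^sub>R \<omega>))"
  then have X [measurable]: "X \<in> sets borel" by simp
  have "emeasure (distr ?N borel (\<lambda>(r, \<omega>). r *\<^sub>R \<omega>)) X =
    emeasure (distr (distr ?L ?N (\<lambda>x. (norm x, sgn x))) borel (\<lambda>(r, \<omega>). r *\<^sub>R \<omega>)) X"
    by (subst polar_pair_measure) (rule refl)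
  also have "\<dots> = emeasure (distr ?L borel ((\<lambda>(r, \<omega>). r *\<^sub>R \<omega>) \<circ> (\<lambda>x. (norm x, sgn x)))) X"
    using p by (subst distr_distr) simp_all
  also have "\<dots> = emeasure ?L (((\<lambda>(r, \<omega>). r *\<^sub>R \<omega>) \<circ> (\<lambda>x. (norm x, sgn x))) -` X \<inter> space ?L)"
    using p measurable_comp[OF p measurable_polar] by (intro emeasure_distr X) (simp add: comp_def)
  also have "((\<lambda>(r, \<omega>). r *\<^sub>R \<omega>) \<circ> (\<lambda>x. (norm x, sgn x))) -` X \<inter> space ?L = X - {0}"
    by (auto simp: space_restrict_space sgn_div_norm)
  also have "emeasure ?L (X - {0}) = emeasure lborel (X - {0})"
    by (rule emeasure_restrict_space) auto
  also have "\<dots> = emeasure lborel X"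
    using AE_lborel_singleton[of "0 :: real ^ 'n"] by (intro emeasure_eq_AE) auto
  finally show "emeasure (distr ?N borel (\<lambda>(r, \<omega>). r *\<^sub>R \<omega>)) X = emeasure lborel X" .
qed simp

lemma nn_integral_polar:
  fixes f :: "real ^ 'n \<Rightarrow> ennreal"
  assumes [measurable]: "f \<in> borel_measurable borel"
  shows "(\<integral>\<^sup>+x. f x \<partial>lborel) = (\<integral>\<^sup>+r. \<integral>\<^sup>+\<omega>. f (r *\<^sub>R \<omega>) \<partial>surface_measure \<partial>radial_measure CARD('n))"
proof -
  have "(\<integral>\<^sup>+x. f x \<partial>lborel) = (\<integral>\<^sup>+z. f (case z of (r, \<omega>) \<Rightarrow> r *\<^sub>R \<omega>) \<partial>(radial_measure CARD('n) \<Otimes>\<^sub>M surface_measure))"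
    by (subst lborel_polar[symmetric]) (simp add: nn_integral_distr)
  also have "\<dots> = (\<integral>\<^sup>+r. \<integral>\<^sup>+\<omega>. f (case (r, \<omega>) of (r, \<omega>) \<Rightarrow> r *\<^sub>R \<omega>) \<partial>surface_measure \<partial>radial_measure CARD('n))"
    by (subst surface.nn_integral_fst[symmetric]) auto
  finally show ?thesis by simp
qed

lemma nn_integral_radial_measure:
  assumes [measurable]: "f \<in> borel_measurable borel"
  shows "(\<integral>\<^sup>+r. f r \<partial>radial_measure d) = (\<integral>\<^sup>+r. ennreal (indicator {0<..} r * r ^ (d - 1)) * f r \<partial>lborel)"
  unfolding radial_measure_def by (subst nn_integral_density) auto

lemma integral_polar:
  fixes f :: "real ^ 'n \<Rightarrow> complex"
  assumes f: "integrable lborel f"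
  shows "(\<integral>x. f x \<partial>lborel) = (\<integral>r. \<integral>\<omega>. f (r *\<^sub>R \<omega>) \<partial>surface_measure \<partial>radial_measure CARD('n))"
proof -
  let ?N = "radial_measure CARD('n) \<Otimes>\<^sub>M (surface_measure :: (real ^ 'n) measure)"
  have [measurable]: "f \<in> borel_measurable borel" using f by (auto dest: borel_measurable_integrable)
  have "(\<integral>x. f x \<partial>lborel) = (\<integral>z. f (case z of (r, \<omega>) \<Rightarrow> r *\<^sub>R \<omega>) \<partial>?N)"
    by (subst lborel_polar[symmetric]) (simp add: integral_distr)
  also have "\<dots> = (\<integral>r. \<integral>\<omega>. f (case (r, \<omega>) of (r, \<omega>) \<Rightarrow> r *\<^sub>R \<omega>) \<partial>surface_measure \<partial>radial_measure CARD('n))"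
  proof (rule polar.integral_fst'[symmetric])
    show "integrable ?N (\<lambda>z. f (case z of (r, \<omega>) \<Rightarrow> r *\<^sub>R \<omega>))"
      using f by (subst (asm) lborel_polar[symmetric]) (simp add: integrable_distr_eq)
  qed
  finally show ?thesis by simp
qed

lemma AE_radial_measure: "AE r in radial_measure d. 0 < r"
  unfolding radial_measure_def by (subst AE_density) (auto simp: indicator_def)

lemma surface_measure_pos: "0 < measure surface_measure (sphere (0 :: real ^ 'n) 1)"
proof -
  have "0 < measure lborel (ball (0 :: real ^ 'n) 1)"
    using content_ball_pos[of 1 "0 :: real ^ 'n"] by simp
  also have "measure lborel (ball (0 :: real ^ 'n) 1) \<le> measure lborel (cball (0 :: real ^ 'n) 1)"
    by (intro measure_mono_fmeasurable) (auto simp: fmeasurable_compact)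
  finally have "0 < emeasure lborel (cball (0 :: real ^ 'n) 1)"
    by (simp add: measure_def enn2real_positive_iff)
  also have "emeasure lborel (cball (0 :: real ^ 'n) 1) = emeasure lborel {x :: real ^ 'n. x \<noteq> 0 \<and> norm x \<le> 1 \<and> sgn x \<in> sphere 0 1}"
    using AE_lborel_singleton[of "0 :: real ^ 'n"] 
    by (intro emeasure_eq_AE) (auto elim!: eventually_mono simp: norm_sgn)
  also have "\<dots> = ennreal (1 ^ CARD('n) / CARD('n)) * emeasure surface_measure (sphere (0 :: real ^ 'n) 1)"
    using sets.top[of "surface_measure :: (real ^ 'n) measure"]
    by (intro emeasure_lborel_sector) (simp_all add: space_surface_measure)
  finally have "emeasure surface_measure (sphere (0 :: real ^ 'n) 1) \<noteq> 0" by (intro notI) simp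
  then show ?thesis
    using surface.emeasure_eq_measure[of "sphere (0 :: real ^ 'n) 1"] by (auto simp: zero_less_measure_iff)
qed

section \<open>Gaussian integrals of polynomials\<close>

text \<open>In polar coordinates the integral is Gamma(n) times the area of the sphere. Multiples of
  this function serve as majorants for the Gaussian integrals over the whole space and for their
  limits.\<close>

lemma integrable_exp_minus_norm: "integrable lborel (\<lambda>x :: real ^ 'n. exp (- norm x))"
proof (rule integrableI_bounded)
  have "(\<integral>\<^sup>+x. ennreal (norm (exp (- norm (x :: real ^ 'n)))) \<partial>lborel)
    = (\<integral>\<^sup>+r. \<integral>\<^sup>+\<omega>. ennreal (norm (exp (- norm (r *\<^sub>R \<omega>)))) \<partial>(surface_measure :: (real ^ 'n) measure) \<partial>radial_measure CARD('n))"
    by (rule nn_integral_polar) simp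
  also have "\<dots> = (\<integral>\<^sup>+r. ennreal (exp (- r)) * emeasure surface_measure (sphere (0 :: real ^ 'n) 1) \<partial>radial_measure CARD('n))"
  proof (intro nn_integral_cong_AE, use AE_radial_measure in eventually_elim)
    case (elim r)
    have "(\<integral>\<^sup>+\<omega>. ennreal (norm (exp (- norm (r *\<^sub>R \<omega>)))) \<partial>(surface_measure :: (real ^ 'n) measure)) =
        (\<integral>\<^sup>+\<omega>. ennreal (exp (- r)) \<partial>(surface_measure :: (real ^ 'n) measure))"
      using elim by (intro nn_integral_cong) (simp add: space_surface_measure)
    then show ?case by (simp add: space_surface_measure)
  qed
  also have "\<dots> = (\<integral>\<^sup>+r. ennreal (exp (- r)) \<partial>radial_measure CARD('n)) * emeasure surface_measure (sphere (0 :: real ^ 'n) 1)"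
    by (rule nn_integral_multc) simp
  also have "(\<integral>\<^sup>+r. ennreal (exp (- r)) \<partial>radial_measure CARD('n)) =
      (\<integral>\<^sup>+t. ennreal (indicator {0..} t * t powr (real CARD('n) - 1) / exp t) \<partial>lborel)"
  proof (subst nn_integral_radial_measure)
    show "(\<integral>\<^sup>+ r. ennreal (indicator {0<..} r * r ^ (CARD('n) - 1)) * ennreal (exp (- r)) \<partial>lborel) =
      (\<integral>\<^sup>+t. ennreal (indicator {0..} t * t powr (real CARD('n) - 1) / exp t) \<partial>lborel)"
    proof (intro nn_integral_cong_AE, use AE_lborel_singleton[of "0 :: real"] in eventually_elim)
      case (elim r)
      then show ?case
      proof (cases "0 < r")
        case True
        then have "r ^ (CARD('n) - 1) = r powr (real CARD('n) - 1)"
          by (simp add: of_nat_diff Suc_le_eq flip: powr_realpow)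
        then show ?thesis using True by (simp add: exp_minus field_simps flip: ennreal_mult)
      qed (auto simp: indicator_def)
    qed
  qed simp
  also have "\<dots> = ennreal (Gamma (real CARD('n)))"
    by (rule Gamma_conv_nn_integral_real[symmetric]) simp
  also have "\<dots> * emeasure surface_measure (sphere (0 :: real ^ 'n) 1) < \<infinity>"
  proof -
    have "emeasure surface_measure (sphere (0 :: real ^ 'n) 1) < \<infinity>"
      by (simp add: less_top[symmetric])
    then show ?thesis by (simp add: ennreal_mult_less_top)
  qed
  finally show "(\<integral>\<^sup>+x. ennreal (norm (exp (- norm (x :: real ^ 'n)))) \<partial>lborel) < \<infinity>" .
qed simp

lemma integrable_le_exp_minus_norm:
  fixes f :: "real ^ 'n \<Rightarrow> 'a :: {banach, second_countable_topology}"
  assumes "f \<in> borel_measurable borel" and "\<And>x. norm (f x) \<le> K * exp (- norm x)"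
  shows "integrable lborel f"
proof (rule Bochner_Integration.integrable_bound)
  show "integrable lborel (\<lambda>x :: real ^ 'n. K * exp (- norm x))"
    using integrable_exp_minus_norm by (rule integrable_mult_right)
  show "AE x in lborel. norm (f x) \<le> norm (K * exp (- norm x))"
    using assms(2) by (intro always_eventually allI) (metis norm_ge_zero order_trans abs_of_nonneg real_norm_def)
qed (use assms in auto)

text \<open>By translation invariance every difference quotient of F integrates to 0, and dominated
  convergence passes to the derivative. The majorant comes from the mean value inequality along the
  segment from x to x + h e.\<close>

lemma integral_directional_derivative_zero:
  fixes F G :: "real ^ 'n \<Rightarrow> complex"
  assumes D: "\<And>x. ((\<lambda>t. F (x + t *\<^sub>R e)) has_vector_derivative G x) (at 0)"
    and [measurable]: "F \<in> borel_measurable borel" "G \<in> borel_measurable borel"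
    and F: "\<And>x. cmod (F x) \<le> K * exp (- norm x)" and G: "\<And>x. cmod (G x) \<le> K * exp (- norm x)"
    and e: "norm e = 1"
  shows "(\<integral>x. G x \<partial>lborel) = 0"
proof -
  \<comment> \<open>Steps of length at most 1: moving x along \<open>e\<close> by at most 1 changes
    its norm by at most 1, so on the segment the bound on G worsens only by the factor
    \<open>exp 1\<close>.\<close>
  define h where "h m = 1 / real (Suc m)" for m
  have h: "0 < h m" "h m \<le> 1" for m by (auto simp: h_def)
  define s where "s m x = (F (x + h m *\<^sub>R e) - F x) /\<^sub>R h m" for m x
  have iF: "integrable lborel F" by (rule integrable_le_exp_minus_norm[OF _ F]) simp
  have K: "0 \<le> K" using order_trans[OF norm_ge_zero F[of 0]] by simp
  have shift: "integrable lborel (\<lambda>x. F (c + x))" "(\<integral>x. F (c + x) \<partial>lborel) = (\<integral>x. F x \<partial>lborel)" for c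
  proof -
    have "integrable (distr lborel borel ((+) c)) F" "integral\<^sup>L (distr lborel borel ((+) c)) F = (\<integral>x. F x \<partial>lborel)"
      using iF by (simp_all only: lborel_distr_plus)
    then show "integrable lborel (\<lambda>x. F (c + x))" "(\<integral>x. F (c + x) \<partial>lborel) = (\<integral>x. F x \<partial>lborel)"
      by (simp_all add: integrable_distr_eq integral_distr)
  qed
  have "(\<integral>x. s m x \<partial>lborel) = 0" for m
    using shift[of "h m *\<^sub>R e"] iF
    unfolding s_def by (simp add: add.commute)
  moreover have "(\<lambda>m. \<integral>x. s m x \<partial>lborel) \<longlonglongrightarrow> (\<integral>x. G x \<partial>lborel)"
  proof (rule integral_dominated_convergence)
    show "integrable lborel (\<lambda>x :: real ^ 'n. (K * exp 1) * exp (- norm x))"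
      using integrable_exp_minus_norm by (rule integrable_mult_right)
    show "AE x in lborel. (\<lambda>m. s m x) \<longlonglongrightarrow> G x"
    proof (intro always_eventually allI)
      fix x
      have "((\<lambda>t. F (x + t *\<^sub>R e)) has_derivative (\<lambda>t. t *\<^sub>R G x)) (at 0)"
        using D[of x] by (simp add: has_vector_derivative_def)
      then have lim: "(\<lambda>t. norm (F (x + t *\<^sub>R e) - F x - t *\<^sub>R G x) / norm t) \<midarrow>0\<rightarrow> 0"
        by (simp add: has_derivative_at)
      have "filterlim h (at 0) sequentially"
        unfolding filterlim_at using h(1) LIMSEQ_inverse_real_of_nat
        by (auto simp: h_def[abs_def] inverse_eq_divide intro!: always_eventually)
      from filterlim_compose[OF lim this]
      have "(\<lambda>m. norm (F (x + h m *\<^sub>R e) - F x - h m *\<^sub>R G x) / norm (h m)) \<longlonglongrightarrow> 0" .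
      moreover have "norm (F (x + h m *\<^sub>R e) - F x - h m *\<^sub>R G x) / norm (h m) = norm (s m x - G x)" for m
      proof -
        have "F (x + h m *\<^sub>R e) - F x - h m *\<^sub>R G x = h m *\<^sub>R (s m x - G x)"
          using h(1)[of m] by (simp add: s_def scaleR_diff_right)
        then show ?thesis using h(1)[of m] by simp
      qed
      ultimately have "(\<lambda>m. norm (s m x - G x)) \<longlonglongrightarrow> 0"
        by (simp only:)
      then show "(\<lambda>m. s m x) \<longlonglongrightarrow> G x"
        by (subst Lim_null) (rule tendsto_norm_zero_cancel)
    qed
    show "AE x in lborel. norm (s m x) \<le> (K * exp 1) * exp (- norm x)" for m
    proof (intro always_eventually allI)
      fix x
      have "norm (F (x + h m *\<^sub>R e) - F (x + 0 *\<^sub>R e)) \<le> ((K * exp 1) * exp (- norm x)) * norm (h m - 0)"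
      proof (rule differentiable_bound[where S = "{0..1}" and f' = "\<lambda>t s. s *\<^sub>R G (x + t *\<^sub>R e)"])
        fix t :: real assume t: "t \<in> {0..1}"
        have "((\<lambda>u. F ((x + t *\<^sub>R e) + u *\<^sub>R e)) has_derivative (\<lambda>u. u *\<^sub>R G (x + t *\<^sub>R e))) (at (t - t))"
          using D[of "x + t *\<^sub>R e"] by (simp add: has_vector_derivative_def)
        moreover have "((\<lambda>u. u - t) has_derivative (\<lambda>u. u)) (at t within {0..1})"
          by (auto intro!: derivative_eq_intros)
        ultimately have "((\<lambda>u. F ((x + t *\<^sub>R e) + (u - t) *\<^sub>R e)) has_derivative (\<lambda>u. u *\<^sub>R G (x + t *\<^sub>R e))) (at t within {0..1})"
          by (rule has_derivative_compose[rotated])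
        then show "((\<lambda>u. F (x + u *\<^sub>R e)) has_derivative (\<lambda>s. s *\<^sub>R G (x + t *\<^sub>R e))) (at t within {0..1})"
          by (simp add: algebra_simps)
        have "norm x \<le> norm (x + t *\<^sub>R e) + norm (t *\<^sub>R e)"
          using norm_triangle_ineq4[of "x + t *\<^sub>R e" "t *\<^sub>R e"] by simp
        then have "- norm (x + t *\<^sub>R e) \<le> 1 + - norm x" using t e by auto
        then have "K * exp (- norm (x + t *\<^sub>R e)) \<le> K * exp (1 + - norm x)"
          using K by (intro mult_left_mono) auto
        then have "cmod (G (x + t *\<^sub>R e)) \<le> (K * exp 1) * exp (- norm x)"
          using order_trans[OF G[of "x + t *\<^sub>R e"]] unfolding exp_add mult.assoc by blast
        then show "onorm (\<lambda>s. s *\<^sub>R G (x + t *\<^sub>R e)) \<le> (K * exp 1) * exp (- norm x)"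
          by (intro onorm_le) (simp add: mult.commute[of _ "norm _"] mult_right_mono)
      qed (use h[of m] in auto)
      then have "norm (F (x + h m *\<^sub>R e) - F x) / h m \<le> (K * exp 1) * exp (- norm x)"
        using h(1)[of m] by (simp add: field_simps)
      moreover have "norm (s m x) = norm (F (x + h m *\<^sub>R e) - F x) / h m"
        using h(1)[of m] by (simp add: s_def divide_inverse mult.commute)
      ultimately show "norm (s m x) \<le> (K * exp 1) * exp (- norm x)"
        by (simp only:)
    qed
  qed (simp_all add: s_def)
  ultimately show ?thesis
    by (simp add: LIMSEQ_const_iff)
qed

section \<open>Gaussian moments of polynomials\<close>

definition gauss :: "real ^ 'n \<Rightarrow> real" where
  "gauss x = exp (- (norm x)\<^sup>2 / 2)"

lemma gauss_pos: "0 < gauss x"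
  by (simp add: gauss_def)

lemma gauss_measurable [measurable]: "gauss \<in> borel_measurable borel"
  unfolding gauss_def[abs_def] by measurable

lemma of_real_gauss_measurable [measurable]: "(\<lambda>x. complex_of_real (gauss x)) \<in> borel_measurable borel"
  unfolding gauss_def by (intro borel_measurable_continuous_onI continuous_intros) auto

text \<open>Completing the square around c + 1. Any exponential growth in the norm is thus absorbed
  by the Gaussian, with a constant depending on c alone and one factor exp (- |x|) to spare.\<close>

lemma exp_linear_gauss_le: "exp (c * norm x) * gauss x \<le> exp ((c + 1)\<^sup>2 / 2) * exp (- norm x)"
proof -
  have "0 \<le> (norm x - (c + 1))\<^sup>2" by simp
  then have "c * norm x - (norm x)\<^sup>2 / 2 \<le> (c + 1)\<^sup>2 / 2 - norm x"
    by (simp add: power2_eq_square algebra_simps)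
  then have "exp (c * norm x - (norm x)\<^sup>2 / 2) \<le> exp ((c + 1)\<^sup>2 / 2 - norm x)" by simp
  then show ?thesis by (simp add: gauss_def flip: exp_add)
qed

lemma cpoly_growth: "cpoly p \<Longrightarrow> \<exists>C N. 0 \<le> C \<and> (\<forall>x. cmod (p x) \<le> C * (1 + norm x) ^ N)"
proof (induction rule: cpoly.induct)
  case (const c)
  show ?case by (intro exI[of _ "cmod c"] exI[of _ 0]) auto
next
  case (coord i)
  show ?case
    by (intro exI[of _ 1] exI[of _ 1]) (auto intro: order_trans[OF component_le_norm_cart])
next
  case (add p q)
  then obtain C N D M where *: "0 \<le> C" "\<And>x. cmod (p x) \<le> C * (1 + norm x) ^ N"
    "0 \<le> D" "\<And>x. cmod (q x) \<le> D * (1 + norm x) ^ M" by blast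
  have "cmod (p x + q x) \<le> (C + D) * (1 + norm x) ^ (N + M)" for x
  proof -
    have "cmod (p x) \<le> C * (1 + norm x) ^ (N + M)"
      using *(1) by (intro order_trans[OF *(2)] mult_left_mono power_increasing) auto
    moreover have "cmod (q x) \<le> D * (1 + norm x) ^ (N + M)"
      using *(3) by (intro order_trans[OF *(4)] mult_left_mono power_increasing) auto
    ultimately show ?thesis
      using norm_triangle_ineq[of "p x" "q x"] by (simp add: distrib_right)
  qed
  then show ?case using * by (intro exI[of _ "C + D"] exI[of _ "N + M"]) auto
next
  case (mult p q)
  then obtain C N D M where *: "0 \<le> C" "\<And>x. cmod (p x) \<le> C * (1 + norm x) ^ N"
    "0 \<le> D" "\<And>x. cmod (q x) \<le> D * (1 + norm x) ^ M" by blast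
  have "cmod (p x * q x) \<le> (C * (1 + norm x) ^ N) * (D * (1 + norm x) ^ M)" for x
    unfolding norm_mult using * by (intro mult_mono) auto
  then have "cmod (p x * q x) \<le> (C * D) * (1 + norm x) ^ (N + M)" for x
    by (simp add: power_add mult_ac)
  then show ?case using * by (intro exI[of _ "C * D"] exI[of _ "N + M"]) auto
qed

lemma cpoly_gauss_bound:
  assumes "cpoly p" shows "\<exists>K. \<forall>x. cmod (p x * gauss x) \<le> K * exp (- norm x)"
proof -
  obtain C N where C: "0 \<le> C" "\<And>x. cmod (p x) \<le> C * (1 + norm x) ^ N"
    using cpoly_growth[OF assms] by blast
  have "cmod (p x * gauss x) \<le> C * exp ((real N + 1)\<^sup>2 / 2) * exp (- norm x)" for x
  proof -
    have "(1 + norm x) ^ N \<le> exp (norm x) ^ N"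
      by (intro power_mono) auto
    also have "\<dots> = exp (real N * norm x)" by (simp add: exp_of_nat_mult)
    finally have "cmod (p x) \<le> C * exp (real N * norm x)"
      using C by (meson mult_left_mono order_trans)
    then have "cmod (p x) * gauss x \<le> C * (exp (real N * norm x) * gauss x)"
      using gauss_pos[of x] by (simp add: mult.assoc[symmetric])
    also have "\<dots> \<le> C * (exp ((real N + 1)\<^sup>2 / 2) * exp (- norm x))"
      using C(1) by (intro mult_left_mono exp_linear_gauss_le)
    finally show ?thesis
      using gauss_pos[of x] by (simp add: norm_mult mult.assoc)
  qed
  then show ?thesis by blast
qed

lemma integrable_cpoly_gauss:
  assumes "cpoly p" shows "integrable lborel (\<lambda>x. p x * gauss x)"
proof -
  obtain K where K: "\<And>x. cmod (p x * gauss x) \<le> K * exp (- norm x)"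
    using cpoly_gauss_bound[OF assms] by blast
  show ?thesis
    by (intro integrable_le_exp_minus_norm[OF _ K] borel_measurable_times of_real_gauss_measurable
        cpoly_measurable[OF assms])
qed

definition gauss_integral :: "(real ^ 'n \<Rightarrow> complex) \<Rightarrow> complex" where
  "gauss_integral p = (\<integral>x. p x * gauss x \<partial>lborel)"

lemma gauss_integral_add:
  "cpoly p \<Longrightarrow> cpoly q \<Longrightarrow> gauss_integral (\<lambda>x. p x + q x) = gauss_integral p + gauss_integral q"
  by (simp add: gauss_integral_def distrib_right integrable_cpoly_gauss)

lemma gauss_integral_diff:
  "cpoly p \<Longrightarrow> cpoly q \<Longrightarrow> gauss_integral (\<lambda>x. p x - q x) = gauss_integral p - gauss_integral q"
  by (simp add: gauss_integral_def left_diff_distrib integrable_cpoly_gauss)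

lemma gauss_integral_cmult: "cpoly p \<Longrightarrow> gauss_integral (\<lambda>x. c * p x) = c * gauss_integral p"
  by (simp add: gauss_integral_def mult.assoc integrable_cpoly_gauss)

lemma gauss_integral_sum:
  "(\<And>i. i \<in> I \<Longrightarrow> cpoly (p i)) \<Longrightarrow> gauss_integral (\<lambda>x. \<Sum>i\<in>I. p i x) = (\<Sum>i\<in>I. gauss_integral (p i))"
  by (simp add: gauss_integral_def sum_distrib_right integrable_cpoly_gauss)

text \<open>The i-th derivative of p times the Gaussian is (d_i p - x_i p) times the Gaussian, and
  it integrates to 0. The moment formulas that follow all rest on this integration by parts.\<close>

lemma gauss_integral_partial_deriv:
  fixes p :: "real ^ 'n \<Rightarrow> complex"
  assumes p: "cpoly p"
  shows "gauss_integral (partial_deriv i p) = gauss_integral (\<lambda>x. x $ i * p x)"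
proof -
  have cq: "cpoly (\<lambda>x. partial_deriv i p x - x $ i * p x)"
    by (intro cpoly_diff cpoly.intros cpoly_partial_deriv p)
  obtain K1 where K1: "\<And>x. cmod (p x * gauss x) \<le> K1 * exp (- norm x)"
    using cpoly_gauss_bound[OF p] by blast
  obtain K2 where K2: "\<And>x. cmod ((partial_deriv i p x - x $ i * p x) * gauss x) \<le> K2 * exp (- norm x)"
    using cpoly_gauss_bound[OF cq] by blast
  have "(\<integral>x. (partial_deriv i p x - x $ i * p x) * gauss x \<partial>lborel) = 0"
  proof (rule integral_directional_derivative_zero[where e = "axis i 1" and F = "\<lambda>x. p x * gauss x" and K = "max K1 K2"])
    show "cmod (p x * gauss x) \<le> max K1 K2 * exp (- norm x)" for x
      by (rule order_trans[OF K1]) simp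
    show "cmod ((partial_deriv i p x - x $ i * p x) * gauss x) \<le> max K1 K2 * exp (- norm x)" for x
      by (rule order_trans[OF K2]) simp
    show "(\<lambda>x. p x * gauss x) \<in> borel_measurable borel" 
      "(\<lambda>x. (partial_deriv i p x - x $ i * p x) * gauss x) \<in> borel_measurable borel"
      by (intro borel_measurable_times of_real_gauss_measurable cpoly_measurable p cq)+
    fix x
    let ?D = "frechet_derivative p (at x)"
    have D: "(p has_derivative ?D) (at (x + 0 *\<^sub>R axis i 1))"
      using p by (simp add: cpoly_differentiable flip: frechet_derivative_works)
    have "((\<lambda>t. x + t *\<^sub>R axis i 1) has_derivative (\<lambda>t. t *\<^sub>R axis i 1)) (at (0 :: real))"
      by (auto intro!: derivative_eq_intros)
    from has_derivative_compose[OF this D]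
    have "((\<lambda>t. p (x + t *\<^sub>R axis i 1)) has_derivative (\<lambda>t. ?D (t *\<^sub>R axis i 1))) (at 0)" .
    moreover have "?D (t *\<^sub>R axis i 1) = t *\<^sub>R partial_deriv i p x" for t
      using has_derivative_linear[OF D] by (simp add: linear_cmul partial_deriv_def)
    ultimately have dp: "((\<lambda>t. p (x + t *\<^sub>R axis i 1)) has_vector_derivative partial_deriv i p x) (at 0)"
      by (simp add: has_vector_derivative_def)
    have "((\<lambda>t. exp (- ((x + t *\<^sub>R axis i 1) \<bullet> (x + t *\<^sub>R axis i 1)) / 2)) has_real_derivative - (x $ i) * gauss x) (at 0)"
      by (simp add: inner_add_left inner_add_right inner_axis inner_axis')
        (auto intro!: derivative_eq_intros simp: gauss_def power2_norm_eq_inner inner_axis)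
    then have "((\<lambda>t. gauss (x + t *\<^sub>R axis i 1)) has_real_derivative - (x $ i) * gauss x) (at 0)"
      by (simp add: gauss_def power2_norm_eq_inner)
    then have "((\<lambda>t. complex_of_real (gauss (x + t *\<^sub>R axis i 1))) has_vector_derivative complex_of_real (- (x $ i) * gauss x)) (at 0)"
      by (intro has_vector_derivative_of_real) (simp add: has_real_derivative_iff_has_vector_derivative)
    from has_vector_derivative_mult[OF dp this]
    show "((\<lambda>t. p (x + t *\<^sub>R axis i 1) * gauss (x + t *\<^sub>R axis i 1)) has_vector_derivative
       (partial_deriv i p x - x $ i * p x) * gauss x) (at 0)"
      by (simp add: algebra_simps)
  qed simp
  then have "gauss_integral (\<lambda>x. partial_deriv i p x - x $ i * p x) = 0"
    by (simp add: gauss_integral_def)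
  then show ?thesis
    using p by (simp add: gauss_integral_diff cpoly_partial_deriv cpoly.intros)
qed

text \<open>Splitting |x|^2 into the terms x_i x_i and integrating by parts in one of the two
  factors gives the factor n + 2 q = 2 (n/2 + q) for each step, hence the Pochhammer symbol.\<close>

lemma gauss_integral_radial_power:
  "gauss_integral (\<lambda>x :: real ^ 'n. (complex_of_real (norm x) ^ 2) ^ q)
    = 2 ^ q * pochhammer (of_nat CARD('n) / 2) q * gauss_integral (\<lambda>x :: real ^ 'n. 1)"
proof (induction q)
  case (Suc q)
  let ?N = "\<lambda>x :: real ^ 'n. complex_of_real (norm x) ^ 2"
  have cN: "cpoly (\<lambda>x. ?N x ^ m)" for m by (intro cpoly_power cpoly_norm_sq)
  have N: "(\<Sum>i\<in>UNIV. complex_of_real (x $ i) * complex_of_real (x $ i)) = ?N x" for x :: "real ^ 'n"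
    by (simp add: norm_vec_def L2_set_def sum_nonneg power2_eq_square flip: of_real_power of_real_sum of_real_mult)
  have "gauss_integral (\<lambda>x. ?N x ^ Suc q) = gauss_integral (\<lambda>x. \<Sum>i\<in>UNIV. x $ i * (x $ i * ?N x ^ q))"
    by (simp add: mult.assoc[symmetric] N flip: sum_distrib_right)
  also have "\<dots> = (\<Sum>i\<in>UNIV. gauss_integral (\<lambda>x. x $ i * (x $ i * ?N x ^ q)))"
    by (intro gauss_integral_sum cpoly.intros cN)
  also have "\<dots> = (\<Sum>i\<in>UNIV. gauss_integral (partial_deriv i (\<lambda>x. x $ i * ?N x ^ q)))"
    by (intro sum.cong refl gauss_integral_partial_deriv[symmetric] cpoly.intros cN)
  also have "\<dots> = (\<Sum>i\<in>UNIV. gauss_integral (\<lambda>x. ?N x ^ q + 2 * of_nat q * ?N x ^ (q - 1) * (complex_of_real (x $ i) * complex_of_real (x $ i))))"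
    by (simp add: partial_deriv_mult cpoly.intros cN partial_deriv_power cpoly_norm_sq partial_deriv_norm_sq algebra_simps)
  also have "\<dots> = gauss_integral (\<lambda>x. \<Sum>i\<in>UNIV. ?N x ^ q + 2 * of_nat q * ?N x ^ (q - 1) * (complex_of_real (x $ i) * complex_of_real (x $ i)))"
    by (intro gauss_integral_sum[symmetric] cpoly.intros cN)
  also have "\<dots> = gauss_integral (\<lambda>x. (of_nat CARD('n) + 2 * of_nat q) * ?N x ^ q)"
  proof -
    \<comment> \<open>For q = 0 the truncated exponent \<open>q - 1\<close> occurs only with the
      factor 0.\<close>
    have "(\<Sum>i\<in>UNIV. ?N x ^ q + 2 * of_nat q * ?N x ^ (q - 1) * (complex_of_real (x $ i) * complex_of_real (x $ i))) = (of_nat CARD('n) + 2 * of_nat q) * ?N x ^ q" for x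
      by (simp add: sum.distrib N flip: sum_distrib_left) (cases q; simp add: algebra_simps)
    then show ?thesis by simp
  qed
  also have "\<dots> = (of_nat CARD('n) + 2 * of_nat q) * gauss_integral (\<lambda>x. ?N x ^ q)"
    by (intro gauss_integral_cmult cN)
  finally show ?case
    by (simp add: Suc pochhammer_Suc field_simps)
qed simp

section \<open>Moments of powers of a linear form, alone and against harmonics\<close>

text \<open>The recursion of one-dimensional Gaussian moments: one factor x . y is split into the
  terms x_i y_i, and integration by parts trades y_i for the derivative (m + 1) x_i (x .
  y)^m.\<close>

lemma gauss_integral_inner_power_Suc_Suc:
  "gauss_integral (\<lambda>y. complex_of_real (x \<bullet> y) ^ Suc (Suc m))
    = of_nat (Suc m) * (complex_of_real (norm x))\<^sup>2 * gauss_integral (\<lambda>y. complex_of_real (x \<bullet> y) ^ m)"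
proof -
  let ?I = "\<lambda>y. complex_of_real (x \<bullet> y)"
  have cI: "cpoly (\<lambda>y. ?I y ^ l)" for l by (intro cpoly_power cpoly_inner)
  have "gauss_integral (\<lambda>y. ?I y ^ Suc (Suc m)) = gauss_integral (\<lambda>y. \<Sum>i\<in>UNIV. x $ i * (y $ i * ?I y ^ Suc m))"
    by (simp add: inner_vec_def sum_distrib_right mult_ac)
  also have "\<dots> = (\<Sum>i\<in>UNIV. x $ i * gauss_integral (\<lambda>y. y $ i * ?I y ^ Suc m))"
    by (simp only: gauss_integral_sum gauss_integral_cmult cpoly.intros cI)
  also have "\<dots> = (\<Sum>i\<in>UNIV. x $ i * gauss_integral (partial_deriv i (\<lambda>y. ?I y ^ Suc m)))"
    by (simp only: gauss_integral_partial_deriv cI)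
  also have "\<dots> = (\<Sum>i\<in>UNIV. x $ i * gauss_integral (\<lambda>y. (of_nat (Suc m) * (x $ i)) * ?I y ^ m))"
    by (simp add: partial_deriv_power cpoly_inner partial_deriv_inner mult_ac del: of_nat_Suc power_Suc)
  also have "\<dots> = (\<Sum>i\<in>UNIV. x $ i * (of_nat (Suc m) * (x $ i) * gauss_integral (\<lambda>y. ?I y ^ m)))"
    by (simp only: gauss_integral_cmult cI)
  also have "\<dots> = of_nat (Suc m) * (\<Sum>i\<in>UNIV. complex_of_real (x $ i) ^ 2) * gauss_integral (\<lambda>y. ?I y ^ m)"
    by (simp add: sum_distrib_left sum_distrib_right power2_eq_square mult_ac)
  also have "(\<Sum>i\<in>UNIV. complex_of_real (x $ i) ^ 2) = (complex_of_real (norm x))\<^sup>2"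
    by (simp add: norm_vec_def L2_set_def sum_nonneg flip: of_real_power of_real_sum)
  finally show ?thesis .
qed

lemma gauss_integral_inner:
  fixes x :: "real ^ 'n"
  shows "gauss_integral (\<lambda>y. complex_of_real (x \<bullet> y)) = 0"
proof -
  have "gauss_integral (\<lambda>y. complex_of_real (x \<bullet> y))
      = gauss_integral (\<lambda>y. \<Sum>i\<in>UNIV. complex_of_real (x $ i) * (complex_of_real (y $ i) * 1))"
    by (simp add: inner_vec_def)
  also have "\<dots> = (\<Sum>i\<in>UNIV. x $ i * gauss_integral (\<lambda>y. complex_of_real (y $ i) * 1))"
    by (simp only: gauss_integral_sum gauss_integral_cmult cpoly.intros)
  also have "\<dots> = (\<Sum>i\<in>UNIV. x $ i * gauss_integral (partial_deriv i (\<lambda>y :: real ^ 'n. 1)))"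
    by (subst gauss_integral_partial_deriv[OF cpoly.const]) (rule refl)
  finally show ?thesis by (simp add: gauss_integral_def)
qed

lemma gauss_integral_inner_odd: "odd m \<Longrightarrow> gauss_integral (\<lambda>y. complex_of_real (x \<bullet> y) ^ m) = 0"
proof (induction m rule: less_induct)
  case (less m)
  then obtain l where "m = 1 \<or> m = Suc (Suc l)"
    by (metis One_nat_def not0_implies_Suc odd_pos gr0_conv_Suc)
  then show ?case
  proof
    assume "m = 1" then show ?thesis by (simp add: gauss_integral_inner)
  next
    assume m: "m = Suc (Suc l)"
    then show ?thesis
      using less by (simp add: gauss_integral_inner_power_Suc_Suc del: power_Suc)
  qed
qed

text \<open>The quotient of factorials is the double factorial (2 j - 1)!!, the moment of order 2 j
  of a standard normal variable.\<close>

lemma gauss_integral_inner_even: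
  fixes x :: "real ^ 'n"
  shows "gauss_integral (\<lambda>y. complex_of_real (x \<bullet> y) ^ (2 * j))
    = fact (2 * j) / (2 ^ j * fact j) * complex_of_real (norm x) ^ (2 * j) * gauss_integral (\<lambda>y :: real ^ 'n. 1)"
proof (induction j)
  case (Suc j)
  have f: "fact (2 * Suc j) = (2 * of_nat (Suc j)) * (of_nat (Suc (2 * j)) * fact (2 * j) :: complex)"
    "2 ^ Suc j * fact (Suc j) = (2 * of_nat (Suc j)) * (2 ^ j * fact j :: complex)"
    by (simp_all add: algebra_simps)
  have "(2 * of_nat (Suc j) :: complex) \<noteq> 0"
    by (simp del: of_nat_Suc)
  then have e: "of_nat (Suc (2 * j)) * (fact (2 * j) / (2 ^ j * fact j) :: complex) = fact (2 * Suc j) / (2 ^ Suc j * fact (Suc j))"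
    unfolding f by (subst mult_divide_mult_cancel_left) simp_all
  have nm: "complex_of_real (norm x) ^ (2 * Suc j) = (complex_of_real (norm x))\<^sup>2 * complex_of_real (norm x) ^ (2 * j)"
    by (simp add: power2_eq_square)
  have "of_nat (Suc (2 * j)) * (complex_of_real (norm x))\<^sup>2
      * (fact (2 * j) / (2 ^ j * fact j) * complex_of_real (norm x) ^ (2 * j) * gauss_integral (\<lambda>y :: real ^ 'n. 1))
    = fact (2 * Suc j) / (2 ^ Suc j * fact (Suc j)) * complex_of_real (norm x) ^ (2 * Suc j)
      * gauss_integral (\<lambda>y :: real ^ 'n. 1)"
    unfolding nm e[symmetric] by (simp only: mult_ac)
  moreover have "2 * Suc j = Suc (Suc (2 * j))" by simp
  ultimately show ?case
    by (simp only: gauss_integral_inner_power_Suc_Suc Suc)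
qed (simp add: gauss_integral_def)

text \<open>Euler's identity writes k Y as the sum of y_i d_i Y. Integration by parts then lets d_i
  fall either on d_i Y, where the sum over i is the Laplacian and vanishes, or on the power of x .
  y. Degree and power both drop by one.\<close>

lemma gauss_integral_harmonic_reduce:
  assumes Y: "Y \<in> spherical_harmonics k"
  shows "of_nat k * gauss_integral (\<lambda>y. complex_of_real (x \<bullet> y) ^ m * Y y)
    = of_nat m * (\<Sum>i\<in>UNIV. x $ i * gauss_integral (\<lambda>y. complex_of_real (x \<bullet> y) ^ (m - 1) * partial_deriv i Y y))"
proof -
  let ?I = "\<lambda>y. complex_of_real (x \<bullet> y)" and ?d = "\<lambda>i. partial_deriv i Y"
  have cI: "cpoly (\<lambda>y. ?I y ^ l)" for l by (intro cpoly_power cpoly_inner)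
  have cY: "cpoly Y" using Y by (simp add: spherical_harmonicsD)
  have cd: "cpoly (?d i)" for i by (intro cpoly_partial_deriv cY)
  note c = cpoly.intros cI cd cpoly_partial_deriv cY
  have "of_nat k * gauss_integral (\<lambda>y. ?I y ^ m * Y y) = gauss_integral (\<lambda>y. of_nat k * (?I y ^ m * Y y))"
    by (intro gauss_integral_cmult[symmetric] c)
  also have "\<dots> = gauss_integral (\<lambda>y. ?I y ^ m * (\<Sum>i\<in>UNIV. y $ i * ?d i y))"
  proof -
    have "of_nat k * (?I y ^ m * Y y) = ?I y ^ m * (\<Sum>i\<in>UNIV. y $ i * ?d i y)" for y
      unfolding spherical_harmonics_euler[OF Y] by (simp add: mult_ac)
    then show ?thesis by (simp only:)
  qed
  also have "\<dots> = gauss_integral (\<lambda>y. \<Sum>i\<in>UNIV. y $ i * (?I y ^ m * ?d i y))"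
    by (simp add: sum_distrib_left mult_ac)
  also have "\<dots> = (\<Sum>i\<in>UNIV. gauss_integral (\<lambda>y. y $ i * (?I y ^ m * ?d i y)))"
    by (intro gauss_integral_sum c)
  also have "\<dots> = (\<Sum>i\<in>UNIV. gauss_integral (partial_deriv i (\<lambda>y. ?I y ^ m * ?d i y)))"
    by (intro sum.cong refl gauss_integral_partial_deriv[symmetric] c)
  also have "\<dots> = (\<Sum>i\<in>UNIV. gauss_integral (\<lambda>y. ?I y ^ m * partial_deriv i (?d i) y + (of_nat m * complex_of_real (x $ i)) * (?I y ^ (m - 1) * ?d i y)))"
    by (simp only: partial_deriv_mult partial_deriv_power cI cd cpoly_inner partial_deriv_inner ac_simps)
  also have "\<dots> = (\<Sum>i\<in>UNIV. gauss_integral (\<lambda>y. ?I y ^ m * partial_deriv i (?d i) y)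
      + (of_nat m * complex_of_real (x $ i)) * gauss_integral (\<lambda>y. ?I y ^ (m - 1) * ?d i y))"
    by (simp only: gauss_integral_add gauss_integral_cmult c)
  also have "\<dots> = gauss_integral (\<lambda>y. \<Sum>i\<in>UNIV. ?I y ^ m * partial_deriv i (?d i) y)
      + of_nat m * (\<Sum>i\<in>UNIV. x $ i * gauss_integral (\<lambda>y. ?I y ^ (m - 1) * ?d i y))"
    by (simp only: sum.distrib gauss_integral_sum c sum_distrib_left mult.assoc)
  also have "(\<lambda>y. \<Sum>i\<in>UNIV. ?I y ^ m * partial_deriv i (?d i) y) = (\<lambda>y. ?I y ^ m * laplacian Y y)"
    by (simp add: laplacian_def sum_distrib_left)
  finally show ?thesis
    by (simp add: spherical_harmonicsD[OF Y] gauss_integral_def)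
qed

text \<open>Each reduction lowers m and k together; when m < k, the factor m reaches 0 while the
  degree is still positive.\<close>

lemma gauss_integral_harmonic_zero:
  "Y \<in> spherical_harmonics k \<Longrightarrow> m < k \<Longrightarrow> gauss_integral (\<lambda>y. complex_of_real (x \<bullet> y) ^ m * Y y) = 0"
proof (induction k arbitrary: m Y)
  case (Suc k)
  have "of_nat (Suc k) * gauss_integral (\<lambda>y. complex_of_real (x \<bullet> y) ^ m * Y y) = 0"
  proof (cases m)
    case (Suc l)
    then have "l < k" using \<open>m < Suc k\<close> by simp
    then have "gauss_integral (\<lambda>y. complex_of_real (x \<bullet> y) ^ (m - 1) * partial_deriv i Y y) = 0" for i
      using Suc.IH[OF spherical_harmonics_partial_deriv[OF Suc.prems(1)]] Suc by simp
    then show ?thesis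
      unfolding gauss_integral_harmonic_reduce[OF Suc.prems(1)] by simp
  qed (simp only: gauss_integral_harmonic_reduce[OF Suc.prems(1)] of_nat_0 mult_zero_left)
  then show ?case by (simp del: of_nat_Suc)
qed simp

text \<open>A Funk-Hecke formula in Gaussian form. The reduction is repeated until Y is constant; at
  each stage Euler's identity, now at the point x, reassembles the derivatives of Y, and the factor
  k it produces cancels the one on the left.\<close>

lemma gauss_integral_harmonic:
  "Y \<in> spherical_harmonics k \<Longrightarrow> gauss_integral (\<lambda>y. complex_of_real (x \<bullet> y) ^ (m + k) * Y y)
    = fact (m + k) / fact m * gauss_integral (\<lambda>y. complex_of_real (x \<bullet> y) ^ m) * Y x"
proof (induction k arbitrary: Y)
  case 0
  have "gauss_integral (\<lambda>y. complex_of_real (x \<bullet> y) ^ m * Y y) = gauss_integral (\<lambda>y. Y 0 * complex_of_real (x \<bullet> y) ^ m)"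
    by (subst spherical_harmonics_0D[OF 0]) (simp add: mult.commute)
  also have "\<dots> = Y 0 * gauss_integral (\<lambda>y. complex_of_real (x \<bullet> y) ^ m)"
    by (intro gauss_integral_cmult cpoly_power cpoly_inner)
  also have "Y 0 = Y x" using fun_cong[OF spherical_harmonics_0D[OF 0], of x] by simp
  finally show ?case by simp
next
  case (Suc k)
  let ?M = "gauss_integral (\<lambda>y. complex_of_real (x \<bullet> y) ^ m)"
  have "of_nat (Suc k) * gauss_integral (\<lambda>y. complex_of_real (x \<bullet> y) ^ (m + Suc k) * Y y)
    = of_nat (m + Suc k) * (\<Sum>i\<in>UNIV. x $ i * (fact (m + k) / fact m * ?M * partial_deriv i Y x))"
    unfolding gauss_integral_harmonic_reduce[OF Suc.prems]
    using Suc.IH[OF spherical_harmonics_partial_deriv[OF Suc.prems]] by simp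
  also have "\<dots> = of_nat (m + Suc k) * (fact (m + k) / fact m * ?M) * (\<Sum>i\<in>UNIV. x $ i * partial_deriv i Y x)"
    by (simp add: sum_distrib_left sum_divide_distrib mult_ac)
  also have "\<dots> = of_nat (Suc k) * ((of_nat (m + Suc k) * fact (m + k)) / fact m * ?M * Y x)"
    unfolding spherical_harmonics_euler[OF Suc.prems] by (simp add: mult_ac)
  also have "of_nat (m + Suc k) * fact (m + k) = (fact (m + Suc k) :: complex)"
    by simp
  finally show ?case
    by (rule iffD1[OF mult_left_cancel[OF of_nat_neq_0]])
qed

section \<open>Integrals of spherical harmonics over the sphere\<close>

text \<open>The ratio between a Gaussian integral and a sphere integral of the same homogeneous
  function. It is left unevaluated because it enters both sides of each comparison and cancels, once
  known to be nonzero.\<close>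

definition radial_moment :: "nat \<Rightarrow> nat \<Rightarrow> complex" where
  "radial_moment d q = (\<integral>r. complex_of_real (r ^ q * exp (- r\<^sup>2 / 2)) \<partial>radial_measure d)"

definition sphere_area :: "'n::finite itself \<Rightarrow> real" where
  "sphere_area _ = measure surface_measure (sphere (0 :: real ^ 'n) 1)"

lemma sphere_area_pos: "0 < sphere_area TYPE('n::finite)"
  unfolding sphere_area_def by (rule surface_measure_pos)

text \<open>Homogeneity is asked only for positive radii and unit vectors, and f need not be a
  polynomial, so that odd powers of the norm are covered as well.\<close>

lemma integral_gauss_homogeneous:
  fixes f :: "real ^ 'n \<Rightarrow> complex"
  assumes int: "integrable lborel (\<lambda>x. f x * gauss x)"
    and hom: "\<And>r \<omega>. 0 < r \<Longrightarrow> norm \<omega> = 1 \<Longrightarrow> f (r *\<^sub>R \<omega>) = complex_of_real (r ^ q) * f \<omega>"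
  shows "(\<integral>x. f x * gauss x \<partial>lborel) = radial_moment CARD('n) q * (\<integral>\<omega>. f \<omega> \<partial>surface_measure)"
proof -
  let ?I = "\<integral>\<omega>. f \<omega> \<partial>surface_measure"
  have *: "(\<integral>\<omega>. f (r *\<^sub>R \<omega>) * gauss (r *\<^sub>R \<omega>) \<partial>surface_measure) = complex_of_real (r ^ q * exp (- r\<^sup>2 / 2)) * ?I"
    if "0 < r" for r
  proof -
    have "(\<integral>\<omega>. f (r *\<^sub>R \<omega>) * gauss (r *\<^sub>R \<omega>) \<partial>surface_measure) = (\<integral>\<omega>. complex_of_real (r ^ q * exp (- r\<^sup>2 / 2)) * f \<omega> \<partial>surface_measure)"
      using that by (intro Bochner_Integration.integral_cong) (auto simp: space_surface_measure hom gauss_def)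
    then show ?thesis by simp
  qed
  have "(\<integral>x. f x * gauss x \<partial>lborel) = (\<integral>r. (\<integral>\<omega>. f (r *\<^sub>R \<omega>) * gauss (r *\<^sub>R \<omega>) \<partial>surface_measure) \<partial>radial_measure CARD('n))"
    by (rule integral_polar[OF int])
  also have "\<dots> = (\<integral>r. complex_of_real (r ^ q * exp (- r\<^sup>2 / 2)) * ?I \<partial>radial_measure CARD('n))"
  proof (rule integral_cong_AE)
    have "(\<lambda>(r, \<omega>). f (r *\<^sub>R \<omega>) * gauss (r *\<^sub>R \<omega>))
        \<in> borel_measurable (radial_measure CARD('n) \<Otimes>\<^sub>M surface_measure)"
      using measurable_compose[OF measurable_polar borel_measurable_integrable[OF int, simplified]]
      by (simp add: split_beta')
    then show "(\<lambda>r. \<integral>\<omega>. f (r *\<^sub>R \<omega>) * gauss (r *\<^sub>R \<omega>) \<partial>surface_measure) \<in> borel_measurable (radial_measure CARD('n))"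
      by (rule surface.borel_measurable_lebesgue_integral)
    show "(\<lambda>r. complex_of_real (r ^ q * exp (- r\<^sup>2 / 2)) * ?I) \<in> borel_measurable (radial_measure CARD('n))"
      by (simp add: measurable_cong_sets[OF sets_radial_measure refl])
    show "AE r in radial_measure CARD('n). (\<integral>\<omega>. f (r *\<^sub>R \<omega>) * gauss (r *\<^sub>R \<omega>) \<partial>surface_measure) = complex_of_real (r ^ q * exp (- r\<^sup>2 / 2)) * ?I"
      using AE_radial_measure by eventually_elim (rule *)
  qed
  also have "\<dots> = radial_moment CARD('n) q * ?I"
    unfolding radial_moment_def by simp
  finally show ?thesis .
qed

text \<open>Tested on |x|^q: were the moment 0, the Gaussian integral of |x|^q would vanish although
  its integrand is positive off the origin.\<close>

lemma radial_moment_neq_0: "radial_moment CARD('n::finite) q \<noteq> 0"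
proof
  assume "radial_moment CARD('n) q = 0"
  let ?f = "\<lambda>x :: real ^ 'n. norm x ^ q"
  have b: "norm (?f x * gauss x) \<le> exp ((real q + 1)\<^sup>2 / 2) * exp (- norm x)" for x
  proof -
    have "norm x ^ q \<le> exp (norm x) ^ q" using exp_ge_add_one_self[of "norm x"] by (intro power_mono) (linarith, simp)
    then have "?f x \<le> exp (real q * norm x)" by (simp add: exp_of_nat_mult)
    then have "?f x * gauss x \<le> exp (real q * norm x) * gauss x"
      using gauss_pos[of x] by (intro mult_right_mono) auto
    from order_trans[OF this exp_linear_gauss_le] show ?thesis
      using gauss_pos[of x] by (simp add: abs_mult)
  qed
  have int: "integrable lborel (\<lambda>x. ?f x * gauss x)"
    by (rule integrable_le_exp_minus_norm[OF _ b]) measurable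
  then have "integrable lborel (\<lambda>x. complex_of_real (?f x * gauss x))"
    by (rule integrable_of_real)
  then have "(\<integral>x. complex_of_real (?f x) * gauss x \<partial>lborel) = radial_moment CARD('n) q * (\<integral>\<omega>. complex_of_real (?f \<omega>) \<partial>surface_measure)"
    by (intro integral_gauss_homogeneous) (auto simp: power_mult_distrib)
  then have "(\<integral>x. complex_of_real (?f x * gauss x) \<partial>lborel) = 0"
    using \<open>radial_moment CARD('n) q = 0\<close> by simp
  then have "(\<integral>x. ?f x * gauss x \<partial>lborel) = 0"
    by (simp only: integral_complex_of_real of_real_eq_0_iff)
  then have "AE x in lborel. ?f x * gauss x = 0"
    using gauss_pos[THEN less_imp_le]
    by (subst integral_nonneg_eq_0_iff_AE[OF int, symmetric]) (auto intro!: always_eventually mult_nonneg_nonneg)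
  with AE_lborel_singleton[of "0 :: real ^ 'n"] have "AE x in lborel :: (real ^ 'n) measure. False"
  proof eventually_elim
    case (elim x)
    then show False using gauss_pos[of x] by simp
  qed
  then have "emeasure lborel (UNIV :: (real ^ 'n) set) = 0"
    by (simp add: AE_iff_measurable[OF _ refl])
  then show False by simp
qed

lemma gauss_integral_homogeneous:
  fixes p :: "real ^ 'n \<Rightarrow> complex"
  assumes "cpoly p" and "\<And>t x. p (t *\<^sub>R x) = complex_of_real (t ^ q) * p x"
  shows "gauss_integral p = radial_moment CARD('n) q * (\<integral>\<omega>. p \<omega> \<partial>surface_measure)"
  unfolding gauss_integral_def
  by (rule integral_gauss_homogeneous) (use assms integrable_cpoly_gauss in auto)

lemma gauss_integral_1_neq_0: "gauss_integral (\<lambda>x :: real ^ 'n. 1) \<noteq> 0"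
proof -
  have "gauss_integral (\<lambda>x :: real ^ 'n. 1) = radial_moment CARD('n) 0 * (\<integral>\<omega>. 1 \<partial>(surface_measure :: (real ^ 'n) measure))"
    by (rule gauss_integral_homogeneous) (auto intro: cpoly.intros)
  then show ?thesis
    using radial_moment_neq_0[where 'n = 'n, of 0] surface_measure_pos[where 'n = 'n]
    by (simp add: space_surface_measure)
qed

text \<open>
  The eigenvalue on degree \<open>k\<close> of the operator with kernel \<open>(\<omega> \<bullet> \<eta>)\<^sup>m\<close>, \<open>m = k + 2 j\<close>, divided by
  \<open>m!\<close> and by the area of the sphere.
\<close>

definition harmonic_coeff :: "nat \<Rightarrow> nat \<Rightarrow> nat \<Rightarrow> real" where
  "harmonic_coeff d k j = 1 / (4 ^ j * 2 ^ k * fact j * pochhammer (real d / 2) (k + j))"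

lemma harmonic_coeff_pos: "0 < d \<Longrightarrow> 0 < harmonic_coeff d k j"
  by (simp add: harmonic_coeff_def pochhammer_pos)

lemma inner_power_mult_harmonic:
  fixes Y :: "real ^ 'n \<Rightarrow> complex"
  assumes "Y \<in> spherical_harmonics k"
  shows "gauss_integral (\<lambda>y. complex_of_real (x \<bullet> y) ^ m * Y y)
    = radial_moment CARD('n) (m + k) * (\<integral>\<omega>. complex_of_real (x \<bullet> \<omega>) ^ m * Y \<omega> \<partial>surface_measure)"
  by (rule gauss_integral_homogeneous)
    (use assms in \<open>auto simp: spherical_harmonicsD power_mult_distrib power_add intro!: cpoly.mult cpoly_power cpoly_inner\<close>)

lemma sphere_integral_inner_power_zero:
  fixes Y :: "real ^ 'n \<Rightarrow> complex"
  assumes Y: "Y \<in> spherical_harmonics k" and m: "m < k \<or> odd (m + k)"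
  shows "(\<integral>\<omega>. complex_of_real (x \<bullet> \<omega>) ^ m * Y \<omega> \<partial>surface_measure) = 0"
proof -
  have "gauss_integral (\<lambda>y. complex_of_real (x \<bullet> y) ^ m * Y y) = 0"
  proof (cases "m < k")
    case False
    then obtain l where l: "m = l + k" by (metis add.commute le_Suc_ex not_less)
    with m False have "odd l" by auto
    then show ?thesis
      unfolding l gauss_integral_harmonic[OF Y] by (simp add: gauss_integral_inner_odd)
  qed (simp add: gauss_integral_harmonic_zero[OF Y])
  then show ?thesis
    unfolding inner_power_mult_harmonic[OF Y] using radial_moment_neq_0[where 'n = 'n] by simp
qed

text \<open>The Funk-Hecke eigenvalue. The Gaussian integral of (x . y)^(k + 2 j) Y is known from
  integration by parts, and equals \<open>?R\<close> times the wanted sphere integral. The moment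
  \<open>?R\<close> is calibrated by the radial power |y|^(2 (k + j)), whose sphere integral is the
  area.\<close>

lemma sphere_integral_inner_power:
  fixes Y :: "real ^ 'n \<Rightarrow> complex"
  assumes Y: "Y \<in> spherical_harmonics k"
  shows "(\<integral>\<omega>. complex_of_real (x \<bullet> \<omega>) ^ (k + 2 * j) * Y \<omega> \<partial>surface_measure)
    = fact (k + 2 * j) * (sphere_area TYPE('n) * harmonic_coeff CARD('n) k j) * complex_of_real (norm x) ^ (2 * j) * Y x"
    (is "?I = _")
proof -
  let ?Z = "gauss_integral (\<lambda>x :: real ^ 'n. 1)" and ?R = "radial_moment CARD('n) (2 * (k + j))"
  let ?P = "pochhammer (of_nat CARD('n) / 2) (k + j) :: complex"
  have Z: "?Z \<noteq> 0" by (rule gauss_integral_1_neq_0)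
  have P: "?P = of_real (pochhammer (real CARD('n) / 2) (k + j))"
    by (simp flip: pochhammer_of_real)
  then have P0: "?P \<noteq> 0"
    using pochhammer_pos[of "real CARD('n) / 2" "k + j"] by simp
  have "gauss_integral (\<lambda>x :: real ^ 'n. (complex_of_real (norm x) ^ 2) ^ (k + j))
      = ?R * (\<integral>\<omega>. (complex_of_real (norm \<omega>) ^ 2) ^ (k + j) \<partial>(surface_measure :: (real ^ 'n) measure))"
  proof (rule gauss_integral_homogeneous)
    fix t and x :: "real ^ 'n"
    have "(complex_of_real (norm (t *\<^sub>R x)))\<^sup>2 = (complex_of_real t)\<^sup>2 * (complex_of_real (norm x))\<^sup>2"
      by (simp add: power_mult_distrib flip: of_real_power)
    then show "((complex_of_real (norm (t *\<^sub>R x)))\<^sup>2) ^ (k + j) = complex_of_real (t ^ (2 * (k + j))) * ((complex_of_real (norm x))\<^sup>2) ^ (k + j)"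
      by (simp only: power_mult_distrib power_mult of_real_power)
  qed (intro cpoly_power cpoly_norm_sq)
  also have "(\<integral>\<omega>. (complex_of_real (norm \<omega>) ^ 2) ^ (k + j) \<partial>(surface_measure :: (real ^ 'n) measure))
      = (\<integral>\<omega>. 1 \<partial>(surface_measure :: (real ^ 'n) measure))"
    by (intro Bochner_Integration.integral_cong) (auto simp: space_surface_measure)
  also have "\<dots> = sphere_area TYPE('n)"
    by (simp add: sphere_area_def space_surface_measure scaleR_conv_of_real)
  finally have 1: "2 ^ (k + j) * ?P * ?Z = ?R * sphere_area TYPE('n)"
    by (simp only: gauss_integral_radial_power)
  \<comment> \<open>The polynomial (x . y)^(k + 2 j) Y has total degree 2 (k + j), which is why the
    same radial moment occurs in both computations.\<close>
  have idx: "k + 2 * j = 2 * j + k" "2 * (k + j) = 2 * j + k + k" by simp_all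
  have "?R * ?I = gauss_integral (\<lambda>y. complex_of_real (x \<bullet> y) ^ (2 * j + k) * Y y)"
    by (simp only: inner_power_mult_harmonic[OF Y] idx)
  also have "\<dots> = fact (k + 2 * j) / fact (2 * j) * (fact (2 * j) / (2 ^ j * fact j) * complex_of_real (norm x) ^ (2 * j) * ?Z) * Y x"
    by (simp only: gauss_integral_harmonic[OF Y] gauss_integral_inner_even idx)
  also have "\<dots> = fact (k + 2 * j) / (2 ^ j * fact j) * complex_of_real (norm x) ^ (2 * j) * Y x * ?Z"
    by simp
  also have "?Z = ?R * sphere_area TYPE('n) / (2 ^ (k + j) * ?P)"
    unfolding 1[symmetric] using P0 by simp
  finally have "?R * ?I = ?R * (fact (k + 2 * j) * (sphere_area TYPE('n) / (2 ^ j * fact j * (2 ^ (k + j) * ?P))) * complex_of_real (norm x) ^ (2 * j) * Y x)"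
    by simp
  then have "?I = fact (k + 2 * j) * (sphere_area TYPE('n) / (2 ^ j * fact j * (2 ^ (k + j) * ?P))) * complex_of_real (norm x) ^ (2 * j) * Y x"
    by (rule iffD1[OF mult_left_cancel[OF radial_moment_neq_0[where 'n = 'n]]])
  moreover have "sphere_area TYPE('n) / (2 ^ j * fact j * (2 ^ (k + j) * ?P)) = complex_of_real (sphere_area TYPE('n) * harmonic_coeff CARD('n) k j)"
    unfolding P harmonic_coeff_def
    by (simp add: power_add mult_ac flip: power_mult_distrib)
  ultimately show ?thesis by (simp only: of_real_mult of_real_fact)
qed

section \<open>Integral operators on the sphere and orthogonality of degrees\<close>

lemma integrable_surface_bounded:
  fixes f :: "real ^ 'n \<Rightarrow> complex"
  assumes "f \<in> borel_measurable surface_measure" "\<And>\<omega>. norm \<omega> = 1 \<Longrightarrow> cmod (f \<omega>) \<le> C"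
  shows "integrable surface_measure f"
  using assms by (intro surface.integrable_const_bound[of _ C]) (auto intro!: AE_I2 simp: space_surface_measure)

lemma cpoly_measurable_surface: "cpoly p \<Longrightarrow> p \<in> borel_measurable surface_measure"
  by (intro borel_measurable_surface_measure cpoly_measurable)

lemma continuous_sphere_bounded:
  fixes f :: "real ^ 'n \<Rightarrow> complex"
  assumes "continuous_on UNIV f" shows "\<exists>C. \<forall>\<omega>. norm \<omega> = 1 \<longrightarrow> cmod (f \<omega>) \<le> C"
proof -
  have "compact (f ` sphere 0 1)"
    using assms by (intro compact_continuous_image) (auto intro: continuous_on_subset)
  from compact_imp_bounded[OF this] obtain C where "\<forall>y\<in>f ` sphere 0 1. cmod y \<le> C"
    unfolding bounded_iff by blast
  then show ?thesis by (intro exI[of _ C]) simp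
qed

lemma integrable_surface_continuous:
  fixes f :: "real ^ 'n \<Rightarrow> complex"
  assumes "continuous_on UNIV f" shows "integrable surface_measure f"
proof -
  obtain C where "\<forall>\<omega>. norm \<omega> = 1 \<longrightarrow> cmod (f \<omega>) \<le> C"
    using continuous_sphere_bounded[OF assms] by blast
  then show ?thesis
    using assms by (intro integrable_surface_bounded borel_measurable_surface_measure borel_measurable_continuous_onI) auto
qed

lemma integrable_surface_cpoly: "cpoly p \<Longrightarrow> integrable surface_measure p"
  by (intro integrable_surface_continuous cpoly_continuous)

lemma (in pair_sigma_finite) kernel_integrable:
  fixes K :: "'a \<Rightarrow> 'b \<Rightarrow> complex"
  assumes K [measurable]: "(\<lambda>(x, y). K x y) \<in> borel_measurable (M1 \<Otimes>\<^sub>M M2)"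
    and C: "\<And>x y. x \<in> space M1 \<Longrightarrow> y \<in> space M2 \<Longrightarrow> cmod (K x y) \<le> C"
    and h: "integrable M1 h" and g: "integrable M2 g"
  shows "integrable (M1 \<Otimes>\<^sub>M M2) (\<lambda>(x, y). h x * (K x y * g y))"
proof (rule integrableI_bounded)
  have [measurable]: "g \<in> borel_measurable M2" "h \<in> borel_measurable M1"
    using g h by (auto dest: borel_measurable_integrable)
  show m: "(\<lambda>(x, y). h x * (K x y * g y)) \<in> borel_measurable (M1 \<Otimes>\<^sub>M M2)" by measurable
  have "(\<integral>\<^sup>+z. ennreal (cmod (case z of (x, y) \<Rightarrow> h x * (K x y * g y))) \<partial>(M1 \<Otimes>\<^sub>M M2))
      = (\<integral>\<^sup>+x. \<integral>\<^sup>+y. ennreal (cmod (h x * (K x y * g y))) \<partial>M2 \<partial>M1)"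
    by (subst M2.nn_integral_fst[symmetric]) (auto intro: m)
  also have "\<dots> \<le> (\<integral>\<^sup>+x. \<integral>\<^sup>+y. (ennreal C * ennreal (cmod (h x))) * ennreal (cmod (g y)) \<partial>M2 \<partial>M1)"
  proof (intro nn_integral_mono)
    fix x y assume "x \<in> space M1" "y \<in> space M2"
    then have K: "cmod (K x y) \<le> C" by (rule C)
    have "cmod (h x * (K x y * g y)) = cmod (K x y) * (cmod (h x) * cmod (g y))" by (simp add: norm_mult mult_ac)
    also have "\<dots> \<le> C * (cmod (h x) * cmod (g y))" using K by (intro mult_right_mono) auto
    finally show "ennreal (cmod (h x * (K x y * g y))) \<le> (ennreal C * ennreal (cmod (h x))) * ennreal (cmod (g y))"
      using order_trans[OF norm_ge_zero K] by (simp add: mult.assoc flip: ennreal_mult)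
  qed
  also have "\<dots> = ennreal C * (\<integral>\<^sup>+x. ennreal (cmod (h x)) \<partial>M1) * (\<integral>\<^sup>+y. ennreal (cmod (g y)) \<partial>M2)"
    by (simp add: nn_integral_cmult nn_integral_multc)
  also have "\<dots> < \<infinity>"
    using g h by (simp add: integrable_iff_bounded ennreal_mult_less_top)
  finally show "(\<integral>\<^sup>+z. ennreal (cmod (case z of (x, y) \<Rightarrow> h x * (K x y * g y))) \<partial>(M1 \<Otimes>\<^sub>M M2)) < \<infinity>" .
qed

text \<open>Stated for two arbitrary measures because it serves both the sphere paired with itself
  and the whole space paired with the sphere. The pairing is bilinear; conjugates are put into h by
  the caller.\<close>

lemma (in pair_sigma_finite) kernel_swap:
  fixes K :: "'a \<Rightarrow> 'b \<Rightarrow> complex"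
  assumes "(\<lambda>(x, y). K x y) \<in> borel_measurable (M1 \<Otimes>\<^sub>M M2)"
    and "\<And>x y. x \<in> space M1 \<Longrightarrow> y \<in> space M2 \<Longrightarrow> cmod (K x y) \<le> C"
    and "integrable M1 h" and "integrable M2 g"
  shows "(\<integral>x. h x * (\<integral>y. K x y * g y \<partial>M2) \<partial>M1) = (\<integral>y. g y * (\<integral>x. K x y * h x \<partial>M1) \<partial>M2)"
proof -
  have "(\<integral>x. h x * (\<integral>y. K x y * g y \<partial>M2) \<partial>M1) = (\<integral>x. (\<integral>y. h x * (K x y * g y) \<partial>M2) \<partial>M1)"
    by simp
  also have "\<dots> = (\<integral>y. (\<integral>x. h x * (K x y * g y) \<partial>M1) \<partial>M2)"
    by (rule Fubini_integral[symmetric], rule kernel_integrable[OF assms])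
  also have "\<dots> = (\<integral>y. (\<integral>x. g y * (K x y * h x) \<partial>M1) \<partial>M2)"
    by (simp add: mult_ac)
  finally show ?thesis by simp
qed

interpretation surface_pair: pair_sigma_finite surface_measure surface_measure ..

lemma measurable_fst_surface [measurable]:
  "fst \<in> (surface_measure :: (real ^ 'n) measure) \<Otimes>\<^sub>M N \<rightarrow>\<^sub>M borel"
  by (rule measurable_compose[OF measurable_fst measurable_ident_surface_measure])

lemma measurable_snd_surface [measurable]:
  "snd \<in> N \<Otimes>\<^sub>M (surface_measure :: (real ^ 'n) measure) \<rightarrow>\<^sub>M borel"
  by (rule measurable_compose[OF measurable_snd measurable_ident_surface_measure])

lemma measurable_continuous_kernel:
  fixes K :: "real ^ 'n \<Rightarrow> real ^ 'n \<Rightarrow> complex"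
  assumes "continuous_on UNIV (\<lambda>z. K (fst z) (snd z))"
  shows "(\<lambda>(\<omega>, \<eta>). K \<omega> \<eta>) \<in> borel_measurable (surface_measure \<Otimes>\<^sub>M surface_measure)"
proof -
  have "(\<lambda>z :: (real ^ 'n) \<times> (real ^ 'n). (fst z, snd z)) \<in> surface_measure \<Otimes>\<^sub>M surface_measure \<rightarrow>\<^sub>M borel"
    by (subst borel_prod[symmetric]) (intro measurable_Pair measurable_fst_surface measurable_snd_surface)
  moreover have "(\<lambda>z. K (fst z) (snd z)) \<in> borel_measurable borel"
    using assms by (rule borel_measurable_continuous_onI)
  ultimately have "(\<lambda>z. K (fst (fst z, snd z)) (snd (fst z, snd z))) \<in> borel_measurable (surface_measure \<Otimes>\<^sub>M surface_measure)"
    by (rule measurable_compose)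
  then show ?thesis by (simp add: split_beta')
qed

lemma inner_power_kernel:
  "(\<lambda>(\<omega>, \<eta>). complex_of_real (\<omega> \<bullet> \<eta>) ^ m) \<in> borel_measurable (surface_measure \<Otimes>\<^sub>M surface_measure)"
  "norm \<omega> = 1 \<Longrightarrow> norm \<eta> = 1 \<Longrightarrow> cmod (complex_of_real (\<omega> \<bullet> \<eta>) ^ m) \<le> 1"
proof -
  show "(\<lambda>(\<omega>, \<eta>). complex_of_real (\<omega> \<bullet> \<eta>) ^ m) \<in> borel_measurable (surface_measure \<Otimes>\<^sub>M surface_measure)"
    by (rule measurable_continuous_kernel) (intro continuous_intros)
  show "cmod (complex_of_real (\<omega> \<bullet> \<eta>) ^ m) \<le> 1" if "norm \<omega> = 1" "norm \<eta> = 1"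
    using Cauchy_Schwarz_ineq2[of \<omega> \<eta>] that by (auto simp: norm_power intro!: power_le_one)
qed

text \<open>The kernel is symmetric, so the operator can be moved from g to X, on which it acts as a
  scalar.\<close>

lemma inner_power_operator_adjoint:
  fixes g X :: "real ^ 'n \<Rightarrow> complex"
  assumes g: "integrable surface_measure g" and X: "X \<in> spherical_harmonics k"
  shows "(\<integral>\<omega>. X \<omega> * (\<integral>\<eta>. complex_of_real (\<omega> \<bullet> \<eta>) ^ k * g \<eta> \<partial>surface_measure) \<partial>surface_measure)
    = fact k * (sphere_area TYPE('n) * harmonic_coeff CARD('n) k 0) * (\<integral>\<omega>. g \<omega> * X \<omega> \<partial>surface_measure)"
proof -
  have "(\<integral>\<omega>. X \<omega> * (\<integral>\<eta>. complex_of_real (\<omega> \<bullet> \<eta>) ^ k * g \<eta> \<partial>surface_measure) \<partial>surface_measure)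
    = (\<integral>\<eta>. g \<eta> * (\<integral>\<omega>. complex_of_real (\<omega> \<bullet> \<eta>) ^ k * X \<omega> \<partial>surface_measure) \<partial>surface_measure)"
    using inner_power_kernel g X
    by (intro surface_pair.kernel_swap[where C = 1])
      (auto simp: spherical_harmonicsD integrable_surface_cpoly space_surface_measure)
  also have "\<dots> = (\<integral>\<eta>. (fact k * (sphere_area TYPE('n) * harmonic_coeff CARD('n) k 0)) * (g \<eta> * X \<eta>) \<partial>surface_measure)"
    using sphere_integral_inner_power[OF X, of _ 0]
    by (simp add: inner_commute mult_ac)
  finally show ?thesis by simp
qed

text \<open>The operator with kernel (\<omega> . \<eta>)^k annihilates the higher degree l and
  multiplies degree k by a nonzero scalar; since it is symmetric, the pairing must vanish.\<close>

lemma spherical_harmonics_orthogonal_less: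
  fixes X Y :: "real ^ 'n \<Rightarrow> complex"
  assumes X: "X \<in> spherical_harmonics k" and Y: "Y \<in> spherical_harmonics l" and "k < l"
  shows "(\<integral>\<omega>. X \<omega> * Y \<omega> \<partial>surface_measure) = 0"
proof -
  have "(\<integral>\<eta>. complex_of_real (\<omega> \<bullet> \<eta>) ^ k * Y \<eta> \<partial>surface_measure) = 0" for \<omega>
    by (rule sphere_integral_inner_power_zero[OF Y]) (use \<open>k < l\<close> in simp)
  with inner_power_operator_adjoint[OF integrable_surface_cpoly[OF spherical_harmonicsD(1)[OF Y]] X]
  have "fact k * (sphere_area TYPE('n) * harmonic_coeff CARD('n) k 0) * (\<integral>\<omega>. Y \<omega> * X \<omega> \<partial>surface_measure) = 0"
    by simp
  moreover have "fact k * complex_of_real (sphere_area TYPE('n) * harmonic_coeff CARD('n) k 0) \<noteq> 0"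
    using sphere_area_pos[where 'n = 'n] harmonic_coeff_pos[of "CARD('n)" k 0] by simp
  ultimately show ?thesis by (simp add: mult.commute)
qed

lemma spherical_harmonics_orthogonal:
  fixes X Y :: "real ^ 'n \<Rightarrow> complex"
  assumes "X \<in> spherical_harmonics k" "Y \<in> spherical_harmonics l" "k \<noteq> l"
  shows "(\<integral>\<omega>. X \<omega> * cnj (Y \<omega>) \<partial>surface_measure) = 0"
proof (cases "k < l")
  case True
  then show ?thesis using spherical_harmonics_orthogonal_less[OF _ spherical_harmonics_cnj] assms by blast
next
  case False
  then have "l < k" using assms by simp
  then show ?thesis
    using spherical_harmonics_orthogonal_less[OF spherical_harmonics_cnj[OF assms(2)] assms(1)] by (simp add: mult.commute)
qed

text \<open>One factor x . \<omega> is expanded into coordinates; x_i leaves the integral and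
  \<omega>_i is absorbed into h, which is why h is arbitrary in the induction.\<close>

lemma cpoly_inner_power_operator:
  "integrable surface_measure h \<Longrightarrow> cpoly (\<lambda>x. \<integral>\<omega>. complex_of_real (x \<bullet> \<omega>) ^ m * h \<omega> \<partial>surface_measure)"
proof (induction m arbitrary: h)
  case 0
  then show ?case by (simp add: cpoly.const)
next
  case (Suc m)
  have int: "integrable surface_measure (\<lambda>\<omega>. complex_of_real (\<omega> $ i) * h \<omega>)" for i
  proof (rule Bochner_Integration.integrable_bound[OF Suc.prems])
    have "(\<lambda>\<omega>. complex_of_real (\<omega> $ i)) \<in> borel_measurable surface_measure"
      by (intro cpoly_measurable_surface cpoly.intros)
    then show "(\<lambda>\<omega>. complex_of_real (\<omega> $ i) * h \<omega>) \<in> borel_measurable surface_measure"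
      using borel_measurable_integrable[OF Suc.prems] by measurable
    show "AE \<omega> in surface_measure. norm (complex_of_real (\<omega> $ i) * h \<omega>) \<le> norm (h \<omega>)"
    proof (intro AE_I2)
      fix \<omega> :: "real ^ 'a" assume "\<omega> \<in> space surface_measure"
      then have "\<bar>\<omega> $ i\<bar> \<le> 1" using component_le_norm_cart[of \<omega> i] by (simp add: space_surface_measure)
      then show "norm (complex_of_real (\<omega> $ i) * h \<omega>) \<le> norm (h \<omega>)"
        by (simp add: norm_mult mult_left_le_one_le)
    qed
  qed
  have int2: "integrable surface_measure (\<lambda>\<omega>. complex_of_real (x \<bullet> \<omega>) ^ m * (complex_of_real (\<omega> $ i) * h \<omega>))" for x i
  proof -
    have "continuous_on UNIV (\<lambda>\<omega>. complex_of_real (x \<bullet> \<omega>) ^ m)" by (intro continuous_intros)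
    from continuous_sphere_bounded[OF this] obtain C where C: "\<And>\<omega>. norm \<omega> = 1 \<Longrightarrow> cmod (complex_of_real (x \<bullet> \<omega>) ^ m) \<le> C"
      by blast
    show ?thesis
    proof (rule Bochner_Integration.integrable_bound)
      show "integrable surface_measure (\<lambda>\<omega>. C * cmod (complex_of_real (\<omega> $ i) * h \<omega>))"
        using int by (intro integrable_mult_right integrable_norm)
      have "(\<lambda>\<omega>. complex_of_real (x \<bullet> \<omega>) ^ m) \<in> borel_measurable surface_measure"
        by (intro cpoly_measurable_surface cpoly_power cpoly_inner)
      then show "(\<lambda>\<omega>. complex_of_real (x \<bullet> \<omega>) ^ m * (complex_of_real (\<omega> $ i) * h \<omega>)) \<in> borel_measurable surface_measure"
        using borel_measurable_integrable[OF int] by (rule borel_measurable_times)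
      show "AE \<omega> in surface_measure. norm (complex_of_real (x \<bullet> \<omega>) ^ m * (complex_of_real (\<omega> $ i) * h \<omega>))
          \<le> norm (C * cmod (complex_of_real (\<omega> $ i) * h \<omega>))"
      proof (intro AE_I2)
        fix \<omega> :: "real ^ 'a" assume "\<omega> \<in> space surface_measure"
        then have "cmod (complex_of_real (x \<bullet> \<omega>) ^ m) \<le> C" using C by (simp add: space_surface_measure)
        then have "cmod (complex_of_real (x \<bullet> \<omega>) ^ m) * cmod (complex_of_real (\<omega> $ i) * h \<omega>) \<le> C * cmod (complex_of_real (\<omega> $ i) * h \<omega>)"
          by (intro mult_right_mono) auto
        then show "norm (complex_of_real (x \<bullet> \<omega>) ^ m * (complex_of_real (\<omega> $ i) * h \<omega>)) \<le> norm (C * cmod (complex_of_real (\<omega> $ i) * h \<omega>))"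
          unfolding norm_mult[of "_ ^ m"] by (rule order_trans) simp
      qed
    qed
  qed
  have "(\<lambda>x. \<integral>\<omega>. complex_of_real (x \<bullet> \<omega>) ^ Suc m * h \<omega> \<partial>surface_measure)
    = (\<lambda>x. \<Sum>i\<in>UNIV. complex_of_real (x $ i) * (\<integral>\<omega>. complex_of_real (x \<bullet> \<omega>) ^ m * (complex_of_real (\<omega> $ i) * h \<omega>) \<partial>surface_measure))"
  proof
    fix x :: "real ^ 'a"
    have "complex_of_real (x \<bullet> \<omega>) ^ Suc m * h \<omega> = (\<Sum>i\<in>UNIV. complex_of_real (x $ i) * (complex_of_real (x \<bullet> \<omega>) ^ m * (complex_of_real (\<omega> $ i) * h \<omega>)))" for \<omega>
    proof -
      have "complex_of_real (x \<bullet> \<omega>) = (\<Sum>i\<in>UNIV. complex_of_real (x $ i) * complex_of_real (\<omega> $ i))"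
        by (simp add: inner_vec_def)
      from arg_cong[OF this, of "\<lambda>z. z * (complex_of_real (x \<bullet> \<omega>) ^ m * h \<omega>)"]
      have "complex_of_real (x \<bullet> \<omega>) ^ Suc m * h \<omega>
         = (\<Sum>i\<in>UNIV. complex_of_real (x $ i) * complex_of_real (\<omega> $ i)) * (complex_of_real (x \<bullet> \<omega>) ^ m * h \<omega>)"
        by (simp only: power_Suc mult.assoc)
      also have "\<dots> = (\<Sum>i\<in>UNIV. complex_of_real (x $ i) * (complex_of_real (x \<bullet> \<omega>) ^ m * (complex_of_real (\<omega> $ i) * h \<omega>)))"
        by (simp add: sum_distrib_right sum_distrib_left mult_ac)
      finally show ?thesis .
    qed
    then have "(\<integral>\<omega>. complex_of_real (x \<bullet> \<omega>) ^ Suc m * h \<omega> \<partial>surface_measure)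
       = (\<integral>\<omega>. (\<Sum>i\<in>UNIV. complex_of_real (x $ i) * (complex_of_real (x \<bullet> \<omega>) ^ m * (complex_of_real (\<omega> $ i) * h \<omega>))) \<partial>surface_measure)"
      by (simp only:)
    also have "\<dots> = (\<Sum>i\<in>UNIV. \<integral>\<omega>. complex_of_real (x $ i) * (complex_of_real (x \<bullet> \<omega>) ^ m * (complex_of_real (\<omega> $ i) * h \<omega>)) \<partial>surface_measure)"
      by (intro Bochner_Integration.integral_sum integrable_mult_right int2)
    finally show "(\<integral>\<omega>. complex_of_real (x \<bullet> \<omega>) ^ Suc m * h \<omega> \<partial>surface_measure)
       = (\<Sum>i\<in>UNIV. complex_of_real (x $ i) * (\<integral>\<omega>. complex_of_real (x \<bullet> \<omega>) ^ m * (complex_of_real (\<omega> $ i) * h \<omega>) \<partial>surface_measure))"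
      by simp
  qed
  moreover have "cpoly (\<lambda>x. \<Sum>i\<in>UNIV. complex_of_real (x $ i) * (\<integral>\<omega>. complex_of_real (x \<bullet> \<omega>) ^ m * (complex_of_real (\<omega> $ i) * h \<omega>) \<partial>surface_measure))"
    by (intro cpoly_sum cpoly.intros Suc.IH int)
  ultimately show ?case by simp
qed

section \<open>Square-integrable functions on the sphere\<close>

definition surface_nsq :: "(real ^ 'n \<Rightarrow> complex) \<Rightarrow> real" where
  "surface_nsq f = (\<integral>\<omega>. (cmod (f \<omega>))\<^sup>2 \<partial>surface_measure)"

lemma L2_norm_surface: "L2_norm surface_measure f = sqrt (surface_nsq f)"
  by (simp add: L2_norm_def surface_nsq_def)

lemma surface_nsq_nonneg: "0 \<le> surface_nsq f"
  by (simp add: surface_nsq_def)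

lemma L2D:
  assumes "f \<in> L2 M"
  shows "f \<in> borel_measurable M" "integrable M (\<lambda>x. (cmod (f x))\<^sup>2)"
  using assms by (auto simp: L2_def)

lemma cmod_add_square_le: "(cmod (a + b))\<^sup>2 \<le> 2 * (cmod a)\<^sup>2 + 2 * (cmod b)\<^sup>2"
proof -
  have "(cmod (a + b))\<^sup>2 \<le> (cmod a + cmod b)\<^sup>2"
    by (intro power_mono norm_triangle_ineq) simp
  also have "\<dots> \<le> 2 * (cmod a)\<^sup>2 + 2 * (cmod b)\<^sup>2"
    using zero_le_power2[of "cmod a - cmod b"] by (simp add: power2_eq_square algebra_simps)
  finally show ?thesis .
qed

lemma L2_add:
  assumes f: "f \<in> L2 M" and g: "g \<in> L2 M" shows "(\<lambda>x. f x + g x) \<in> L2 M"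
proof -
  have [measurable]: "f \<in> borel_measurable M" "g \<in> borel_measurable M" using f g by (auto dest: L2D)
  have "integrable M (\<lambda>x. (cmod (f x + g x))\<^sup>2)"
  proof (rule Bochner_Integration.integrable_bound)
    show "integrable M (\<lambda>x. 2 * (cmod (f x))\<^sup>2 + 2 * (cmod (g x))\<^sup>2)"
      using L2D(2)[OF f] L2D(2)[OF g] by auto
    show "AE x in M. norm ((cmod (f x + g x))\<^sup>2) \<le> norm (2 * (cmod (f x))\<^sup>2 + 2 * (cmod (g x))\<^sup>2)"
      using cmod_add_square_le by (intro AE_I2) simp
  qed measurable
  then show ?thesis by (simp add: L2_def)
qed

lemma L2_cmult: "f \<in> L2 M \<Longrightarrow> (\<lambda>x. c * f x) \<in> L2 M"
  by (auto simp: L2_def norm_mult power_mult_distrib)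

lemma L2_diff: "f \<in> L2 M \<Longrightarrow> g \<in> L2 M \<Longrightarrow> (\<lambda>x. f x - g x) \<in> L2 M"
  using L2_add[OF _ L2_cmult, of f M g "-1"] by simp

lemma L2_zero: "(\<lambda>x. 0) \<in> L2 M"
  by (simp add: L2_def)

lemma L2_sum: "finite I \<Longrightarrow> (\<And>i. i \<in> I \<Longrightarrow> f i \<in> L2 M) \<Longrightarrow> (\<lambda>x. \<Sum>i\<in>I. f i x) \<in> L2 M"
  by (induction I rule: finite_induct) (auto intro: L2_zero L2_add)

lemma L2_surface_bounded:
  fixes f :: "real ^ 'n \<Rightarrow> complex"
  assumes f [measurable]: "f \<in> borel_measurable surface_measure" and C: "\<And>\<omega>. norm \<omega> = 1 \<Longrightarrow> cmod (f \<omega>) \<le> C"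
  shows "f \<in> L2 surface_measure" "surface_nsq f \<le> C\<^sup>2 * sphere_area TYPE('n)"
proof -
  have C2: "(cmod (f \<omega>))\<^sup>2 \<le> C\<^sup>2" if "\<omega> \<in> space surface_measure" for \<omega>
    using C that by (intro power_mono) (auto simp: space_surface_measure)
  have int: "integrable surface_measure (\<lambda>\<omega>. (cmod (f \<omega>))\<^sup>2)"
    using C2 by (intro surface.integrable_const_bound[of _ "C\<^sup>2"]) (auto intro!: AE_I2)
  then show "f \<in> L2 surface_measure" by (simp add: L2_def)
  have "surface_nsq f \<le> (\<integral>\<omega>. C\<^sup>2 \<partial>(surface_measure :: (real ^ 'n) measure))"
    unfolding surface_nsq_def using C2 by (intro integral_mono int) auto
  then show "surface_nsq f \<le> C\<^sup>2 * sphere_area TYPE('n)"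
    by (simp add: sphere_area_def space_surface_measure mult.commute)
qed

lemma L2_surface_continuous:
  fixes f :: "real ^ 'n \<Rightarrow> complex"
  assumes f: "continuous_on UNIV f"
  shows "f \<in> L2 surface_measure"
proof -
  obtain C where "\<forall>\<omega>. norm \<omega> = 1 \<longrightarrow> cmod (f \<omega>) \<le> C"
    using continuous_sphere_bounded[OF f] by blast
  with f show ?thesis
    by (intro L2_surface_bounded(1) borel_measurable_surface_measure borel_measurable_continuous_onI) auto
qed

lemma L2_surface_cpoly: "cpoly p \<Longrightarrow> p \<in> L2 surface_measure"
  by (intro L2_surface_continuous cpoly_continuous)

lemma L2_surface_harmonic: "Y \<in> spherical_harmonics k \<Longrightarrow> Y \<in> L2 surface_measure"
  by (intro L2_surface_cpoly spherical_harmonicsD)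

text \<open>Pointwise |f| \<le> d + |f|^2 / d, separating |f| \<le> d from |f| > d. The free d plays
  the part of Cauchy-Schwarz: it is tuned when a small squared norm must give a small first
  moment.\<close>

lemma integral_cmod_surface_le:
  fixes f :: "real ^ 'n \<Rightarrow> complex"
  assumes f: "f \<in> L2 surface_measure" and "0 < d"
  shows "integrable surface_measure f"
    and "(\<integral>\<omega>. cmod (f \<omega>) \<partial>surface_measure) \<le> d * sphere_area TYPE('n) + surface_nsq f / d"
proof -
  have le: "cmod (f \<omega>) \<le> d + (cmod (f \<omega>))\<^sup>2 / d" for \<omega>
  proof (cases "cmod (f \<omega>) \<le> d")
    case False
    then have "cmod (f \<omega>) * d \<le> cmod (f \<omega>) * cmod (f \<omega>)" by (intro mult_left_mono) auto
    then have "cmod (f \<omega>) \<le> (cmod (f \<omega>))\<^sup>2 / d" using \<open>0 < d\<close> by (simp add: field_simps power2_eq_square)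
    then show ?thesis using \<open>0 < d\<close> by linarith
  qed (use \<open>0 < d\<close> in \<open>auto intro: add_increasing2\<close>)
  have int: "integrable surface_measure (\<lambda>\<omega>. d + (cmod (f \<omega>))\<^sup>2 / d)"
    using L2D[OF f] by auto
  show i: "integrable surface_measure f"
    using L2D[OF f] le \<open>0 < d\<close> by (intro Bochner_Integration.integrable_bound[OF int]) (auto intro!: AE_I2 simp: abs_of_pos add_pos_nonneg)
  have "(\<integral>\<omega>. cmod (f \<omega>) \<partial>surface_measure) \<le> (\<integral>\<omega>. d + (cmod (f \<omega>))\<^sup>2 / d \<partial>surface_measure)"
    using le by (intro integral_mono integrable_norm i int) auto
  also have "\<dots> = d * sphere_area TYPE('n) + surface_nsq f / d"
    using L2D[OF f] by (simp add: surface_nsq_def sphere_area_def space_surface_measure mult.commute)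
  finally show "(\<integral>\<omega>. cmod (f \<omega>) \<partial>surface_measure) \<le> d * sphere_area TYPE('n) + surface_nsq f / d" .
qed

lemma L2_surface_integrable: "f \<in> L2 surface_measure \<Longrightarrow> integrable surface_measure f"
  using integral_cmod_surface_le(1)[of f 1] by simp

lemma L2_mult_integrable:
  assumes f: "f \<in> L2 M" and g: "g \<in> L2 M"
  shows "integrable M (\<lambda>x. f x * cnj (g x))"
proof (rule Bochner_Integration.integrable_bound)
  show "integrable M (\<lambda>x. (cmod (f x))\<^sup>2 + (cmod (g x))\<^sup>2)"
    using L2D[OF f] L2D[OF g] by simp
  have [measurable]: "f \<in> borel_measurable M" "g \<in> borel_measurable M" using f g by (auto dest: L2D)
  have "(\<lambda>x. cnj (g x)) \<in> borel_measurable M"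
    using borel_measurable_continuous_on[OF _ \<open>g \<in> borel_measurable M\<close>, of cnj] by (simp add: continuous_on_cnj)
  then show "(\<lambda>x. f x * cnj (g x)) \<in> borel_measurable M" by measurable
  show "AE x in M. norm (f x * cnj (g x)) \<le> norm ((cmod (f x))\<^sup>2 + (cmod (g x))\<^sup>2)"
  proof (intro AE_I2)
    fix x
    have "2 * (cmod (f x) * cmod (g x)) \<le> (cmod (f x))\<^sup>2 + (cmod (g x))\<^sup>2"
      using zero_le_power2[of "cmod (f x) - cmod (g x)"] by (simp add: power2_eq_square algebra_simps)
    moreover have "0 \<le> cmod (f x) * cmod (g x)" by simp
    ultimately have "cmod (f x) * cmod (g x) \<le> (cmod (f x))\<^sup>2 + (cmod (g x))\<^sup>2" by linarith
    then show "norm (f x * cnj (g x)) \<le> norm ((cmod (f x))\<^sup>2 + (cmod (g x))\<^sup>2)"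
      by (simp add: norm_mult)
  qed
qed

definition surface_inner :: "(real ^ 'n \<Rightarrow> complex) \<Rightarrow> (real ^ 'n \<Rightarrow> complex) \<Rightarrow> complex" where
  "surface_inner f g = (\<integral>\<omega>. f \<omega> * cnj (g \<omega>) \<partial>surface_measure)"

lemma surface_inner_cmult_left: "surface_inner (\<lambda>x. c * f x) h = c * surface_inner f h"
  by (simp add: surface_inner_def mult.assoc)

lemma surface_inner_diff_left:
  "f \<in> L2 surface_measure \<Longrightarrow> g \<in> L2 surface_measure \<Longrightarrow> h \<in> L2 surface_measure \<Longrightarrow>
    surface_inner (\<lambda>x. f x - g x) h = surface_inner f h - surface_inner g h"
  by (simp add: surface_inner_def left_diff_distrib L2_mult_integrable)

lemma surface_inner_sum_left:
  "(\<And>i. i \<in> I \<Longrightarrow> f i \<in> L2 surface_measure) \<Longrightarrow> h \<in> L2 surface_measure \<Longrightarrow>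
    surface_inner (\<lambda>x. \<Sum>i\<in>I. f i x) h = (\<Sum>i\<in>I. surface_inner (f i) h)"
  by (simp add: surface_inner_def sum_distrib_right L2_mult_integrable)

lemma surface_inner_sum_right:
  "(\<And>i. i \<in> I \<Longrightarrow> f i \<in> L2 surface_measure) \<Longrightarrow> h \<in> L2 surface_measure \<Longrightarrow>
    surface_inner h (\<lambda>x. \<Sum>i\<in>I. f i x) = (\<Sum>i\<in>I. surface_inner h (f i))"
  by (simp add: surface_inner_def sum_distrib_left L2_mult_integrable)

lemma surface_nsq_add_orthogonal:
  assumes f: "f \<in> L2 surface_measure" and g: "g \<in> L2 surface_measure" and o: "surface_inner f g = 0"
  shows "surface_nsq (\<lambda>x. f x + g x) = surface_nsq f + surface_nsq g"
proof -
  have eq: "(cmod (f x + g x))\<^sup>2 = (cmod (f x))\<^sup>2 + (cmod (g x))\<^sup>2 + 2 * Re (f x * cnj (g x))" for x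
    unfolding cmod_power2 by (simp add: power2_eq_square algebra_simps)
  have "surface_nsq (\<lambda>x. f x + g x) = surface_nsq f + surface_nsq g + 2 * (\<integral>x. Re (f x * cnj (g x)) \<partial>surface_measure)"
    unfolding surface_nsq_def eq
    by (simp only: Bochner_Integration.integral_add Bochner_Integration.integrable_add integral_mult_right_zero
        integrable_mult_right integrable_Re[OF L2_mult_integrable[OF f g]] L2D(2)[OF f] L2D(2)[OF g])
  also have "(\<integral>x. Re (f x * cnj (g x)) \<partial>surface_measure) = Re (surface_inner f g)"
    unfolding surface_inner_def by (rule integral_Re[OF L2_mult_integrable[OF f g]])
  finally show ?thesis using o by simp
qed

text \<open>Young's inequality for the cross term, with weight d. The value d = 1 gives the triangle
  inequality for squares, and d \<rightarrow> 0 gives a sharp limit comparison in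
  \<open>parseval_harmonics\<close>.\<close>

lemma surface_nsq_add_le:
  assumes f: "f \<in> L2 surface_measure" and g: "g \<in> L2 surface_measure" and "0 < d"
  shows "surface_nsq (\<lambda>x. f x + g x) \<le> (1 + d) * surface_nsq f + (1 + 1 / d) * surface_nsq g"
proof -
  have "(cmod (f x + g x))\<^sup>2 \<le> (1 + d) * (cmod (f x))\<^sup>2 + (1 + 1 / d) * (cmod (g x))\<^sup>2" for x
  proof -
    have "(cmod (f x + g x))\<^sup>2 \<le> (cmod (f x) + cmod (g x))\<^sup>2"
      by (intro power_mono norm_triangle_ineq) simp
    also have "\<dots> \<le> (1 + d) * (cmod (f x))\<^sup>2 + (1 + 1 / d) * (cmod (g x))\<^sup>2"
    proof -
      have "0 \<le> (d * cmod (f x) - cmod (g x))\<^sup>2 / d" using \<open>0 < d\<close> by simp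
      also have "\<dots> = d * (cmod (f x))\<^sup>2 - 2 * cmod (f x) * cmod (g x) + (cmod (g x))\<^sup>2 / d"
        using \<open>0 < d\<close> by (simp add: power2_eq_square field_simps)
      finally show ?thesis by (simp add: power2_eq_square algebra_simps)
    qed
    finally show ?thesis .
  qed
  moreover have "integrable surface_measure (\<lambda>x. (1 + d) * (cmod (f x))\<^sup>2 + (1 + 1 / d) * (cmod (g x))\<^sup>2)"
    using L2D[OF f] L2D[OF g] by auto
  ultimately have "surface_nsq (\<lambda>x. f x + g x) \<le> (\<integral>x. (1 + d) * (cmod (f x))\<^sup>2 + (1 + 1 / d) * (cmod (g x))\<^sup>2 \<partial>surface_measure)"
    unfolding surface_nsq_def using L2D(2)[OF L2_add[OF f g]] by (intro integral_mono) auto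
  also have "\<dots> = (1 + d) * surface_nsq f + (1 + 1 / d) * surface_nsq g"
    using L2D[OF f] L2D[OF g] by (simp add: surface_nsq_def)
  finally show ?thesis .
qed

lemma surface_nsq_minus_commute: "surface_nsq (\<lambda>x. f x - g x) = surface_nsq (\<lambda>x. g x - f x)"
  by (simp add: surface_nsq_def norm_minus_commute)

lemma surface_nsq_cmult: "surface_nsq (\<lambda>x. c * f x) = (cmod c)\<^sup>2 * surface_nsq f"
  by (simp add: surface_nsq_def norm_mult power_mult_distrib)

lemma surface_nsq_triangle:
  assumes "f \<in> L2 surface_measure" "g \<in> L2 surface_measure" "h \<in> L2 surface_measure"
  shows "surface_nsq (\<lambda>x. f x - h x) \<le> 2 * surface_nsq (\<lambda>x. f x - g x) + 2 * surface_nsq (\<lambda>x. g x - h x)"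
  using surface_nsq_add_le[OF L2_diff[OF assms(1,2)] L2_diff[OF assms(2,3)], of 1] by simp

section \<open>Density of polynomials in the square-integrable functions\<close>

definition approximable :: "(real ^ 'n \<Rightarrow> complex) \<Rightarrow> bool" where
  "approximable f \<longleftrightarrow> f \<in> L2 surface_measure \<and>
     (\<forall>e>0. \<exists>p. cpoly p \<and> surface_nsq (\<lambda>\<omega>. f \<omega> - p \<omega>) < e)"

text \<open>The two errors are kept below e / 4 each, because the triangle inequality for squares
  doubles both.\<close>

lemma approximable_closure:
  assumes f: "f \<in> L2 surface_measure"
    and h: "\<And>e. 0 < e \<Longrightarrow> \<exists>h. approximable h \<and> surface_nsq (\<lambda>\<omega>. f \<omega> - h \<omega>) < e"
  shows "approximable f"
  unfolding approximable_def
proof (intro conjI f allI impI)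
  fix e :: real assume "0 < e"
  then obtain h where h: "approximable h" "surface_nsq (\<lambda>\<omega>. f \<omega> - h \<omega>) < e / 4"
    using h[of "e / 4"] by auto
  then obtain p where p: "cpoly p" "surface_nsq (\<lambda>\<omega>. h \<omega> - p \<omega>) < e / 4"
    using \<open>0 < e\<close> unfolding approximable_def by (meson divide_pos_pos zero_less_numeral)
  have "surface_nsq (\<lambda>\<omega>. f \<omega> - p \<omega>) < e"
    using surface_nsq_triangle[OF f _ L2_surface_cpoly[OF p(1)], of h] h p by (simp add: approximable_def)
  then show "\<exists>p. cpoly p \<and> surface_nsq (\<lambda>\<omega>. f \<omega> - p \<omega>) < e" using p by blast
qed

lemma approximable_add:
  assumes f: "approximable f" and g: "approximable g"
  shows "approximable (\<lambda>x. f x + g x)"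
  unfolding approximable_def
proof (intro conjI allI impI)
  have fL: "f \<in> L2 surface_measure" and gL: "g \<in> L2 surface_measure"
    using f g by (auto simp: approximable_def)
  then show "(\<lambda>x. f x + g x) \<in> L2 surface_measure" by (rule L2_add)
  fix e :: real assume "0 < e"
  then obtain p q where p: "cpoly p" "surface_nsq (\<lambda>\<omega>. f \<omega> - p \<omega>) < e / 4"
    and q: "cpoly q" "surface_nsq (\<lambda>\<omega>. g \<omega> - q \<omega>) < e / 4"
    using f g unfolding approximable_def by (meson divide_pos_pos zero_less_numeral)
  have "surface_nsq (\<lambda>\<omega>. (f \<omega> - p \<omega>) + (g \<omega> - q \<omega>)) \<le> 2 * surface_nsq (\<lambda>\<omega>. f \<omega> - p \<omega>) + 2 * surface_nsq (\<lambda>\<omega>. g \<omega> - q \<omega>)"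
    using surface_nsq_add_le[OF L2_diff[OF fL L2_surface_cpoly[OF p(1)]] L2_diff[OF gL L2_surface_cpoly[OF q(1)]], of 1] by simp
  also have "\<dots> < e" using p q by simp
  finally have "surface_nsq (\<lambda>\<omega>. (f \<omega> + g \<omega>) - (p \<omega> + q \<omega>)) < e"
    by (simp add: algebra_simps)
  then show "\<exists>p. cpoly p \<and> surface_nsq (\<lambda>\<omega>. (f \<omega> + g \<omega>) - p \<omega>) < e"
    using cpoly.add[OF p(1) q(1)] by (intro exI[of _ "\<lambda>\<omega>. p \<omega> + q \<omega>"]) simp
qed

lemma approximable_zero: "approximable (\<lambda>x. 0)"
  unfolding approximable_def
  by (auto intro!: L2_zero exI[of _ "\<lambda>_. 0"] cpoly.const simp: surface_nsq_def)

lemma approximable_cmult: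
  assumes f: "approximable f"
  shows "approximable (\<lambda>x. c * f x)"
proof (cases "c = 0")
  case False
  show ?thesis
    unfolding approximable_def
  proof (intro conjI allI impI)
    show "(\<lambda>x. c * f x) \<in> L2 surface_measure" using f by (auto simp: approximable_def intro: L2_cmult)
    fix e :: real assume "0 < e"
    then have "0 < e / (cmod c)\<^sup>2" using False by simp
    then obtain p where p: "cpoly p" "surface_nsq (\<lambda>\<omega>. f \<omega> - p \<omega>) < e / (cmod c)\<^sup>2"
      using f unfolding approximable_def by meson
    then have "surface_nsq (\<lambda>\<omega>. c * (f \<omega> - p \<omega>)) < e"
      unfolding surface_nsq_cmult using False by (simp add: field_simps)
    then show "\<exists>p. cpoly p \<and> surface_nsq (\<lambda>\<omega>. c * f \<omega> - p \<omega>) < e"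
      using cpoly.mult[OF cpoly.const[of c] p(1)] by (intro exI[of _ "\<lambda>\<omega>. c * p \<omega>"]) (simp add: algebra_simps)
  qed
qed (simp add: approximable_zero)

lemma approximable_sum: "finite I \<Longrightarrow> (\<And>i. i \<in> I \<Longrightarrow> approximable (f i)) \<Longrightarrow> approximable (\<lambda>x. \<Sum>i\<in>I. f i x)"
  by (induction I rule: finite_induct) (auto intro: approximable_zero approximable_add)

lemma approximable_continuous:
  fixes f :: "real ^ 'n \<Rightarrow> complex"
  assumes f: "continuous_on UNIV f"
  shows "approximable f"
  unfolding approximable_def
proof (intro conjI allI impI L2_surface_continuous f)
  fix e :: real assume "0 < e"
  let ?A = "sphere_area TYPE('n)"
  \<comment> \<open>A uniform error d costs at most d^2 times the area in squared norm, here e /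
    2.\<close>
  define d where "d = sqrt (e / (2 * ?A))"
  have A: "0 < ?A" by (rule sphere_area_pos)
  have d: "0 < d" "d\<^sup>2 * ?A = e / 2" using A \<open>0 < e\<close> by (auto simp: d_def)
  obtain p where p: "polynomial_function p" "\<forall>\<omega>\<in>sphere 0 1. norm (f \<omega> - p \<omega>) < d"
    using Stone_Weierstrass_polynomial_function[of "sphere 0 1" f d] d f
    by (auto intro: continuous_on_subset)
  then have cp: "cpoly p" by (simp add: cpoly_iff_polynomial_function)
  have "surface_nsq (\<lambda>\<omega>. f \<omega> - p \<omega>) \<le> d\<^sup>2 * ?A"
    using p(2) f cpoly_continuous[OF cp, of UNIV]
    by (intro L2_surface_bounded borel_measurable_surface_measure borel_measurable_continuous_onI continuous_intros)
      (auto intro: less_imp_le)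
  then show "\<exists>p. cpoly p \<and> surface_nsq (\<lambda>\<omega>. f \<omega> - p \<omega>) < e"
    using cp d(2) \<open>0 < e\<close> by (intro exI[of _ p]) auto
qed

lemma surface_nsq_dominated_limit:
  fixes f :: "real ^ 'n \<Rightarrow> complex"
  assumes f: "f \<in> L2 surface_measure" and s: "\<And>i. s i \<in> L2 surface_measure"
    and lim: "\<And>\<omega>. norm \<omega> = 1 \<Longrightarrow> (\<lambda>i. s i \<omega>) \<longlonglongrightarrow> f \<omega>"
    and le: "\<And>i \<omega>. norm \<omega> = 1 \<Longrightarrow> cmod (s i \<omega>) \<le> w \<omega>" and w: "integrable surface_measure (\<lambda>\<omega>. (w \<omega>)\<^sup>2)"
  shows "(\<lambda>i. surface_nsq (\<lambda>\<omega>. f \<omega> - s i \<omega>)) \<longlonglongrightarrow> 0"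
proof -
  have [measurable]: "f \<in> borel_measurable surface_measure" "s i \<in> borel_measurable surface_measure" for i
    using f s by (auto dest: L2D)
  have "(\<lambda>i. \<integral>\<omega>. (cmod (f \<omega> - s i \<omega>))\<^sup>2 \<partial>surface_measure) \<longlonglongrightarrow> (\<integral>\<omega>. 0 \<partial>(surface_measure :: (real ^ 'n) measure))"
  proof (rule integral_dominated_convergence)
    show "integrable surface_measure (\<lambda>\<omega>. 2 * (cmod (f \<omega>))\<^sup>2 + 2 * (w \<omega>)\<^sup>2)"
      using L2D[OF f] w by auto
    show "AE \<omega> in surface_measure. (\<lambda>i. (cmod (f \<omega> - s i \<omega>))\<^sup>2) \<longlonglongrightarrow> 0"
    proof (intro AE_I2)
      fix \<omega> :: "real ^ 'n" assume "\<omega> \<in> space surface_measure"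
      then have "(\<lambda>i. s i \<omega>) \<longlonglongrightarrow> f \<omega>" using lim by (simp add: space_surface_measure)
      then have "(\<lambda>i. (cmod (f \<omega> - s i \<omega>))\<^sup>2) \<longlonglongrightarrow> (cmod (f \<omega> - f \<omega>))\<^sup>2"
        by (intro tendsto_intros)
      then show "(\<lambda>i. (cmod (f \<omega> - s i \<omega>))\<^sup>2) \<longlonglongrightarrow> 0" by simp
    qed
    show "AE \<omega> in surface_measure. norm ((cmod (f \<omega> - s i \<omega>))\<^sup>2) \<le> 2 * (cmod (f \<omega>))\<^sup>2 + 2 * (w \<omega>)\<^sup>2" for i
    proof (intro AE_I2)
      fix \<omega> :: "real ^ 'n" assume "\<omega> \<in> space surface_measure"
      then have "(cmod (s i \<omega>))\<^sup>2 \<le> (w \<omega>)\<^sup>2" using le by (intro power_mono) (auto simp: space_surface_measure)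
      then show "norm ((cmod (f \<omega> - s i \<omega>))\<^sup>2) \<le> 2 * (cmod (f \<omega>))\<^sup>2 + 2 * (w \<omega>)\<^sup>2"
        using cmod_add_square_le[of "f \<omega>" "- s i \<omega>"] by simp
    qed
  qed auto
  then show ?thesis by (simp add: surface_nsq_def)
qed

lemma approximable_limit:
  fixes f :: "real ^ 'n \<Rightarrow> complex"
  assumes f: "f \<in> L2 surface_measure" and s: "\<And>i. approximable (s i)"
    and "\<And>\<omega>. norm \<omega> = 1 \<Longrightarrow> (\<lambda>i. s i \<omega>) \<longlonglongrightarrow> f \<omega>"
    and "\<And>i \<omega>. norm \<omega> = 1 \<Longrightarrow> cmod (s i \<omega>) \<le> w \<omega>" and "integrable surface_measure (\<lambda>\<omega>. (w \<omega>)\<^sup>2)"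
  shows "approximable f"
proof (rule approximable_closure[OF f])
  have "(\<lambda>i. surface_nsq (\<lambda>\<omega>. f \<omega> - s i \<omega>)) \<longlonglongrightarrow> 0"
    using assms by (intro surface_nsq_dominated_limit[of f s w]) (auto simp: approximable_def)
  then have ev: "\<forall>\<^sub>F i in sequentially. surface_nsq (\<lambda>\<omega>. f \<omega> - s i \<omega>) < e" if "0 < e" for e
    using that by (rule order_tendstoD)
  show "\<exists>h. approximable h \<and> surface_nsq (\<lambda>\<omega>. f \<omega> - h \<omega>) < e" if "0 < e" for e
    using eventually_happens'[OF sequentially_bot ev[OF that]] s by blast
qed

lemma approximable_indicator_compact:
  fixes K :: "(real ^ 'n) set"
  assumes K: "compact K"
  shows "approximable (\<lambda>\<omega>. complex_of_real (indicator K \<omega>))"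
\<comment> \<open>The tents max 0 (1 - i dist) decrease to the indicator of a closed nonempty K. The
  distance to the empty set is 0 by convention, so there they would be constantly 1.\<close>
proof (cases "K = {}")
  case False
  define s where "s i \<omega> = complex_of_real (max 0 (1 - real i * infdist \<omega> K))" for i and \<omega> :: "real ^ 'n"
  have "closed K" using K by (rule compact_imp_closed)
  then have [measurable]: "K \<in> sets borel" by simp
  show ?thesis
  proof (rule approximable_limit[where s = s and w = "\<lambda>_. 1"])
    have "(\<lambda>\<omega>. complex_of_real (indicator K \<omega>)) \<in> borel_measurable borel" by measurable
    then show "(\<lambda>\<omega>. complex_of_real (indicator K \<omega>)) \<in> L2 surface_measure"
      by (intro L2_surface_bounded(1)[where C = 1] borel_measurable_surface_measure) (auto simp: indicator_def)
    show "approximable (s i)" for i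
      unfolding s_def by (intro approximable_continuous continuous_intros)
    show "cmod (s i \<omega>) \<le> 1" for i \<omega>
      using infdist_nonneg[of \<omega> K] by (auto simp: s_def max_def)
    show "(\<lambda>i. s i \<omega>) \<longlonglongrightarrow> complex_of_real (indicator K \<omega>)" for \<omega>
    proof (cases "\<omega> \<in> K")
      case True
      then show ?thesis by (simp add: s_def)
    next
      case F: False
      then have pos: "0 < infdist \<omega> K"
        using in_closed_iff_infdist_zero[OF \<open>closed K\<close> False, of \<omega>] infdist_nonneg[of \<omega> K] by linarith
      obtain N where N: "1 < real N * infdist \<omega> K" using reals_Archimedean3[OF pos] by blast
      have "s i \<omega> = 0" if "N \<le> i" for i
      proof -
        have "real N * infdist \<omega> K \<le> real i * infdist \<omega> K" using that pos by (intro mult_right_mono) auto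
        then show ?thesis using N by (simp add: s_def)
      qed
      then have "\<forall>\<^sub>F i in sequentially. s i \<omega> = 0" by (auto simp: eventually_sequentially)
      then show ?thesis using F by (simp add: tendsto_eventually)
    qed
  qed auto
qed (simp add: approximable_zero)

lemma approximable_indicator:
  fixes A :: "(real ^ 'n) set"
  assumes A: "A \<in> sets surface_measure"
  shows "approximable (\<lambda>\<omega>. complex_of_real (indicator A \<omega>))"
proof (rule approximable_closure)
  have Ab [measurable]: "A \<in> sets borel" using A by (rule sets_surface_measure_borel)
  have "(\<lambda>\<omega>. complex_of_real (indicator A \<omega>)) \<in> borel_measurable borel" by measurable
  then show "(\<lambda>\<omega>. complex_of_real (indicator A \<omega>)) \<in> L2 surface_measure"
    by (intro L2_surface_bounded(1)[where C = 1] borel_measurable_surface_measure) (auto simp: indicator_def)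
  fix e :: real assume "0 < e"
  \<comment> \<open>Inner regularity by compact sets is applied to Borel measures on the whole
    space, hence the push-forward under the inclusion.\<close>
  let ?N = "distr surface_measure borel (\<lambda>x. x :: real ^ 'n)"
  have em: "emeasure ?N B = emeasure surface_measure (B \<inter> sphere 0 1)" if "B \<in> sets borel" for B
    using that by (subst emeasure_distr) (auto simp: measurable_ident_surface_measure space_surface_measure)
  have AS: "A \<subseteq> sphere 0 1" using sets.sets_into_space[OF A] by (simp add: space_surface_measure)
  have reg: "emeasure ?N A = (SUP K \<in> {K. K \<subseteq> A \<and> compact K}. emeasure ?N K)"
    by (rule inner_regular) (auto simp: em)
  have "\<exists>K. K \<subseteq> A \<and> compact K \<and> emeasure surface_measure A < emeasure surface_measure K + ennreal e"
  \<comment> \<open>Subtracting e lowers the measure strictly only if it is positive; a null set is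
    approximated by the empty compact set.\<close>
  proof (cases "emeasure surface_measure A = 0")
    case True
    then show ?thesis using \<open>0 < e\<close> by (intro exI[of _ "{}"]) auto
  next
    case False
    then have "emeasure surface_measure A - ennreal e < emeasure surface_measure A"
      using \<open>0 < e\<close> by (simp add: surface.emeasure_eq_measure ennreal_minus ennreal_lessI zero_less_measure_iff)
    also have "emeasure surface_measure A = (SUP K \<in> {K. K \<subseteq> A \<and> compact K}. emeasure ?N K)"
      using em[OF Ab] AS reg by (simp add: Int_absorb2)
    finally obtain K where K: "K \<subseteq> A" "compact K" "emeasure surface_measure A - ennreal e < emeasure ?N K"
      by (auto simp: less_SUP_iff)
    have "emeasure ?N K = emeasure surface_measure K"
      using em[of K] K AS by (simp add: Int_absorb2 compact_imp_closed subset_trans[OF K(1) AS])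
    then have "ennreal (measure surface_measure A - e) < ennreal (measure surface_measure K)"
      using K(3) \<open>0 < e\<close> by (simp add: surface.emeasure_eq_measure ennreal_minus)
    then have "measure surface_measure A - e < measure surface_measure K"
    proof (cases "0 \<le> measure surface_measure A - e")
      case False
      then show ?thesis using measure_nonneg[of surface_measure K] by linarith
    qed (simp add: ennreal_less_iff)
    then have "ennreal (measure surface_measure A) < ennreal (measure surface_measure K + e)"
      by (intro iffD2[OF ennreal_less_iff]) auto
    then have "emeasure surface_measure A < emeasure surface_measure K + ennreal e"
      using \<open>0 < e\<close> by (simp add: surface.emeasure_eq_measure)
    then show ?thesis using K by blast
  qed
  then obtain K where K: "K \<subseteq> A" "compact K" "emeasure surface_measure A < emeasure surface_measure K + ennreal e" by blast
  have [measurable]: "K \<in> sets borel" using K(2) by (simp add: compact_imp_closed)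
  have Ks: "K \<in> sets surface_measure"
    using K AS by (auto simp: sets_surface_measure sets_restrict_space intro!: image_eqI[of _ _ K] compact_imp_closed)
  have "surface_nsq (\<lambda>\<omega>. complex_of_real (indicator A \<omega>) - complex_of_real (indicator K \<omega>))
      = (\<integral>\<omega>. indicator (A - K) \<omega> \<partial>surface_measure)"
    unfolding surface_nsq_def using K(1) by (intro Bochner_Integration.integral_cong) (auto simp: indicator_def)
  also have "\<dots> = measure surface_measure (A - K)"
    using A Ks by (simp add: sets.sets_into_space Int_absorb2 sets.Diff)
  also have "\<dots> = measure surface_measure A - measure surface_measure K"
    using A Ks K(1) by (rule surface.finite_measure_Diff)
  also have "\<dots> < e"
  proof -
    have "ennreal (measure surface_measure A) < ennreal (measure surface_measure K + e)"
      using K(3) \<open>0 < e\<close> by (simp add: surface.emeasure_eq_measure)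
    then have "measure surface_measure A < measure surface_measure K + e"
      using ennreal_less_iff[of "measure surface_measure A"] by simp
    then show ?thesis by simp
  qed
  finally show "\<exists>h. approximable h \<and> surface_nsq (\<lambda>\<omega>. complex_of_real (indicator A \<omega>) - h \<omega>) < e"
    using approximable_indicator_compact[OF K(2)] by blast
qed

text \<open>Simple functions converge pointwise to f and stay below 2 |f|, whose square is
  integrable; each is a finite combination of indicators of its level sets.\<close>

lemma approximable_L2:
  fixes f :: "real ^ 'n \<Rightarrow> complex"
  assumes f: "f \<in> L2 surface_measure"
  shows "approximable f"
proof -
  obtain s where s: "\<And>i. simple_function surface_measure (s i)"
    and lim: "\<And>x. x \<in> space surface_measure \<Longrightarrow> (\<lambda>i. s i x) \<longlonglongrightarrow> f x"
    and le: "\<And>i x. x \<in> space surface_measure \<Longrightarrow> cmod (s i x) \<le> 2 * cmod (f x)"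
    using borel_measurable_implies_sequence_metric[OF L2D(1)[OF f], of 0] by auto metis
  have "approximable (\<lambda>\<omega>. \<Sum>y\<in>s i ` space surface_measure. y * complex_of_real (indicator (s i -` {y} \<inter> space surface_measure) \<omega>))" for i
    using s[of i] by (intro approximable_sum approximable_cmult approximable_indicator)
      (auto simp: simple_function_def)
  moreover have eq: "(\<Sum>y\<in>s i ` space surface_measure. y * complex_of_real (indicator (s i -` {y} \<inter> space surface_measure) \<omega>)) = s i \<omega>"
    if "norm \<omega> = 1" for i \<omega>
  proof -
    have \<omega>: "\<omega> \<in> space surface_measure" using that by (simp add: space_surface_measure)
    have "(\<Sum>y\<in>s i ` space surface_measure. y * complex_of_real (indicator (s i -` {y} \<inter> space surface_measure) \<omega>))
      = (\<Sum>y\<in>s i ` space surface_measure. if y = s i \<omega> then y else 0)"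
      using \<omega> by (intro sum.cong) (auto simp: indicator_def)
    also have "\<dots> = s i \<omega>"
      using s[of i] \<omega> by (subst sum.delta) (auto simp: simple_function_def)
    finally show ?thesis .
  qed
  ultimately show ?thesis
    using L2D[OF f] lim le
    by (intro approximable_limit[OF f, where w = "\<lambda>\<omega>. 2 * cmod (f \<omega>)"
          and s = "\<lambda>i \<omega>. \<Sum>y\<in>s i ` space surface_measure. y * complex_of_real (indicator (s i -` {y} \<inter> space surface_measure) \<omega>)"])
      (auto simp: eq space_surface_measure power_mult_distrib)
qed

section \<open>Expansion in spherical harmonics\<close>

lemma spherical_harmonics_sum_orthogonal:
  assumes "\<And>k. Y k \<in> spherical_harmonics k" "X \<in> spherical_harmonics l"
  shows "surface_inner (\<lambda>\<omega>. \<Sum>k<N. Y k \<omega>) X = (if l < N then surface_inner (Y l) X else 0)"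
proof -
  have "surface_inner (\<lambda>\<omega>. \<Sum>k<N. Y k \<omega>) X = (\<Sum>k<N. surface_inner (Y k) X)"
    using assms by (intro surface_inner_sum_left L2_surface_harmonic)
  also have "\<dots> = (\<Sum>k<N. if k = l then surface_inner (Y l) X else 0)"
    by (intro sum.cong) (auto simp: surface_inner_def intro!: spherical_harmonics_orthogonal[OF assms])
  finally show ?thesis by (simp add: sum.delta)
qed

lemma surface_nsq_sum_harmonics:
  assumes Y: "\<And>k. Y k \<in> spherical_harmonics k"
  shows "surface_nsq (\<lambda>\<omega>. \<Sum>k<N. Y k \<omega>) = (\<Sum>k<N. surface_nsq (Y k))"
proof (induction N)
  case (Suc N)
  have "surface_nsq (\<lambda>\<omega>. (\<Sum>k<N. Y k \<omega>) + Y N \<omega>) = surface_nsq (\<lambda>\<omega>. \<Sum>k<N. Y k \<omega>) + surface_nsq (Y N)"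
    using spherical_harmonics_sum_orthogonal[OF Y Y, of N N] Y
    by (intro surface_nsq_add_orthogonal L2_sum L2_surface_harmonic) auto
  then show ?case using Suc by simp
qed (simp add: surface_nsq_def)

text \<open>
  The operator with kernel \<open>(\<omega> \<bullet> \<eta>)\<^sup>k\<close> maps \<open>g\<close> to a polynomial and acts on degree \<open>k\<close> as a nonzero
  scalar, so the projection can be read off without any completeness argument.
\<close>

lemma harmonic_projection:
  fixes g :: "real ^ 'n \<Rightarrow> complex"
  assumes g: "g \<in> L2 surface_measure"
  shows "\<exists>Y\<in>spherical_harmonics k. \<forall>X\<in>spherical_harmonics k. surface_inner g X = surface_inner Y X"
proof -
  let ?c = "fact k * complex_of_real (sphere_area TYPE('n) * harmonic_coeff CARD('n) k 0)"
  let ?T = "\<lambda>x. \<integral>\<omega>. complex_of_real (x \<bullet> \<omega>) ^ k * g \<omega> \<partial>surface_measure"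
  have c: "?c \<noteq> 0"
    using sphere_area_pos[where 'n = 'n] harmonic_coeff_pos[of "CARD('n)" k 0] by simp
  have gi: "integrable surface_measure g" using g by (rule L2_surface_integrable)
  obtain N h where h: "\<And>l. h l \<in> spherical_harmonics l" and T: "\<And>x. x \<in> sphere 0 1 \<Longrightarrow> ?T x = (\<Sum>l<N. h l x)"
    using harmonic_sum_cpoly[OF cpoly_inner_power_operator[OF gi, of k]] unfolding harmonic_sum_def by metis
  \<comment> \<open>On the sphere the polynomial \<open>?T\<close> is a finite sum of harmonics, of
    which only the degree-k part pairs with X. If k \<ge> N there is no such part, hence the
    coefficient 0.\<close>
  define Y where "Y = (\<lambda>x. (if k < N then 1 / ?c else 0) * h k x)"
  have "surface_inner g X = surface_inner Y X" if X: "X \<in> spherical_harmonics k" for X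
  proof -
    have "?c * surface_inner g X = (\<integral>\<omega>. cnj (X \<omega>) * ?T \<omega> \<partial>surface_measure)"
      using inner_power_operator_adjoint[OF gi spherical_harmonics_cnj[OF X]] by (simp add: surface_inner_def)
    also have "\<dots> = surface_inner (\<lambda>\<omega>. \<Sum>l<N. h l \<omega>) X"
      unfolding surface_inner_def
      by (intro Bochner_Integration.integral_cong refl)
        (subst T, simp_all add: space_surface_measure mult.commute)
    also have "\<dots> = ?c * surface_inner Y X"
      using c unfolding spherical_harmonics_sum_orthogonal[OF h X] Y_def surface_inner_cmult_left by simp
    finally show ?thesis using c by simp
  qed
  moreover have "Y \<in> spherical_harmonics k"
    unfolding Y_def by (intro spherical_harmonics_cmult h)
  ultimately show ?thesis by blast
qed

text \<open>The projections of g are its best approximations by sums of harmonics. Any approximating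
  polynomial is such a sum on the sphere, so the partial sums do at least as well from its degree
  on.\<close>

lemma harmonic_expansion:
  fixes g :: "real ^ 'n \<Rightarrow> complex"
  assumes g: "g \<in> L2 surface_measure"
  shows "\<exists>Y. (\<forall>k. Y k \<in> spherical_harmonics k) \<and> (\<lambda>N. surface_nsq (\<lambda>\<omega>. g \<omega> - (\<Sum>k<N. Y k \<omega>))) \<longlonglongrightarrow> 0"
proof -
  have "\<forall>k. \<exists>Y\<in>spherical_harmonics k. \<forall>X\<in>spherical_harmonics k. surface_inner g X = surface_inner Y X"
    using harmonic_projection[OF g] by blast
  then obtain Y where Y: "\<And>k. Y k \<in> spherical_harmonics k"
    and gY: "\<And>k X. X \<in> spherical_harmonics k \<Longrightarrow> surface_inner g X = surface_inner (Y k) X"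
    by metis
  let ?S = "\<lambda>N \<omega>. \<Sum>k<N. Y k \<omega>"
  have SL: "?S N \<in> L2 surface_measure" for N using Y by (intro L2_sum L2_surface_harmonic) auto
  \<comment> \<open>The competitor is padded with zeros up to N. Its difference \<open>W\<close>
    from the projections is orthogonal to the remainder of g, so Pythagoras applies.\<close>
  have best: "surface_nsq (\<lambda>\<omega>. g \<omega> - ?S N \<omega>) \<le> surface_nsq (\<lambda>\<omega>. g \<omega> - (\<Sum>k<M. X k \<omega>))"
    if X: "\<And>k. X k \<in> spherical_harmonics k" and "M \<le> N" for X M N
  proof -
    define W where "W k = (\<lambda>\<omega>. Y k \<omega> - (if k < M then 1 else 0) * X k \<omega>)" for k
    have W: "W k \<in> spherical_harmonics k" for k
      unfolding W_def using X Y by (intro spherical_harmonics_diff spherical_harmonics_cmult)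
    have "(\<Sum>k<N. (if k < M then 1 else 0) * X k \<omega>) = (\<Sum>k<M. X k \<omega>)" for \<omega>
      using \<open>M \<le> N\<close> by (intro sum.mono_neutral_cong_right) auto
    then have SW: "g \<omega> - (\<Sum>k<M. X k \<omega>) = (g \<omega> - ?S N \<omega>) + (\<Sum>k<N. W k \<omega>)" for \<omega>
      unfolding W_def by (simp add: sum_subtractf)
    have "surface_inner (\<lambda>\<omega>. g \<omega> - ?S N \<omega>) (W k) = 0" if "k < N" for k
      using that spherical_harmonics_sum_orthogonal[OF Y W, of N k] gY[OF W]
      by (simp add: surface_inner_diff_left g SL L2_surface_harmonic[OF W])
    then have "surface_inner (\<lambda>\<omega>. g \<omega> - ?S N \<omega>) (\<lambda>\<omega>. \<Sum>k<N. W k \<omega>) = 0"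
      by (subst surface_inner_sum_right) (auto intro: L2_surface_harmonic[OF W] L2_diff g SL)
    then have "surface_nsq (\<lambda>\<omega>. (g \<omega> - ?S N \<omega>) + (\<Sum>k<N. W k \<omega>)) = surface_nsq (\<lambda>\<omega>. g \<omega> - ?S N \<omega>) + surface_nsq (\<lambda>\<omega>. \<Sum>k<N. W k \<omega>)"
      by (intro surface_nsq_add_orthogonal L2_diff g SL L2_sum L2_surface_harmonic[OF W]) auto
    then show ?thesis unfolding SW using surface_nsq_nonneg[of "\<lambda>\<omega>. \<Sum>k<N. W k \<omega>"] by linarith
  qed
  have "(\<lambda>N. surface_nsq (\<lambda>\<omega>. g \<omega> - ?S N \<omega>)) \<longlonglongrightarrow> 0"
  proof (rule LIMSEQ_I)
    fix e :: real assume "0 < e"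
    then obtain p where p: "cpoly p" "surface_nsq (\<lambda>\<omega>. g \<omega> - p \<omega>) < e"
      using approximable_L2[OF g] unfolding approximable_def by blast
    obtain M X where X: "\<And>l. X l \<in> spherical_harmonics l" and pX: "\<And>x. x \<in> sphere 0 1 \<Longrightarrow> p x = (\<Sum>l<M. X l x)"
      using harmonic_sum_cpoly[OF p(1)] unfolding harmonic_sum_def by metis
    have "surface_nsq (\<lambda>\<omega>. g \<omega> - (\<Sum>k<M. X k \<omega>)) = surface_nsq (\<lambda>\<omega>. g \<omega> - p \<omega>)"
      unfolding surface_nsq_def by (intro Bochner_Integration.integral_cong) (auto simp: space_surface_measure pX)
    then have "surface_nsq (\<lambda>\<omega>. g \<omega> - ?S N \<omega>) < e" if "M \<le> N" for N
      using best[OF X that] p(2) by simp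
    then show "\<exists>no. \<forall>N\<ge>no. norm (surface_nsq (\<lambda>\<omega>. g \<omega> - ?S N \<omega>) - 0) < e"
      by (intro exI[of _ M] allI impI) (simp add: abs_of_nonneg[OF surface_nsq_nonneg])
  qed
  with Y show ?thesis by blast
qed

text \<open>\<open>surface_nsq_add_le\<close> bounds f by the partial sums and the partial sums by
  f, each up to a factor 1 + d and an error that vanishes as N grows. Letting N grow first and d
  shrink afterwards gives equality.\<close>

lemma parseval_harmonics:
  fixes f :: "real ^ 'n \<Rightarrow> complex"
  assumes f: "f \<in> L2 surface_measure" and Y: "\<And>k. Y k \<in> spherical_harmonics k"
    and lim: "(\<lambda>N. surface_nsq (\<lambda>\<omega>. f \<omega> - (\<Sum>k<N. Y k \<omega>))) \<longlonglongrightarrow> 0"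
  shows "(\<lambda>k. surface_nsq (Y k)) sums surface_nsq f"
proof -
  let ?S = "\<lambda>N \<omega>. \<Sum>k<N. Y k \<omega>" and ?e = "\<lambda>N. surface_nsq (\<lambda>\<omega>. f \<omega> - (\<Sum>k<N. Y k \<omega>))"
  let ?s = "\<lambda>N. \<Sum>k<N. surface_nsq (Y k)"
  have SL: "?S N \<in> L2 surface_measure" for N using Y by (intro L2_sum L2_surface_harmonic) auto
  have up: "?s N \<le> (1 + d) * surface_nsq f + (1 + 1 / d) * ?e N" if "0 < d" for d N
    using surface_nsq_add_le[OF f L2_diff[OF SL f] that, of N]
    by (simp add: surface_nsq_sum_harmonics[OF Y] surface_nsq_minus_commute[of "?S N"])
  have lo: "surface_nsq f \<le> (1 + d) * ?s N + (1 + 1 / d) * ?e N" if "0 < d" for d N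
    using surface_nsq_add_le[OF SL L2_diff[OF f SL] that, of N N]
    by (simp add: surface_nsq_sum_harmonics[OF Y])
  have mono: "?s N \<le> ?s M" if "N \<le> M" for N M
    using that by (intro sum_mono2) (auto simp: surface_nsq_nonneg)
  have le: "?s N \<le> (1 + d) * surface_nsq f" if d: "0 < d" for d N
  proof (rule LIMSEQ_le_const)
    show "(\<lambda>M. (1 + d) * surface_nsq f + (1 + 1 / d) * ?e M) \<longlonglongrightarrow> (1 + d) * surface_nsq f"
      by (rule tendsto_eq_intros lim refl | simp)+
    show "\<exists>N'. \<forall>M\<ge>N'. ?s N \<le> (1 + d) * surface_nsq f + (1 + 1 / d) * ?e M"
      using order_trans[OF mono up[OF d]] by blast
  qed
  have summ: "summable (\<lambda>k. surface_nsq (Y k))"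
  proof (rule bounded_imp_summable)
    show "(\<Sum>k\<le>N. surface_nsq (Y k)) \<le> (1 + 1) * surface_nsq f" for N
      using le[of 1 "Suc N"] by (simp only: lessThan_Suc_atMost zero_less_one simp_thms)
  qed (rule surface_nsq_nonneg)
  then have conv: "?s \<longlonglongrightarrow> suminf (\<lambda>k. surface_nsq (Y k))" (is "_ \<longlonglongrightarrow> ?L")
    by (rule summable_LIMSEQ)
  have "?L \<le> (1 + d) * surface_nsq f" if "0 < d" for d
    using le[OF that] by (intro LIMSEQ_le_const2[OF conv]) auto
  moreover have "surface_nsq f \<le> (1 + d) * ?L" if d: "0 < d" for d
  proof (rule LIMSEQ_le_const)
    show "(\<lambda>M. (1 + d) * ?s M + (1 + 1 / d) * ?e M) \<longlonglongrightarrow> (1 + d) * ?L"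
      by (rule tendsto_eq_intros lim conv refl | simp)+
  qed (use lo[OF d] in blast)
  ultimately have ab: "?L \<le> surface_nsq f + d * surface_nsq f" "surface_nsq f \<le> ?L + d * ?L" if "0 < d" for d
    using that by (auto simp: algebra_simps)
  have small: "a \<le> b" if h: "\<And>d. 0 < d \<Longrightarrow> a \<le> b + d * c" "0 \<le> c" for a b c :: real
  proof (rule field_le_epsilon)
    fix e :: real assume "0 < e"
    \<comment> \<open>The denominator c + 1 covers c = 0 as well.\<close>
    have "a \<le> b + e / (c + 1) * c" using h \<open>0 < e\<close> by (intro h) auto
    also have "e / (c + 1) * c \<le> e" using \<open>0 < e\<close> \<open>0 \<le> c\<close> by (simp add: field_simps)
    finally show "a \<le> b + e" by simp
  qed
  have "?L = surface_nsq f"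
    using ab surface_nsq_nonneg summ by (intro antisym small[of ?L "surface_nsq f"] small[of "surface_nsq f" ?L])
      (auto intro: suminf_nonneg)
  with summ show ?thesis by (simp add: sums_iff)
qed

text \<open>The squared norm of the k-th difference is one term of the squared norm of the
  difference of the partial sums, which tends to 0. Only equality of norms is recorded, since the
  final computation sees the harmonic parts through their norms.\<close>

lemma harmonic_expansion_unique:
  fixes f :: "real ^ 'n \<Rightarrow> complex"
  assumes f: "f \<in> L2 surface_measure"
    and X: "\<And>k. X k \<in> spherical_harmonics k" and Y: "\<And>k. Y k \<in> spherical_harmonics k"
    and limX: "(\<lambda>N. surface_nsq (\<lambda>\<omega>. f \<omega> - (\<Sum>k<N. X k \<omega>))) \<longlonglongrightarrow> 0"
    and limY: "(\<lambda>N. surface_nsq (\<lambda>\<omega>. f \<omega> - (\<Sum>k<N. Y k \<omega>))) \<longlonglongrightarrow> 0"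
  shows "surface_nsq (X k) = surface_nsq (Y k)"
proof -
  let ?D = "\<lambda>k \<omega>. X k \<omega> - Y k \<omega>"
  have D: "?D k \<in> spherical_harmonics k" for k using X Y by (rule spherical_harmonics_diff)
  have L: "(\<lambda>\<omega>. \<Sum>k<N. X k \<omega>) \<in> L2 surface_measure" "(\<lambda>\<omega>. \<Sum>k<N. Y k \<omega>) \<in> L2 surface_measure" for N
    by (rule L2_sum, simp, rule L2_surface_harmonic, rule X)
      (rule L2_sum, simp, rule L2_surface_harmonic, rule Y)
  have "surface_nsq (?D k) \<le> 0"
  proof (rule LIMSEQ_le_const)
    show "(\<lambda>N. 2 * surface_nsq (\<lambda>\<omega>. f \<omega> - (\<Sum>k<N. X k \<omega>)) + 2 * surface_nsq (\<lambda>\<omega>. f \<omega> - (\<Sum>k<N. Y k \<omega>))) \<longlonglongrightarrow> 0"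
      by (rule tendsto_eq_intros limX limY refl | simp)+
    have "surface_nsq (?D k) \<le> 2 * surface_nsq (\<lambda>\<omega>. f \<omega> - (\<Sum>k<N. X k \<omega>)) + 2 * surface_nsq (\<lambda>\<omega>. f \<omega> - (\<Sum>k<N. Y k \<omega>))"
      if "Suc k \<le> N" for N
    proof -
      have "surface_nsq (?D k) \<le> (\<Sum>k<N. surface_nsq (?D k))"
        using that by (intro member_le_sum) (auto simp: surface_nsq_nonneg)
      also have "\<dots> = surface_nsq (\<lambda>\<omega>. (\<Sum>k<N. X k \<omega>) - (\<Sum>k<N. Y k \<omega>))"
        using surface_nsq_sum_harmonics[OF D, of N] by (simp add: sum_subtractf)
      also have "\<dots> \<le> 2 * surface_nsq (\<lambda>\<omega>. (\<Sum>k<N. X k \<omega>) - f \<omega>) + 2 * surface_nsq (\<lambda>\<omega>. f \<omega> - (\<Sum>k<N. Y k \<omega>))"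
        by (rule surface_nsq_triangle[OF L(1) f L(2)])
      finally show ?thesis by (simp add: surface_nsq_minus_commute[of f])
    qed
    then show "\<exists>N'. \<forall>N\<ge>N'. surface_nsq (?D k) \<le> 2 * surface_nsq (\<lambda>\<omega>. f \<omega> - (\<Sum>k<N. X k \<omega>)) + 2 * surface_nsq (\<lambda>\<omega>. f \<omega> - (\<Sum>k<N. Y k \<omega>))"
      by blast
  qed
  then have "(\<integral>\<omega>. (cmod (?D k \<omega>))\<^sup>2 \<partial>surface_measure) = 0"
    using surface_nsq_nonneg[of "?D k"] unfolding surface_nsq_def by linarith
  then have "AE \<omega> in surface_measure. (cmod (?D k \<omega>))\<^sup>2 = 0"
    by (subst (asm) integral_nonneg_eq_0_iff_AE) (auto intro!: L2D(2) L2_surface_harmonic[OF D])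
  then have "AE \<omega> in surface_measure. (cmod (X k \<omega>))\<^sup>2 = (cmod (Y k \<omega>))\<^sup>2"
    by eventually_elim simp
  then show ?thesis
    unfolding surface_nsq_def
    using L2D(2)[OF L2_surface_harmonic[OF X]] L2D(2)[OF L2_surface_harmonic[OF Y]]
    by (intro integral_cong_AE) (auto dest: borel_measurable_integrable)
qed

section \<open>The radial series and its asymptotics\<close>

text \<open>The integral over u > 0 of u^(p-1) e^(-u) against the j-th term of
  \<open>harmonic_bessel\<close>. Summed over j it is, up to constants, a Weber-Schafheitlin
  integral of a squared Bessel function against a power.\<close>

definition weber_term :: "nat \<Rightarrow> real \<Rightarrow> nat \<Rightarrow> nat \<Rightarrow> real" where
  "weber_term d p k j = harmonic_coeff d k j * Gamma (real k + 2 * real j + p)"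

lemma weber_term_pos: "0 < d \<Longrightarrow> 0 < p \<Longrightarrow> 0 < weber_term d p k j"
  unfolding weber_term_def by (intro mult_pos_pos harmonic_coeff_pos Gamma_real_pos) auto

lemma Gamma_real_plus1: "0 < z \<Longrightarrow> Gamma (z + 1) = z * Gamma z" for z :: real
  by (rule Gamma_plus1) (auto dest: nonpos_Ints_nonpos)

lemma one_divide_mult_cancel: "0 < x \<Longrightarrow> z = x * y \<Longrightarrow> 1 / z * x = 1 / y" for x y z :: real
  by simp

lemma harmonic_coeff_Suc_right:
  assumes "0 < d"
  shows "harmonic_coeff d k (Suc j) * (4 * (real j + 1) * (real d / 2 + real k + real j)) = harmonic_coeff d k j"
proof -
  let ?q = "4 * (real j + 1) * (real d / 2 + real k + real j)"
  have "0 < ?q" using assms by (intro mult_pos_pos add_pos_nonneg add_nonneg_pos) auto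
  moreover have "4 ^ Suc j * 2 ^ k * fact (Suc j) * pochhammer (real d / 2) (k + Suc j)
      = ?q * (4 ^ j * 2 ^ k * fact j * pochhammer (real d / 2) (k + j))"
    by (simp add: pochhammer_Suc algebra_simps)
  ultimately show ?thesis
    unfolding harmonic_coeff_def by (rule one_divide_mult_cancel)
qed

lemma harmonic_coeff_Suc_left:
  assumes "0 < d"
  shows "harmonic_coeff d (Suc k) j * (2 * (real d / 2 + real k + real j)) = harmonic_coeff d k j"
proof -
  let ?q = "2 * (real d / 2 + real k + real j)"
  have "0 < ?q" using assms by (intro mult_pos_pos add_pos_nonneg) auto
  moreover have "4 ^ j * 2 ^ Suc k * fact j * pochhammer (real d / 2) (Suc k + j)
      = ?q * (4 ^ j * 2 ^ k * fact j * pochhammer (real d / 2) (k + j))"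
    by (simp add: pochhammer_Suc algebra_simps)
  ultimately show ?thesis
    unfolding harmonic_coeff_def by (rule one_divide_mult_cancel)
qed

lemma weber_term_Suc_right:
  fixes p :: real and k j :: nat
  assumes "0 < d" "0 < p"
  defines "c \<equiv> real k + 2 * real j + p"
  shows "weber_term d p k (Suc j) * (4 * (real j + 1) * (real d / 2 + real k + real j)) = weber_term d p k j * (c * (c + 1))"
proof -
  have c: "0 < c" using assms by (auto simp: c_def intro!: add_nonneg_pos)
  have "real k + 2 * real (Suc j) + p = (c + 1) + 1" by (simp add: c_def)
  then have "Gamma (real k + 2 * real (Suc j) + p) = (c + 1) * (c * Gamma c)"
    using c by (simp only: Gamma_real_plus1[of "c + 1"] Gamma_real_plus1[of c])
  then show ?thesis
    unfolding weber_term_def harmonic_coeff_Suc_right[OF \<open>0 < d\<close>, of k j, symmetric] c_def by (simp only: mult_ac)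
qed

lemma weber_term_Suc_left:
  assumes "0 < d" "0 < p"
  shows "weber_term d p (Suc k) j * (2 * (real d / 2 + real k + real j)) = weber_term d p k j * (real k + 2 * real j + p)"
proof -
  let ?c = "real k + 2 * real j + p"
  have c: "0 < ?c" using assms by (auto intro!: add_nonneg_pos)
  have "real (Suc k) + 2 * real j + p = ?c + 1" by simp
  then have "Gamma (real (Suc k) + 2 * real j + p) = ?c * Gamma ?c"
    using c by (simp only: Gamma_real_plus1)
  then show ?thesis
    unfolding weber_term_def harmonic_coeff_Suc_left[OF \<open>0 < d\<close>, of k j, symmetric] by (simp only: mult_ac)
qed

text \<open>Zeilberger-type certificate: the right-hand side is a difference in \<open>j\<close> and sums to zero.\<close>

lemma weber_term_telescope:
  assumes "0 < d" "0 < p"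
  shows "(real k + p) * weber_term d p k j - (real k + real d - 1 - p) * weber_term d p (Suc k) j
    = 2 * real (Suc j) * weber_term d p k (Suc j) - 2 * real j * weber_term d p k j"
proof -
  let ?q = "real d / 2 + real k + real j" and ?t = "weber_term d p k j" and ?c = "real k + 2 * real j + p"
  have q: "0 < ?q" using assms by (intro add_pos_nonneg) auto
  have 1: "weber_term d p (Suc k) j * (2 * ?q) = ?t * ?c"
    by (rule weber_term_Suc_left[OF assms])
  have "(weber_term d p k (Suc j) * (2 * real (Suc j))) * (2 * ?q) = ?t * (?c * (?c + 1))"
    using weber_term_Suc_right[OF assms, of k j] by (simp add: algebra_simps)
  then have 2: "(2 * real (Suc j) * weber_term d p k (Suc j)) * (2 * ?q) = ?t * (?c * (?c + 1))"
    by (simp only: mult_ac)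
  \<comment> \<open>Multiplied by \<open>2 * ?q\<close>, both the neighbour in k and the neighbour
    in j become polynomial multiples of \<open>?t\<close>, and a polynomial identity
    remains.\<close>
  have "((real k + p) * ?t - (real k + real d - 1 - p) * weber_term d p (Suc k) j) * (2 * ?q)
     = (real k + p) * ?t * (2 * ?q) - (real k + real d - 1 - p) * (weber_term d p (Suc k) j * (2 * ?q))"
    by (simp only: left_diff_distrib mult.assoc)
  also have "\<dots> = ?t * (?c * (?c + 1)) - 2 * real j * ?t * (2 * ?q)"
    unfolding 1 by (simp add: algebra_simps)
  also have "\<dots> = (2 * real (Suc j) * weber_term d p k (Suc j) - 2 * real j * ?t) * (2 * ?q)"
    unfolding left_diff_distrib 2 ..
  finally show ?thesis
    by (rule iffD1[OF mult_right_cancel, rotated]) (use q in simp)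
qed

text \<open>The quotient of consecutive terms tends to 1, so Raabe's criterion decides. Its limit A
  / 4 = (1 + d - 2 p) / 2 exceeds 1 exactly when p < (d - 1) / 2; for p = (d - b) / 2 it is (1 + b)
  / 2, and the condition reads b > 1.\<close>

lemma weber_term_summable:
  assumes d: "0 < d" and p: "0 < p" and less: "p < (real d - 1) / 2"
  shows "summable (weber_term d p k)"
proof (rule raabes_test_convergence)
  show "\<forall>\<^sub>F j in sequentially. 0 < weber_term d p k j"
    using weber_term_pos[OF d p] by simp
  \<comment> \<open>The quadratic terms in j of numerator and denominator agree; their difference is
    A j + B.\<close>
  define A where "A = 2 + 2 * real d - 4 * p"
  define B where "B = 4 * (real d / 2 + real k) - (real k + p) * (real k + p + 1)"
  have frac: "t = w * (x / y)" if "w * x = t * y" "y \<noteq> 0" for t w x y :: real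
    using that by (simp add: field_simps)
  have frac2: "t / w = x" if "t = w * x" "w \<noteq> 0" for t w x :: real
    using that by simp
  have ratio: "real j * (weber_term d p k j / weber_term d p k (Suc j) - 1)
      = (A + B / real j) / ((2 + (real k + p) / real j) * (2 + (real k + p + 1) / real j))" if "0 < j" for j
  proof -
    let ?c = "real k + 2 * real j + p" and ?q = "4 * (real j + 1) * (real d / 2 + real k + real j)"
    have c: "0 < ?c" using p by (auto intro!: add_nonneg_pos)
    have "weber_term d p k j = weber_term d p k (Suc j) * (?q / (?c * (?c + 1)))"
      by (rule frac[OF weber_term_Suc_right[OF d p]]) (use c in simp)
    then have "weber_term d p k j / weber_term d p k (Suc j) = ?q / (?c * (?c + 1))"
      by (rule frac2) (use weber_term_pos[OF d p, of k "Suc j"] in simp)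
    then have "real j * (weber_term d p k j / weber_term d p k (Suc j) - 1) = real j * ((?q - ?c * (?c + 1)) / (?c * (?c + 1)))"
      using c by (simp add: diff_divide_distrib)
    also have "?q - ?c * (?c + 1) = real j * (A + B / real j)"
      using that by (simp add: A_def B_def field_simps)
    also have "?c * (?c + 1) = real j * (2 + (real k + p) / real j) * (real j * (2 + (real k + p + 1) / real j))"
      using that by (simp add: field_simps)
    finally show ?thesis using that by simp
  qed
  have lim: "(\<lambda>j. (A + B / real j) / ((2 + (real k + p) / real j) * (2 + (real k + p + 1) / real j))) \<longlonglongrightarrow> (A + 0) / ((2 + 0) * (2 + 0))"
    by (intro tendsto_intros lim_const_over_n) auto
  have "(\<lambda>j. real j * (weber_term d p k j / weber_term d p k (Suc j) - 1)) \<longlonglongrightarrow> A / 4"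
  proof (rule Lim_transform_eventually)
    show "\<forall>\<^sub>F j in sequentially. (A + B / real j) / ((2 + (real k + p) / real j) * (2 + (real k + p + 1) / real j))
       = real j * (weber_term d p k j / weber_term d p k (Suc j) - 1)"
      using eventually_gt_at_top[of 0] by eventually_elim (rule ratio[symmetric])
  qed (use lim in simp)
  then have "(\<lambda>j. ereal (real j * (weber_term d p k j / weber_term d p k (Suc j) - 1))) \<longlonglongrightarrow> ereal (A / 4)"
    by (rule tendsto_ereal)
  from lim_imp_Liminf[OF sequentially_bot this]
  show "1 < liminf (\<lambda>j. ereal (real j * (weber_term d p k j / weber_term d p k (Suc j) - 1)))"
    using less by (simp add: A_def)
qed

text \<open>Otherwise the terms would eventually exceed a multiple of 1 / j. This removes the
  boundary term of the telescoping sum.\<close>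

lemma summable_index_mult_limit_zero:
  fixes t :: "nat \<Rightarrow> real"
  assumes t: "summable t" "\<And>j. 0 \<le> t j" and lim: "(\<lambda>j. real j * t j) \<longlonglongrightarrow> M"
  shows "M = 0"
proof (rule ccontr)
  assume "M \<noteq> 0"
  moreover have "0 \<le> M" using t(2) by (intro LIMSEQ_le_const[OF lim]) auto
  ultimately have "0 < M" by simp
  then have "\<forall>\<^sub>F j in sequentially. M / 2 < real j * t j" using lim by (intro order_tendstoD) auto
  then have "\<forall>\<^sub>F j in sequentially. norm (1 / real j) \<le> 2 / M * t j"
    using eventually_gt_at_top[of 0] by eventually_elim (use \<open>0 < M\<close> in \<open>simp add: field_simps\<close>)
  then have "summable (\<lambda>j. 1 / real j)"
    using t(1) by (rule summable_comparison_test_ev[OF _ summable_mult])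
  then show False using not_summable_harmonic[where 'a = real] by (simp add: divide_inverse)
qed

section \<open>Recurrence in the degree and uniform growth\<close>

definition weber_sum :: "nat \<Rightarrow> real \<Rightarrow> nat \<Rightarrow> real" where
  "weber_sum d p k = (\<Sum>j. weber_term d p k j)"

lemma weber_sum_pos:
  assumes "0 < d" "0 < p" "p < (real d - 1) / 2" shows "0 < weber_sum d p k"
  unfolding weber_sum_def using weber_term_summable[OF assms] weber_term_pos[OF assms(1,2)] by (intro suminf_pos)

text \<open>Summing the certificate over j < J leaves the boundary term 2 J times the J-th term. It
  converges because both series do, and a limit of that shape is 0 for a summable sequence.\<close>

lemma weber_sum_Suc:
  assumes d: "0 < d" and p: "0 < p" and less: "p < (real d - 1) / 2"
  shows "(real k + p) * weber_sum d p k = (real k + real d - 1 - p) * weber_sum d p (Suc k)"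
proof -
  let ?M = "(real k + p) * weber_sum d p k - (real k + real d - 1 - p) * weber_sum d p (Suc k)"
  have summ: "summable (weber_term d p l)" for l by (rule weber_term_summable[OF assms])
  have "(\<lambda>j. (real k + p) * weber_term d p k j - (real k + real d - 1 - p) * weber_term d p (Suc k) j) sums ?M"
    unfolding weber_sum_def by (intro sums_diff sums_mult summable_sums summ)
  then have "(\<lambda>J. \<Sum>j<J. 2 * real (Suc j) * weber_term d p k (Suc j) - 2 * real j * weber_term d p k j) \<longlonglongrightarrow> ?M"
    unfolding weber_term_telescope[OF d p] by (simp add: sums_def)
  moreover have "(\<Sum>j<J. 2 * real (Suc j) * weber_term d p k (Suc j) - 2 * real j * weber_term d p k j) = 2 * real J * weber_term d p k J" for J
    by (subst sum_lessThan_telescope) simp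
  ultimately have "(\<lambda>J. 2 * real J * weber_term d p k J) \<longlonglongrightarrow> ?M" by (simp only:)
  then have "(\<lambda>J. real J * (2 * weber_term d p k J)) \<longlonglongrightarrow> ?M" by (simp add: mult_ac)
  then have "?M = 0"
    using weber_term_pos[OF d p] by (intro summable_index_mult_limit_zero[OF summable_mult[OF summ]]) (auto intro: less_imp_le)
  then show ?thesis by simp
qed

lemma weber_sum_pochhammer:
  assumes d: "0 < d" and p: "0 < p" and less: "p < (real d - 1) / 2"
  shows "weber_sum d p k = weber_sum d p 0 * (pochhammer p k / pochhammer (real d - 1 - p) k)"
proof (induction k)
  case (Suc k)
  have pos: "0 < real d - 1 - p + real k" using p less by (intro add_pos_nonneg) auto
  have "weber_sum d p (Suc k) = weber_sum d p k * ((p + real k) / (real d - 1 - p + real k))"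
    using weber_sum_Suc[OF assms, of k] pos by (simp add: field_simps)
  then show ?case
    by (simp add: Suc pochhammer_Suc)
qed simp

text \<open>The quotient of Euler's limit formulas for Gamma(q) and Gamma(p), in which the
  factorials cancel and the powers of n combine.\<close>

lemma pochhammer_ratio_limit:
  fixes p q :: real
  assumes "0 < p" "0 < q"
  shows "(\<lambda>n. pochhammer p (Suc n) / pochhammer q (Suc n) * real n powr (q - p)) \<longlonglongrightarrow> Gamma q / Gamma p"
proof (rule Lim_transform_eventually)
  have "Gamma p \<noteq> 0" using Gamma_real_pos[OF \<open>0 < p\<close>] by simp
  then show "(\<lambda>n. Gamma_series q n / Gamma_series p n) \<longlonglongrightarrow> Gamma q / Gamma p"
    by (intro tendsto_divide Gamma_series_LIMSEQ)
  show "\<forall>\<^sub>F n in sequentially. Gamma_series q n / Gamma_series p n = pochhammer p (Suc n) / pochhammer q (Suc n) * real n powr (q - p)"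
    using eventually_gt_at_top[of 0]
  proof eventually_elim
    case (elim n)
    then have "real n powr (q - p) = exp (q * ln (real n)) / exp (p * ln (real n))"
      by (simp add: powr_def left_diff_distrib exp_diff)
    then show ?case by (simp add: Gamma_series_def)
  qed
qed

text \<open>The product of multiplier and sum is positive and tends to a positive limit
  \<open>L\<close>: the sum decays like k^(p - q), and the exponent \<open>s\<close> is half of q -
  p because its base grows like k^2. Convergence of the product and of its inverse bounds
  both.\<close>

lemma weber_sum_bounds:
  assumes d: "0 < d" and p: "0 < p" and less: "p < (real d - 1) / 2"
  shows "\<exists>c C. 0 < c \<and> 0 < C \<and> (\<forall>k. c \<le> (1 + real (k * (k + d - 2))) powr ((real d - 1) / 2 - p) * weber_sum d p k \<and>
     (1 + real (k * (k + d - 2))) powr ((real d - 1) / 2 - p) * weber_sum d p k \<le> C)"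
proof -
  define s where "s = (real d - 1) / 2 - p"
  define q where "q = real d - 1 - p"
  have d2: "2 \<le> d" using p less by simp
  have s: "0 < s" "2 * s = q - p" using less by (auto simp: s_def q_def)
  have q: "0 < q" using p less by (simp add: q_def)
  define L where "L = weber_sum d p 0 * (Gamma q / Gamma p)"
  have L: "0 < L"
    unfolding L_def using weber_sum_pos[OF assms] Gamma_real_pos[OF q] Gamma_real_pos[OF p] by simp
  define W where "W k = (1 + real (k * (k + d - 2))) powr s * weber_sum d p k" for k
  have Wpos: "0 < W k" for k
    unfolding W_def using weber_sum_pos[OF assms]
    by (intro mult_pos_pos) (auto simp: add_pos_nonneg intro!: less_imp_neq[symmetric] add_pos_nonneg)
  \<comment> \<open>The index is shifted to n + 1 to fit \<open>pochhammer_ratio_limit\<close>,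
    where the rising factorials have length n + 1 while the power is one of n.\<close>
  have lim1: "(\<lambda>n. ((1 + real (Suc n * (Suc n + d - 2))) / (real n)\<^sup>2) powr s) \<longlonglongrightarrow> 1 powr s"
  proof (intro tendsto_powr tendsto_const)
    have "(\<lambda>n. (1 / real n) * (1 / real n) + (1 + 1 / real n) * (1 + (real d - 1) / real n)) \<longlonglongrightarrow> 0 * 0 + (1 + 0) * (1 + 0)"
      by (intro tendsto_intros lim_const_over_n)
    then have lim: "(\<lambda>n. (1 / real n) * (1 / real n) + (1 + 1 / real n) * (1 + (real d - 1) / real n)) \<longlonglongrightarrow> 1"
      by simp
    have eq: "(1 / real n) * (1 / real n) + (1 + 1 / real n) * (1 + (real d - 1) / real n) = (1 + real (Suc n * (Suc n + d - 2))) / (real n)\<^sup>2"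
      if "0 < n" for n
    proof -
      have "real (Suc n + d - 2) = real n + (real d - 1)" using d2 by (simp add: of_nat_diff)
      then have "real (Suc n * (Suc n + d - 2)) = (real n + 1) * (real n + (real d - 1))"
        by (simp only: of_nat_mult of_nat_Suc add.commute)
      then show ?thesis using that by (simp add: field_simps power2_eq_square)
    qed
    show "(\<lambda>n. (1 + real (Suc n * (Suc n + d - 2))) / (real n)\<^sup>2) \<longlonglongrightarrow> 1"
    proof (rule Lim_transform_eventually[OF lim])
      show "\<forall>\<^sub>F n in sequentially. (1 / real n) * (1 / real n) + (1 + 1 / real n) * (1 + (real d - 1) / real n)
         = (1 + real (Suc n * (Suc n + d - 2))) / (real n)\<^sup>2"
        using eventually_gt_at_top[of 0] by eventually_elim (rule eq)
    qed
  qed auto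
  have "(\<lambda>n. weber_sum d p 0 * (pochhammer p (Suc n) / pochhammer q (Suc n) * real n powr (q - p)) * ((1 + real (Suc n * (Suc n + d - 2))) / (real n)\<^sup>2) powr s) \<longlonglongrightarrow> L * 1 powr s"
    unfolding L_def by (intro tendsto_mult tendsto_const pochhammer_ratio_limit p q lim1)
  then have lim: "(\<lambda>n. weber_sum d p 0 * (pochhammer p (Suc n) / pochhammer q (Suc n) * real n powr (q - p)) * ((1 + real (Suc n * (Suc n + d - 2))) / (real n)\<^sup>2) powr s) \<longlonglongrightarrow> L"
    by simp
  have eq: "weber_sum d p 0 * (pochhammer p (Suc n) / pochhammer q (Suc n) * real n powr (q - p)) * ((1 + real (Suc n * (Suc n + d - 2))) / (real n)\<^sup>2) powr s = W (Suc n)"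
    if "0 < n" for n
  proof -
    have "((1 + real (Suc n * (Suc n + d - 2))) / (real n)\<^sup>2) powr s = (1 + real (Suc n * (Suc n + d - 2))) powr s / ((real n)\<^sup>2) powr s"
      by (rule powr_divide)
    moreover have "((real n)\<^sup>2) powr s = real n powr (q - p)"
      using that by (simp add: s(2)[symmetric] powr_powr flip: powr_numeral)
    ultimately show ?thesis
      unfolding W_def weber_sum_pochhammer[OF assms, of "Suc n"] q_def[symmetric] using that by simp
  qed
  have "(\<lambda>n. W (Suc n)) \<longlonglongrightarrow> L"
  proof (rule Lim_transform_eventually[OF lim])
    show "\<forall>\<^sub>F n in sequentially. weber_sum d p 0 * (pochhammer p (Suc n) / pochhammer q (Suc n) * real n powr (q - p))
        * ((1 + real (Suc n * (Suc n + d - 2))) / (real n)\<^sup>2) powr s = W (Suc n)"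
      using eventually_gt_at_top[of 0] by eventually_elim (rule eq)
  qed
  then have W: "W \<longlonglongrightarrow> L" by (simp only: filterlim_sequentially_Suc)
  from convergent_imp_Bseq[OF convergentI[OF W]] obtain C where C: "0 < C" "\<And>k. norm (W k) \<le> C"
    by (auto simp: Bseq_def)
  \<comment> \<open>A bound \<open>D\<close> for the inverse sequence supplies the lower constant 1
    / D for all k at once.\<close>
  have "(\<lambda>k. inverse (W k)) \<longlonglongrightarrow> inverse L" using W L by (intro tendsto_inverse) auto
  from convergent_imp_Bseq[OF convergentI[OF this]] obtain D where D: "0 < D" "\<And>k. norm (inverse (W k)) \<le> D"
    by (auto simp: Bseq_def)
  have "1 / D \<le> W k" for k
    using D(2)[of k] D(1) Wpos[of k] by (simp add: field_simps)
  moreover have "W k \<le> C" for k using C(2)[of k] Wpos[of k] by simp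
  ultimately show ?thesis
    using C(1) D(1) unfolding W_def s_def by (intro exI[of _ "1 / D"] exI[of _ C]) auto
qed

section \<open>Fourier transforms of measures on the sphere\<close>

text \<open>Equals Gamma(d/2) (z/2)^(1 - d/2) I_\<nu>(z) with \<nu> = k + d/2 - 1 and I the modified
  Bessel function; at z = -i r it becomes the ordinary Bessel function up to a power of r and a unit
  factor. The type is generic so that the real argument u of the energy and the imaginary one of the
  transform share one series.\<close>

definition harmonic_bessel :: "nat \<Rightarrow> nat \<Rightarrow> 'a :: {real_normed_field, banach} \<Rightarrow> 'a" where
  "harmonic_bessel d k z = (\<Sum>j. of_real (harmonic_coeff d k j) * z ^ (k + 2 * j))"

text \<open>For d \<ge> 2 every factor of the Pochhammer symbol beyond the k-th is at least 1.
  Dropping them compares the series with that of exp (|z|^2 / 4).\<close>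

lemma harmonic_coeff_le:
  assumes d: "2 \<le> d"
  shows "harmonic_coeff d k j \<le> harmonic_coeff d k 0 * ((1 / 4) ^ j / fact j)"
proof -
  have ge1: "1 \<le> pochhammer (real d / 2 + real k) j" for k
  proof (induction j)
    case (Suc j)
    have "1 * 1 \<le> pochhammer (real d / 2 + real k) j * (real d / 2 + real k + real j)"
      by (intro mult_mono) (use Suc d in auto)
    then show ?case by (simp add: pochhammer_Suc)
  qed simp
  have pos: "0 < pochhammer (real d / 2) k" using d by (intro pochhammer_pos) auto
  have "pochhammer (real d / 2) k * 1 \<le> pochhammer (real d / 2) k * pochhammer (real d / 2 + real k) j"
    using pos ge1 by (intro mult_left_mono) auto
  also have "\<dots> = pochhammer (real d / 2) (k + j)" by (rule pochhammer_product'[symmetric])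
  finally have "4 ^ j * 2 ^ k * fact j * pochhammer (real d / 2) k \<le> 4 ^ j * 2 ^ k * fact j * pochhammer (real d / 2) (k + j)"
    by (intro mult_left_mono) auto
  then have "harmonic_coeff d k j \<le> 1 / (4 ^ j * 2 ^ k * fact j * pochhammer (real d / 2) k)"
    unfolding harmonic_coeff_def using pos by (intro divide_left_mono) (auto intro!: mult_pos_pos less_le_trans[OF pos])
  also have "\<dots> = harmonic_coeff d k 0 * ((1 / 4) ^ j / fact j)"
    by (simp add: harmonic_coeff_def power_divide mult_ac)
  finally show ?thesis .
qed

lemma harmonic_bessel_term_le:
  fixes z :: "'a :: {real_normed_field, banach}"
  assumes d: "2 \<le> d"
  shows "norm (of_real (harmonic_coeff d k j) * z ^ (k + 2 * j))
    \<le> harmonic_coeff d k 0 * norm z ^ k * (((norm z)\<^sup>2 / 4) ^ j /\<^sub>R fact j)"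
proof -
  have pos: "0 < harmonic_coeff d k l" for l using d by (intro harmonic_coeff_pos) simp
  have "norm (of_real (harmonic_coeff d k j) * z ^ (k + 2 * j)) = harmonic_coeff d k j * norm z ^ (k + 2 * j)"
    using pos[of j] by (simp add: norm_mult norm_power)
  also have "\<dots> \<le> (harmonic_coeff d k 0 * ((1 / 4) ^ j / fact j)) * norm z ^ (k + 2 * j)"
    by (intro mult_right_mono harmonic_coeff_le d) auto
  also have "norm z ^ (k + 2 * j) = norm z ^ k * ((norm z)\<^sup>2) ^ j"
    by (simp only: power_add power_mult)
  also have "harmonic_coeff d k 0 * ((1 / 4) ^ j / fact j) * (norm z ^ k * ((norm z)\<^sup>2) ^ j)
      = harmonic_coeff d k 0 * norm z ^ k * (((norm z)\<^sup>2 / 4) ^ j /\<^sub>R fact j)"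
  proof -
    have "((norm z)\<^sup>2 / 4) ^ j = (1 / 4) ^ j * ((norm z)\<^sup>2) ^ j"
      by (simp flip: power_mult_distrib)
    then show ?thesis
      by (simp only: real_scaleR_def divide_real_def mult_ac)
  qed
  finally show ?thesis .
qed

lemma harmonic_bessel_summable_norm:
  fixes z :: "'a :: {real_normed_field, banach}"
  assumes d: "2 \<le> d"
  shows "summable (\<lambda>j. norm (of_real (harmonic_coeff d k j) * z ^ (k + 2 * j)))"
proof (rule summable_comparison_test')
  show "summable (\<lambda>j. harmonic_coeff d k 0 * norm z ^ k * (((norm z)\<^sup>2 / 4) ^ j /\<^sub>R fact j))"
    by (intro summable_mult sums_summable[OF exp_converges])
  show "norm (norm (of_real (harmonic_coeff d k j) * z ^ (k + 2 * j)))
      \<le> harmonic_coeff d k 0 * norm z ^ k * (((norm z)\<^sup>2 / 4) ^ j /\<^sub>R fact j)" for j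
    unfolding real_norm_def abs_norm_cancel by (rule harmonic_bessel_term_le[OF d])
qed

lemma harmonic_bessel_sums:
  fixes z :: "'a :: {real_normed_field, banach}"
  assumes "2 \<le> d"
  shows "(\<lambda>j. of_real (harmonic_coeff d k j) * z ^ (k + 2 * j)) sums harmonic_bessel d k z"
  unfolding harmonic_bessel_def
  by (rule summable_sums[OF summable_norm_cancel[OF harmonic_bessel_summable_norm[OF assms]]])

lemma norm_harmonic_bessel_le:
  fixes z :: "'a :: {real_normed_field, banach}"
  assumes d: "2 \<le> d"
  shows "norm (harmonic_bessel d k z) \<le> harmonic_coeff d k 0 * norm z ^ k * exp ((norm z)\<^sup>2 / 4)"
proof -
  have "(\<lambda>j. harmonic_coeff d k 0 * norm z ^ k * (((norm z)\<^sup>2 / 4) ^ j /\<^sub>R fact j)) sums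
      (harmonic_coeff d k 0 * norm z ^ k * exp ((norm z)\<^sup>2 / 4))"
    by (intro sums_mult exp_converges)
  from sums_le[OF harmonic_bessel_term_le[OF d] summable_sums[OF harmonic_bessel_summable_norm[OF d]] this]
  have "(\<Sum>j. norm (of_real (harmonic_coeff d k j) * z ^ (k + 2 * j))) \<le> harmonic_coeff d k 0 * norm z ^ k * exp ((norm z)\<^sup>2 / 4)" .
  moreover have "norm (harmonic_bessel d k z) \<le> (\<Sum>j. norm (of_real (harmonic_coeff d k j) * z ^ (k + 2 * j)))"
    unfolding harmonic_bessel_def by (rule summable_norm[OF harmonic_bessel_summable_norm[OF d]])
  ultimately show ?thesis by linarith
qed

lemma harmonic_bessel_of_real:
  "2 \<le> d \<Longrightarrow> harmonic_bessel d k (complex_of_real u) = complex_of_real (harmonic_bessel d k u)"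
  using sums_of_real[OF harmonic_bessel_sums[of d k u], where 'a = complex] harmonic_bessel_sums[of d k "complex_of_real u"]
  by (auto dest: sums_unique2)

lemma harmonic_bessel_nonneg: "2 \<le> d \<Longrightarrow> 0 \<le> u \<Longrightarrow> 0 \<le> harmonic_bessel d k u" for u :: real
  using sums_le[OF _ sums_zero harmonic_bessel_sums[of d k u]] harmonic_coeff_pos[of d k]
  by (auto simp: less_imp_le)

text \<open>The exponential series is integrated termwise, dominated by exp |z| times |Y|. Each
  monomial kernel acts on Y by its Funk-Hecke eigenvalue, and |\<omega>| = 1 removes the powers of
  the norm.\<close>

lemma sphere_integral_exp:
  fixes Y :: "real ^ 'n \<Rightarrow> complex" and z :: complex
  assumes n: "2 \<le> CARD('n)" and Y: "Y \<in> spherical_harmonics k" and \<omega>: "norm \<omega> = 1"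
  shows "(\<integral>\<eta>. exp (z * complex_of_real (\<omega> \<bullet> \<eta>)) * Y \<eta> \<partial>surface_measure)
    = sphere_area TYPE('n) * harmonic_bessel CARD('n) k z * Y \<omega>"
proof -
  define f where "f m \<eta> = z ^ m / fact m * (complex_of_real (\<omega> \<bullet> \<eta>) ^ m * Y \<eta>)" for m \<eta>
  have cY: "cpoly Y" using Y by (simp add: spherical_harmonicsD)
  have int: "integrable surface_measure (f m)" for m
    unfolding f_def by (intro integrable_surface_cpoly cpoly.mult cpoly.const cpoly_power cpoly_inner cY)
  have pt: "(\<lambda>m. f m \<eta>) sums (exp (z * complex_of_real (\<omega> \<bullet> \<eta>)) * Y \<eta>)" for \<eta>
  proof -
    have "(\<lambda>m. (z * complex_of_real (\<omega> \<bullet> \<eta>)) ^ m /\<^sub>R fact m * Y \<eta>) sums (exp (z * complex_of_real (\<omega> \<bullet> \<eta>)) * Y \<eta>)"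
      by (intro sums_mult2 exp_converges)
    moreover have "(z * complex_of_real (\<omega> \<bullet> \<eta>)) ^ m /\<^sub>R fact m * Y \<eta> = f m \<eta>" for m
      by (simp add: f_def scaleR_conv_of_real power_mult_distrib divide_inverse mult_ac)
    ultimately show ?thesis by (simp only:)
  qed
  have le: "norm (f m \<eta>) \<le> (norm z ^ m /\<^sub>R fact m) * cmod (Y \<eta>)" if "norm \<eta> = 1" for m \<eta>
  proof -
    have "cmod (complex_of_real (\<omega> \<bullet> \<eta>) ^ m) \<le> 1" by (rule inner_power_kernel(2)[OF \<omega> that])
    then have "cmod (complex_of_real (\<omega> \<bullet> \<eta>) ^ m) * cmod (Y \<eta>) \<le> 1 * cmod (Y \<eta>)" by (intro mult_right_mono) auto
    then have "(norm z ^ m / fact m) * (cmod (complex_of_real (\<omega> \<bullet> \<eta>) ^ m) * cmod (Y \<eta>)) \<le> (norm z ^ m / fact m) * cmod (Y \<eta>)"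
      by (intro mult_left_mono) auto
    then show ?thesis by (simp add: f_def norm_mult norm_divide norm_power norm_inverse divide_inverse mult_ac)
  qed
  have summ: "summable (\<lambda>m. (norm z ^ m /\<^sub>R fact m) * c)" for c :: real
    by (intro summable_mult2 sums_summable[OF exp_converges])
  have "(\<lambda>m. \<integral>\<eta>. f m \<eta> \<partial>surface_measure) sums (\<integral>\<eta>. (\<Sum>m. f m \<eta>) \<partial>surface_measure)"
  proof (rule sums_integral[OF int])
    show "AE \<eta> in surface_measure. summable (\<lambda>m. norm (f m \<eta>))"
    proof (intro AE_I2)
      fix \<eta> :: "real ^ 'n" assume "\<eta> \<in> space surface_measure"
      then have "norm (f m \<eta>) \<le> (norm z ^ m /\<^sub>R fact m) * cmod (Y \<eta>)" for m
        by (intro le) (simp add: space_surface_measure)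
      then show "summable (\<lambda>m. norm (f m \<eta>))"
        by (intro summable_comparison_test'[OF summ]) simp
    qed
    have "norm (\<integral>\<eta>. norm (f m \<eta>) \<partial>surface_measure) \<le> (norm z ^ m /\<^sub>R fact m) * (\<integral>\<eta>. cmod (Y \<eta>) \<partial>surface_measure)" for m
    proof -
      have "(\<integral>\<eta>. norm (f m \<eta>) \<partial>surface_measure) \<le> (\<integral>\<eta>. (norm z ^ m /\<^sub>R fact m) * cmod (Y \<eta>) \<partial>surface_measure)"
        using le by (intro integral_mono integrable_norm int integrable_mult_right integrable_surface_cpoly cY)
          (auto simp: space_surface_measure)
      then show ?thesis by (simp add: abs_of_nonneg)
    qed
    then show "summable (\<lambda>m. \<integral>\<eta>. norm (f m \<eta>) \<partial>surface_measure)"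
      by (intro summable_comparison_test'[OF summ]) auto
  qed
  also have "(\<lambda>\<eta>. \<Sum>m. f m \<eta>) = (\<lambda>\<eta>. exp (z * complex_of_real (\<omega> \<bullet> \<eta>)) * Y \<eta>)"
    using pt by (auto simp: sums_iff)
  finally have 1: "(\<lambda>m. \<integral>\<eta>. f m \<eta> \<partial>surface_measure) sums (\<integral>\<eta>. exp (z * complex_of_real (\<omega> \<bullet> \<eta>)) * Y \<eta> \<partial>surface_measure)" .
  have f: "(\<integral>\<eta>. f m \<eta> \<partial>surface_measure) = z ^ m / fact m * (\<integral>\<eta>. complex_of_real (\<omega> \<bullet> \<eta>) ^ m * Y \<eta> \<partial>surface_measure)" for m
    unfolding f_def by (rule integral_mult_right_zero)
  have "(\<lambda>j. \<integral>\<eta>. f (k + 2 * j) \<eta> \<partial>surface_measure) sums (\<integral>\<eta>. exp (z * complex_of_real (\<omega> \<bullet> \<eta>)) * Y \<eta> \<partial>surface_measure)"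
  \<comment> \<open>Only the powers m = k + 2 j survive: the monomial kernels of lower degree or of
    the wrong parity annihilate Y.\<close>
  proof (subst sums_mono_reindex)
    show "strict_mono (\<lambda>j. k + 2 * j)" by (auto simp: strict_mono_def)
    fix m assume m: "m \<notin> range (\<lambda>j. k + 2 * j)"
    have "m < k \<or> odd (m + k)"
    proof (rule ccontr)
      assume "\<not> (m < k \<or> odd (m + k))"
      then have "k \<le> m" and "even (m - k)" by (auto simp: even_diff_nat)
      from \<open>even (m - k)\<close> obtain j where "m - k = 2 * j" by (rule evenE)
      then have "m = k + 2 * j" using \<open>k \<le> m\<close> by simp
      with m show False by blast
    qed
    then show "(\<integral>\<eta>. f m \<eta> \<partial>surface_measure) = 0"
      unfolding f by (simp add: sphere_integral_inner_power_zero[OF Y])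
  qed (rule 1)
  moreover have "(\<integral>\<eta>. f (k + 2 * j) \<eta> \<partial>surface_measure) = sphere_area TYPE('n) * (of_real (harmonic_coeff CARD('n) k j) * z ^ (k + 2 * j)) * Y \<omega>" for j
    unfolding f sphere_integral_inner_power[OF Y] by (simp add: \<omega> mult_ac)
  moreover have "(\<lambda>j. sphere_area TYPE('n) * (of_real (harmonic_coeff CARD('n) k j) * z ^ (k + 2 * j)) * Y \<omega>) sums
      (sphere_area TYPE('n) * harmonic_bessel CARD('n) k z * Y \<omega>)"
    by (intro sums_mult2 sums_mult harmonic_bessel_sums n)
  ultimately show ?thesis by (simp only: sums_unique2)
qed

lemma sphere_fourier_harmonic:
  fixes Y :: "real ^ 'n \<Rightarrow> complex"
  assumes "2 \<le> CARD('n)" "Y \<in> spherical_harmonics k" "norm \<omega> = 1"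
  shows "sphere_fourier Y (r *\<^sub>R \<omega>) = sphere_area TYPE('n) * harmonic_bessel CARD('n) k (- \<i> * complex_of_real r) * Y \<omega>"
  using sphere_integral_exp[OF assms, of "- \<i> * complex_of_real r"] by (simp add: sphere_fourier_def mult.assoc)

section \<open>The Fourier transform of the Gaussian\<close>

definition gauss_mass :: "'n::finite itself \<Rightarrow> real" where
  "gauss_mass _ = (\<integral>x. gauss (x :: real ^ 'n) \<partial>lborel)"

lemma gauss_integral_1: "gauss_integral (\<lambda>x :: real ^ 'n. 1) = complex_of_real (gauss_mass TYPE('n))"
  by (simp add: gauss_integral_def gauss_mass_def)

lemma gauss_mass_pos: "0 < gauss_mass TYPE('n::finite)"
proof -
  have "0 \<le> gauss_mass TYPE('n)" unfolding gauss_mass_def by (intro integral_nonneg_AE) (simp add: gauss_pos less_imp_le)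
  moreover have "gauss_mass TYPE('n) \<noteq> 0"
    using gauss_integral_1_neq_0[where 'n = 'n] unfolding gauss_integral_1 by simp
  ultimately show ?thesis by simp
qed

text \<open>Odd moments of y . x vanish and the even ones resum to exp (- |y|^2 / 2). The partial
  sums of the exponential series are bounded by exp (|y| |x|), which the Gaussian absorbs.\<close>

lemma gauss_fourier:
  fixes y :: "real ^ 'n"
  shows "(\<integral>x. exp (\<i> * complex_of_real (y \<bullet> x)) * gauss x \<partial>lborel) = complex_of_real (gauss_mass TYPE('n) * gauss y)"
proof -
  define f where "f m x = \<i> ^ m / fact m * complex_of_real (y \<bullet> x) ^ m * complex_of_real (gauss x)" for m and x :: "real ^ 'n"
  have c: "cpoly (\<lambda>x. \<i> ^ m / fact m * complex_of_real (y \<bullet> x) ^ m)" for m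
    by (intro cpoly.mult cpoly.const cpoly_power cpoly_inner)
  have int: "integrable lborel (f m)" for m unfolding f_def by (rule integrable_cpoly_gauss[OF c])
  have trm: "(\<i> * complex_of_real t) ^ m /\<^sub>R fact m = \<i> ^ m / fact m * complex_of_real t ^ m" for m t
    by (simp add: scaleR_conv_of_real power_mult_distrib divide_inverse mult_ac)
  have "(\<lambda>M. \<integral>x. (\<Sum>m<M. f m x) \<partial>lborel) \<longlonglongrightarrow> (\<integral>x. exp (\<i> * complex_of_real (y \<bullet> x)) * gauss x \<partial>lborel)"
  proof (rule integral_dominated_convergence)
    show "integrable lborel (\<lambda>x :: real ^ 'n. exp ((norm y + 1)\<^sup>2 / 2) * exp (- norm x))"
      using integrable_exp_minus_norm by (rule integrable_mult_right)
    show "AE x in lborel. (\<lambda>M. \<Sum>m<M. f m x) \<longlonglongrightarrow> exp (\<i> * complex_of_real (y \<bullet> x)) * gauss x"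
    proof (intro always_eventually allI)
      fix x :: "real ^ 'n"
      have "(\<lambda>m. (\<i> * complex_of_real (y \<bullet> x)) ^ m /\<^sub>R fact m * gauss x) sums (exp (\<i> * complex_of_real (y \<bullet> x)) * gauss x)"
        by (intro sums_mult2 exp_converges)
      then show "(\<lambda>M. \<Sum>m<M. f m x) \<longlonglongrightarrow> exp (\<i> * complex_of_real (y \<bullet> x)) * gauss x"
        unfolding trm f_def by (simp add: sums_def)
    qed
    show "AE x in lborel. norm (\<Sum>m<M. f m x) \<le> exp ((norm y + 1)\<^sup>2 / 2) * exp (- norm x)" for M
    proof (intro always_eventually allI)
      fix x :: "real ^ 'n"
      have "norm (\<Sum>m<M. f m x) \<le> (\<Sum>m<M. norm (f m x))" by (rule norm_sum)
      also have "\<dots> = (\<Sum>m<M. \<bar>y \<bullet> x\<bar> ^ m /\<^sub>R fact m) * gauss x"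
        using gauss_pos[of x] by (simp add: f_def norm_mult norm_divide norm_power norm_inverse sum_distrib_left sum_distrib_right divide_inverse mult_ac)
      also have "(\<Sum>m<M. \<bar>y \<bullet> x\<bar> ^ m /\<^sub>R fact m) \<le> exp \<bar>y \<bullet> x\<bar>"
        unfolding exp_def by (intro sum_le_suminf sums_summable[OF exp_converges]) auto
      also have "\<bar>y \<bullet> x\<bar> \<le> norm y * norm x" by (rule Cauchy_Schwarz_ineq2)
      also have "exp (norm y * norm x) * gauss x \<le> exp ((norm y + 1)\<^sup>2 / 2) * exp (- norm x)"
        by (rule exp_linear_gauss_le)
      finally show "norm (\<Sum>m<M. f m x) \<le> exp ((norm y + 1)\<^sup>2 / 2) * exp (- norm x)"
        using gauss_pos[of x] by simp
    qed
    show "(\<lambda>x. \<Sum>m<M. f m x) \<in> borel_measurable lborel" for M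
      using borel_measurable_integrable[OF int] by measurable
    show "(\<lambda>x. exp (\<i> * complex_of_real (y \<bullet> x)) * gauss x) \<in> borel_measurable lborel"
      unfolding gauss_def measurable_lborel2 by (intro borel_measurable_continuous_onI continuous_intros) auto
  qed
  then have 1: "(\<lambda>m. \<integral>x. f m x \<partial>lborel) sums (\<integral>x. exp (\<i> * complex_of_real (y \<bullet> x)) * gauss x \<partial>lborel)"
    using int by (simp add: sums_def)
  have f: "(\<integral>x. f m x \<partial>lborel) = \<i> ^ m / fact m * gauss_integral (\<lambda>x. complex_of_real (y \<bullet> x) ^ m)" for m
    unfolding f_def gauss_integral_def mult.assoc by (rule integral_mult_right_zero)
  have "(\<lambda>j. \<integral>x. f (2 * j) x \<partial>lborel) sums (\<integral>x. exp (\<i> * complex_of_real (y \<bullet> x)) * gauss x \<partial>lborel)"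
  proof (subst sums_mono_reindex)
    show "strict_mono (\<lambda>j :: nat. 2 * j)" by (auto simp: strict_mono_def)
    fix m assume "m \<notin> range (\<lambda>j :: nat. 2 * j)"
    then have "odd m" by (auto elim: evenE)
    then show "(\<integral>x. f m x \<partial>lborel) = 0" unfolding f by (simp add: gauss_integral_inner_odd)
  qed (rule 1)
  moreover have "(\<integral>x. f (2 * j) x \<partial>lborel) = complex_of_real (((- (norm y)\<^sup>2 / 2) ^ j /\<^sub>R fact j) * gauss_mass TYPE('n))" for j
  proof -
    have i: "\<i> ^ (2 * j) = (-1) ^ j" by (simp add: power_mult)
    have "(- (norm y)\<^sup>2 / 2) ^ j = (-1) ^ j * norm y ^ (2 * j) / 2 ^ j"
    proof -
      have "- (norm y)\<^sup>2 / 2 = (-1) * (norm y)\<^sup>2 / 2" by simp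
      then show ?thesis by (simp only: power_divide power_mult_distrib power_mult)
    qed
    then have h: "(- (norm y)\<^sup>2 / 2) ^ j /\<^sub>R fact j = (-1) ^ j * norm y ^ (2 * j) / (2 ^ j * fact j)"
      by (simp only: real_scaleR_def) (simp add: field_simps)
    show ?thesis
      unfolding f gauss_integral_inner_even gauss_integral_1 h i by simp
  qed
  moreover have "(\<lambda>j. complex_of_real (((- (norm y)\<^sup>2 / 2) ^ j /\<^sub>R fact j) * gauss_mass TYPE('n))) sums complex_of_real (gauss y * gauss_mass TYPE('n))"
    unfolding gauss_def by (intro sums_of_real sums_mult2 exp_converges)
  ultimately show ?thesis by (simp only: sums_unique2 mult.commute)
qed

lemma integral_lborel_scaleR:
  fixes f :: "real ^ 'n \<Rightarrow> complex"
  assumes c: "0 < c" and f [measurable]: "f \<in> borel_measurable borel"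
  shows "(\<integral>x. f x \<partial>lborel) = complex_of_real (c ^ CARD('n)) * (\<integral>x. f (c *\<^sub>R x) \<partial>lborel)"
proof -
  have "(\<integral>x. f x \<partial>lborel) = (\<integral>x. f x \<partial>density (distr lborel borel (\<lambda>x. 0 + c *\<^sub>R x)) (\<lambda>_. \<bar>c\<bar>^DIM(real ^ 'n)))"
    using c by (subst lborel_affine[of c 0]) auto
  also have "\<dots> = (\<integral>x. (c ^ CARD('n)) *\<^sub>R f x \<partial>distr lborel borel (\<lambda>x. 0 + c *\<^sub>R x))"
    using c by (subst integral_density) auto
  also have "\<dots> = (\<integral>x. (c ^ CARD('n)) *\<^sub>R f (c *\<^sub>R x) \<partial>lborel)"
    by (subst integral_distr) auto
  finally show ?thesis by (simp add: scaleR_conv_of_real)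
qed

lemma gauss_scaled_fourier:
  fixes y :: "real ^ 'n"
  assumes u: "0 < u"
  shows "(\<integral>x. exp (\<i> * complex_of_real (y \<bullet> x)) * complex_of_real (exp (- (norm x)\<^sup>2 / (2 * u))) \<partial>lborel)
    = complex_of_real (sqrt u ^ CARD('n) * gauss_mass TYPE('n) * exp (- u * (norm y)\<^sup>2 / 2))"
proof -
  let ?f = "\<lambda>x :: real ^ 'n. exp (\<i> * complex_of_real (y \<bullet> x)) * complex_of_real (exp (- (norm x)\<^sup>2 / (2 * u)))"
  have "?f \<in> borel_measurable borel"
    using u by (intro borel_measurable_continuous_onI continuous_intros) auto
  from integral_lborel_scaleR[of "sqrt u", OF _ this]
  have "(\<integral>x. ?f x \<partial>lborel) = complex_of_real (sqrt u ^ CARD('n)) * (\<integral>x. ?f (sqrt u *\<^sub>R x) \<partial>lborel)"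
    using u by simp
  also have "(\<lambda>x. ?f (sqrt u *\<^sub>R x)) = (\<lambda>x. exp (\<i> * complex_of_real ((sqrt u *\<^sub>R y) \<bullet> x)) * gauss x)"
    using u by (auto simp: gauss_def power_mult_distrib)
  also have "(\<integral>x. exp (\<i> * complex_of_real ((sqrt u *\<^sub>R y) \<bullet> x)) * gauss x \<partial>lborel)
      = complex_of_real (gauss_mass TYPE('n) * gauss (sqrt u *\<^sub>R y))"
    by (rule gauss_fourier)
  also have "gauss (sqrt u *\<^sub>R y) = exp (- u * (norm y)\<^sup>2 / 2)"
    using u by (simp add: gauss_def power_mult_distrib)
  finally show ?thesis by simp
qed

lemma integrable_gauss_scaled:
  assumes "0 < u" shows "integrable lborel (\<lambda>x :: real ^ 'n. complex_of_real (exp (- (norm x)\<^sup>2 / (2 * u))))"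
proof (rule integrable_le_exp_minus_norm)
  show "(\<lambda>x :: real ^ 'n. complex_of_real (exp (- (norm x)\<^sup>2 / (2 * u)))) \<in> borel_measurable borel"
    using assms by (intro borel_measurable_continuous_onI continuous_intros) auto
  fix x :: "real ^ 'n"
  have "0 \<le> (norm x - u)\<^sup>2 / (2 * u)" using assms by simp
  also have "\<dots> = (norm x)\<^sup>2 / (2 * u) - norm x + u / 2"
    using assms by (simp add: power2_eq_square field_simps)
  finally have "exp (- (norm x)\<^sup>2 / (2 * u)) \<le> exp (u / 2 + - norm x)" by simp
  then show "norm (complex_of_real (exp (- (norm x)\<^sup>2 / (2 * u)))) \<le> exp (u / 2) * exp (- norm x)"
    unfolding exp_add by simp
qed

section \<open>Gaussian-weighted energy of the transform of a harmonic\<close>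

interpretation lborel_surface: pair_sigma_finite lborel surface_measure ..

lemma measurable_fourier_kernel:
  "(\<lambda>(x, \<omega>). exp (c * complex_of_real (x \<bullet> \<omega>))) \<in> borel_measurable (lborel \<Otimes>\<^sub>M (surface_measure :: (real ^ 'n) measure))"
proof -
  have "fst \<in> lborel \<Otimes>\<^sub>M (surface_measure :: (real ^ 'n) measure) \<rightarrow>\<^sub>M (borel :: (real ^ 'n) measure)"
    using measurable_fst[of lborel] by simp
  then have "(\<lambda>z :: (real ^ 'n) \<times> (real ^ 'n). (fst z, snd z)) \<in> lborel \<Otimes>\<^sub>M surface_measure \<rightarrow>\<^sub>M borel"
    by (subst borel_prod[symmetric]) (intro measurable_Pair measurable_snd_surface)
  moreover have "(\<lambda>z :: (real ^ 'n) \<times> (real ^ 'n). exp (c * complex_of_real (fst z \<bullet> snd z))) \<in> borel_measurable borel"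
    by (intro borel_measurable_continuous_onI continuous_intros)
  ultimately have "(\<lambda>z :: (real ^ 'n) \<times> (real ^ 'n). exp (c * complex_of_real (fst (fst z, snd z) \<bullet> snd (fst z, snd z)))) \<in> borel_measurable (lborel \<Otimes>\<^sub>M surface_measure)"
    by (rule measurable_compose)
  then show ?thesis by (simp add: split_beta')
qed

lemma sphere_fourier_measurable:
  fixes g :: "real ^ 'n \<Rightarrow> complex"
  assumes g [measurable]: "g \<in> borel_measurable surface_measure"
  shows "sphere_fourier g \<in> borel_measurable borel"
proof -
  note measurable_fourier_kernel[of "- \<i>", measurable]
  have "(\<lambda>(x, \<omega>). exp (- \<i> * complex_of_real (x \<bullet> \<omega>)) * g \<omega>) \<in> borel_measurable (lborel \<Otimes>\<^sub>M surface_measure)"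
    by measurable
  from surface.borel_measurable_lebesgue_integral[OF this]
  show ?thesis by (simp add: sphere_fourier_def[abs_def])
qed

lemma cmod_sphere_fourier_le:
  assumes "integrable surface_measure g"
  shows "cmod (sphere_fourier g x) \<le> (\<integral>\<omega>. cmod (g \<omega>) \<partial>surface_measure)"
proof -
  have "cmod (sphere_fourier g x) \<le> (\<integral>\<omega>. norm (exp (- \<i> * complex_of_real (x \<bullet> \<omega>)) * g \<omega>) \<partial>surface_measure)"
    unfolding sphere_fourier_def by (rule integral_norm_bound)
  then show ?thesis by (simp add: norm_mult)
qed

text \<open>
  Plancherel for a measure on the sphere, with a Gaussian weight: by Fubini the left-hand side is
  a double integral over the sphere whose kernel is the Fourier transform of a Gaussian at
  \<open>\<eta> - \<omega>\<close>, and \<open>|\<eta> - \<omega>|\<^sup>2 = 2 - 2 \<eta> \<bullet> \<omega>\<close>.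
\<close>

lemma sphere_fourier_gauss_energy:
  fixes Y :: "real ^ 'n \<Rightarrow> complex"
  assumes n: "2 \<le> CARD('n)" and Y: "Y \<in> spherical_harmonics k" and u: "0 < u"
  shows "(\<integral>\<^sup>+x. ennreal ((cmod (sphere_fourier Y x))\<^sup>2 * exp (- (norm x)\<^sup>2 / (2 * u))) \<partial>lborel)
    = ennreal (sqrt u ^ CARD('n) * gauss_mass TYPE('n) * exp (- u) * sphere_area TYPE('n) * harmonic_bessel CARD('n) k u * surface_nsq Y)"
proof -
  let ?g = "\<lambda>x :: real ^ 'n. complex_of_real (exp (- (norm x)\<^sup>2 / (2 * u)))"
  let ?F = "sphere_fourier Y"
  let ?c = "sqrt u ^ CARD('n) * gauss_mass TYPE('n) * exp (- u)"
  let ?B = "sphere_area TYPE('n) * harmonic_bessel CARD('n) k u"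
  have cY: "cpoly Y" using Y by (simp add: spherical_harmonicsD)
  have iY: "integrable surface_measure Y" by (rule integrable_surface_cpoly[OF cY])
  have icY: "integrable surface_measure (\<lambda>\<omega>. cnj (Y \<omega>))" by (intro integrable_surface_cpoly cpoly_cnj cY)
  have ig: "integrable lborel ?g" by (rule integrable_gauss_scaled[OF u])
  have mF [measurable]: "?F \<in> borel_measurable borel"
    by (intro sphere_fourier_measurable cpoly_measurable_surface cY)
  define C where "C = (\<integral>\<omega>. cmod (Y \<omega>) \<partial>surface_measure)"
  have FC: "cmod (?F x) \<le> C" for x unfolding C_def by (rule cmod_sphere_fourier_le[OF iY])
  have iFg: "integrable lborel (\<lambda>x. ?F x * ?g x)"
  proof (rule Bochner_Integration.integrable_bound)
    show "integrable lborel (\<lambda>x. C * cmod (?g x))" by (intro integrable_mult_right integrable_norm ig)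
    show "AE x in lborel. norm (?F x * ?g x) \<le> norm (C * cmod (?g x))"
    proof (intro always_eventually allI)
      fix x
      have "cmod (?F x) * cmod (?g x) \<le> C * cmod (?g x)" by (intro mult_right_mono FC) simp
      then show "norm (?F x * ?g x) \<le> norm (C * cmod (?g x))"
        unfolding norm_mult by (rule order_trans) simp
    qed
  qed (use ig in measurable)
  have iKg: "integrable lborel (\<lambda>x. exp (\<i> * complex_of_real (x \<bullet> \<eta>)) * ?g x)" for \<eta>
  proof (rule Bochner_Integration.integrable_bound[OF ig])
    have "(\<lambda>x. exp (\<i> * complex_of_real (x \<bullet> \<eta>)) * ?g x) \<in> borel_measurable borel"
      using u by (intro borel_measurable_continuous_onI continuous_intros) auto
    then show "(\<lambda>x. exp (\<i> * complex_of_real (x \<bullet> \<eta>)) * ?g x) \<in> borel_measurable lborel" by simp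
  qed (simp add: norm_mult)
  have cF: "cnj (?F x) = (\<integral>\<eta>. exp (\<i> * complex_of_real (x \<bullet> \<eta>)) * cnj (Y \<eta>) \<partial>surface_measure)" for x
  proof -
    have "cnj (?F x) = (\<integral>\<eta>. cnj (exp (- \<i> * complex_of_real (x \<bullet> \<eta>)) * Y \<eta>) \<partial>surface_measure)"
      unfolding sphere_fourier_def by (rule Bochner_Integration.integral_cnj[symmetric])
    also have "(\<lambda>\<eta>. cnj (exp (- \<i> * complex_of_real (x \<bullet> \<eta>)) * Y \<eta>)) = (\<lambda>\<eta>. exp (\<i> * complex_of_real (x \<bullet> \<eta>)) * cnj (Y \<eta>))"
      by (simp add: exp_cnj)
    finally show ?thesis .
  qed
  \<comment> \<open>Fubini is used twice, once for each factor in F times its conjugate. Here \<eta>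
    is held fixed and the first factor is unfolded; the kernel exp (u \<eta> . \<omega>) then acts
    on Y by \<open>sphere_integral_exp\<close>.\<close>
  have step: "(\<integral>x. exp (\<i> * complex_of_real (x \<bullet> \<eta>)) * (?F x * ?g x) \<partial>lborel) = ?c * ?B * Y \<eta>" if \<eta>: "norm \<eta> = 1" for \<eta>
  proof -
    have "(\<integral>x. exp (\<i> * complex_of_real (x \<bullet> \<eta>)) * (?F x * ?g x) \<partial>lborel)
      = (\<integral>x. (exp (\<i> * complex_of_real (x \<bullet> \<eta>)) * ?g x) * (\<integral>\<omega>. exp (- \<i> * complex_of_real (x \<bullet> \<omega>)) * Y \<omega> \<partial>surface_measure) \<partial>lborel)"
      by (simp add: sphere_fourier_def mult_ac)
    also have "\<dots> = (\<integral>\<omega>. Y \<omega> * (\<integral>x. exp (- \<i> * complex_of_real (x \<bullet> \<omega>)) * (exp (\<i> * complex_of_real (x \<bullet> \<eta>)) * ?g x) \<partial>lborel) \<partial>surface_measure)"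
      by (rule lborel_surface.kernel_swap[OF measurable_fourier_kernel _ iKg iY, of _ 1]) simp
    also have "\<dots> = (\<integral>\<omega>. ?c * (exp (complex_of_real u * complex_of_real (\<eta> \<bullet> \<omega>)) * Y \<omega>) \<partial>surface_measure)"
    proof (intro Bochner_Integration.integral_cong refl)
      fix \<omega> :: "real ^ 'n" assume "\<omega> \<in> space surface_measure"
      then have \<omega>: "norm \<omega> = 1" by (simp add: space_surface_measure)
      have e: "exp (complex_of_real u * complex_of_real (\<eta> \<bullet> \<omega>)) = complex_of_real (exp (u * (\<eta> \<bullet> \<omega>)))"
        by (simp only: of_real_mult[symmetric] exp_of_real)
      have "exp (- \<i> * complex_of_real (x \<bullet> \<omega>)) * (exp (\<i> * complex_of_real (x \<bullet> \<eta>)) * ?g x)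
         = exp (\<i> * complex_of_real ((\<eta> - \<omega>) \<bullet> x)) * ?g x" for x
        by (simp add: inner_diff_left inner_commute algebra_simps flip: exp_add)
      then have "(\<integral>x. exp (- \<i> * complex_of_real (x \<bullet> \<omega>)) * (exp (\<i> * complex_of_real (x \<bullet> \<eta>)) * ?g x) \<partial>lborel)
        = complex_of_real (sqrt u ^ CARD('n) * gauss_mass TYPE('n) * exp (- u * (norm (\<eta> - \<omega>))\<^sup>2 / 2))"
        using gauss_scaled_fourier[OF u, of "\<eta> - \<omega>"] by (simp only:)
      also have "(norm (\<eta> - \<omega>))\<^sup>2 = 2 - 2 * (\<eta> \<bullet> \<omega>)"
        using \<eta> \<omega> by (simp add: power2_norm_eq_inner inner_diff_left inner_diff_right inner_commute norm_eq_1)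
      also have "- u * (2 - 2 * (\<eta> \<bullet> \<omega>)) / 2 = - u + u * (\<eta> \<bullet> \<omega>)" by (simp add: field_simps)
      finally show "Y \<omega> * (\<integral>x. exp (- \<i> * complex_of_real (x \<bullet> \<omega>)) * (exp (\<i> * complex_of_real (x \<bullet> \<eta>)) * ?g x) \<partial>lborel)
        = ?c * (exp (complex_of_real u * complex_of_real (\<eta> \<bullet> \<omega>)) * Y \<omega>)"
        by (simp only: exp_add of_real_mult e mult_ac)
    qed
    also have "\<dots> = ?c * (\<integral>\<omega>. exp (complex_of_real u * complex_of_real (\<eta> \<bullet> \<omega>)) * Y \<omega> \<partial>surface_measure)"
      by (rule integral_mult_right_zero)
    also have "\<dots> = ?c * ?B * Y \<eta>"
      unfolding sphere_integral_exp[OF n Y \<eta>] harmonic_bessel_of_real[OF n] by simp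
    finally show ?thesis .
  qed
  have "(\<integral>x. (?F x * ?g x) * cnj (?F x) \<partial>lborel)
    = (\<integral>x. (?F x * ?g x) * (\<integral>\<eta>. exp (\<i> * complex_of_real (x \<bullet> \<eta>)) * cnj (Y \<eta>) \<partial>surface_measure) \<partial>lborel)"
    by (simp only: cF)
  also have "\<dots> = (\<integral>\<eta>. cnj (Y \<eta>) * (\<integral>x. exp (\<i> * complex_of_real (x \<bullet> \<eta>)) * (?F x * ?g x) \<partial>lborel) \<partial>surface_measure)"
    by (rule lborel_surface.kernel_swap[OF measurable_fourier_kernel _ iFg icY, of _ 1]) simp
  also have "\<dots> = (\<integral>\<eta>. (?c * ?B) * complex_of_real ((cmod (Y \<eta>))\<^sup>2) \<partial>surface_measure)"
  proof (intro Bochner_Integration.integral_cong refl)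
    fix \<eta> :: "real ^ 'n" assume "\<eta> \<in> space surface_measure"
    then have "norm \<eta> = 1" by (simp add: space_surface_measure)
    from step[OF this]
    show "cnj (Y \<eta>) * (\<integral>x. exp (\<i> * complex_of_real (x \<bullet> \<eta>)) * (?F x * ?g x) \<partial>lborel) = (?c * ?B) * complex_of_real ((cmod (Y \<eta>))\<^sup>2)"
      by (simp only: complex_norm_square of_real_mult mult_ac)
  qed
  also have "\<dots> = complex_of_real (?c * ?B * surface_nsq Y)"
    unfolding surface_nsq_def by (simp only: integral_mult_right_zero integral_complex_of_real of_real_mult)
  finally have eq: "(\<integral>x. complex_of_real ((cmod (?F x))\<^sup>2 * exp (- (norm x)\<^sup>2 / (2 * u))) \<partial>lborel) = complex_of_real (?c * ?B * surface_nsq Y)"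
    by (simp only: complex_norm_square of_real_mult mult_ac)
  have int: "integrable lborel (\<lambda>x. (cmod (?F x))\<^sup>2 * exp (- (norm x)\<^sup>2 / (2 * u)))"
  proof (rule Bochner_Integration.integrable_bound)
    show "integrable lborel (\<lambda>x. C\<^sup>2 * cmod (?g x))" by (intro integrable_mult_right integrable_norm ig)
    have "(\<lambda>x :: real ^ 'n. exp (- (norm x)\<^sup>2 / (2 * u))) \<in> borel_measurable borel"
      using u by (intro borel_measurable_continuous_onI continuous_intros) auto
    then show "(\<lambda>x. (cmod (?F x))\<^sup>2 * exp (- (norm x)\<^sup>2 / (2 * u))) \<in> borel_measurable lborel" by measurable
    show "AE x in lborel. norm ((cmod (?F x))\<^sup>2 * exp (- (norm x)\<^sup>2 / (2 * u))) \<le> norm (C\<^sup>2 * cmod (?g x))"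
      using FC by (intro always_eventually allI) (simp add: abs_mult mult_right_mono power_mono)
  qed
  have "(\<integral>x. (cmod (?F x))\<^sup>2 * exp (- (norm x)\<^sup>2 / (2 * u)) \<partial>lborel) = ?c * ?B * surface_nsq Y"
    using eq by (simp only: integral_complex_of_real of_real_eq_iff)
  moreover have "(\<integral>\<^sup>+x. ennreal ((cmod (?F x))\<^sup>2 * exp (- (norm x)\<^sup>2 / (2 * u))) \<partial>lborel)
     = ennreal (\<integral>x. (cmod (?F x))\<^sup>2 * exp (- (norm x)\<^sup>2 / (2 * u)) \<partial>lborel)"
    by (intro nn_integral_eq_integral int) auto
  ultimately show ?thesis by (simp add: mult.assoc)
qed

section \<open>Subordination and the radial integrals\<close>

definition radial_profile :: "'n::finite itself \<Rightarrow> nat \<Rightarrow> real \<Rightarrow> complex" where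
  "radial_profile _ k r = sphere_area TYPE('n) * harmonic_bessel CARD('n) k (- \<i> * complex_of_real r)"

lemma radial_profile_measurable [measurable]: "radial_profile TYPE('n::finite) k \<in> borel_measurable borel"
  unfolding radial_profile_def[abs_def] harmonic_bessel_def by measurable

lemma sphere_fourier_radial_profile:
  fixes Y :: "real ^ 'n \<Rightarrow> complex"
  assumes "2 \<le> CARD('n)" "Y \<in> spherical_harmonics k" "norm \<omega> = 1"
  shows "sphere_fourier Y (r *\<^sub>R \<omega>) = radial_profile TYPE('n) k r * Y \<omega>"
  unfolding radial_profile_def by (rule sphere_fourier_harmonic[OF assms])

lemma nn_integral_surface_nsq:
  assumes "f \<in> L2 surface_measure"
  shows "(\<integral>\<^sup>+\<omega>. ennreal ((cmod (f \<omega>))\<^sup>2) \<partial>surface_measure) = ennreal (surface_nsq f)"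
  unfolding surface_nsq_def using L2D(2)[OF assms] by (intro nn_integral_eq_integral) auto

text \<open>In polar coordinates the energy factors into the integral of the profile and the squared
  norm of Y. The profile depends on the degree alone, so any Y of nonzero norm may be
  cancelled.\<close>

lemma radial_profile_gauss_energy:
  fixes Y :: "real ^ 'n \<Rightarrow> complex"
  assumes n: "2 \<le> CARD('n)" and Y: "Y \<in> spherical_harmonics k" and nz: "surface_nsq Y \<noteq> 0" and u: "0 < u"
  shows "(\<integral>\<^sup>+r. ennreal ((cmod (radial_profile TYPE('n) k r))\<^sup>2 * exp (- r\<^sup>2 / (2 * u))) \<partial>radial_measure CARD('n))
    = ennreal (sqrt u ^ CARD('n) * gauss_mass TYPE('n) * exp (- u) * sphere_area TYPE('n) * harmonic_bessel CARD('n) k u)"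
    (is "?L = ennreal ?R")
proof -
  let ?F = "sphere_fourier Y" and ?P = "radial_profile TYPE('n) k"
  have [measurable]: "?F \<in> borel_measurable borel"
    by (intro sphere_fourier_measurable cpoly_measurable_surface spherical_harmonicsD(1)[OF Y])
  have [measurable]: "(\<lambda>x :: real ^ 'n. exp (- (norm x)\<^sup>2 / (2 * u))) \<in> borel_measurable borel"
    using u by (intro borel_measurable_continuous_onI continuous_intros) auto
  have [measurable]: "(\<lambda>r :: real. exp (- r\<^sup>2 / (2 * u))) \<in> borel_measurable borel"
    using u by (intro borel_measurable_continuous_onI continuous_intros) auto
  have R: "0 \<le> ?R"
    using u gauss_mass_pos[where 'n = 'n] sphere_area_pos[where 'n = 'n] harmonic_bessel_nonneg[OF n, of u k]
    by (intro mult_nonneg_nonneg) auto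
  have "ennreal (?R * surface_nsq Y) = (\<integral>\<^sup>+x. ennreal ((cmod (?F x))\<^sup>2 * exp (- (norm x)\<^sup>2 / (2 * u))) \<partial>lborel)"
    by (rule sphere_fourier_gauss_energy[OF n Y u, symmetric])
  also have "\<dots> = (\<integral>\<^sup>+r. \<integral>\<^sup>+\<omega>. ennreal ((cmod (?F (r *\<^sub>R \<omega>)))\<^sup>2 * exp (- (norm (r *\<^sub>R \<omega>))\<^sup>2 / (2 * u))) \<partial>surface_measure \<partial>radial_measure CARD('n))"
    by (rule nn_integral_polar) measurable
  also have "\<dots> = (\<integral>\<^sup>+r. ennreal ((cmod (?P r))\<^sup>2 * exp (- r\<^sup>2 / (2 * u))) * ennreal (surface_nsq Y) \<partial>radial_measure CARD('n))"
  proof (intro nn_integral_cong)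
    fix r
    have "(\<integral>\<^sup>+\<omega>. ennreal ((cmod (?F (r *\<^sub>R \<omega>)))\<^sup>2 * exp (- (norm (r *\<^sub>R \<omega>))\<^sup>2 / (2 * u))) \<partial>surface_measure)
        = (\<integral>\<^sup>+\<omega>. ennreal ((cmod (?P r))\<^sup>2 * exp (- r\<^sup>2 / (2 * u))) * ennreal ((cmod (Y \<omega>))\<^sup>2) \<partial>surface_measure)"
      by (intro nn_integral_cong)
        (simp add: space_surface_measure sphere_fourier_radial_profile[OF n Y] norm_mult power_mult_distrib mult_ac flip: ennreal_mult)
    also have "\<dots> = ennreal ((cmod (?P r))\<^sup>2 * exp (- r\<^sup>2 / (2 * u))) * ennreal (surface_nsq Y)"
      using L2D(1)[OF L2_surface_harmonic[OF Y]]
      by (simp add: nn_integral_cmult nn_integral_surface_nsq[OF L2_surface_harmonic[OF Y]])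
    finally show "(\<integral>\<^sup>+\<omega>. ennreal ((cmod (?F (r *\<^sub>R \<omega>)))\<^sup>2 * exp (- (norm (r *\<^sub>R \<omega>))\<^sup>2 / (2 * u))) \<partial>surface_measure) = \<dots>" .
  qed
  also have "\<dots> = ?L * ennreal (surface_nsq Y)"
    by (rule nn_integral_multc) (simp add: measurable_cong_sets[OF sets_radial_measure refl])
  finally have "ennreal (surface_nsq Y) * ennreal ?R = ennreal (surface_nsq Y) * ?L"
    using R surface_nsq_nonneg[of Y] by (simp add: ennreal_mult mult.commute)
  then show ?thesis
    using nz surface_nsq_nonneg[of Y] by (auto simp: ennreal_mult_cancel_left)
qed

text \<open>Among power weights, the exponent -b/2 - 1 is the one for which scaling by r^2 in the
  superposition of the Gaussians exp (- r^2 / (2 u)) produces r^(-b).\<close>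

definition power_weight :: "real \<Rightarrow> real \<Rightarrow> real" where
  "power_weight b u = indicator {0<..} u * u powr (- (b / 2) - 1)"

lemma power_weight_nonneg: "0 \<le> power_weight b u"
  by (simp add: power_weight_def)

lemma power_weight_measurable [measurable]: "power_weight b \<in> borel_measurable borel"
  unfolding power_weight_def[abs_def] by measurable

text \<open>Has the value 2^(b/2) Gamma(b/2) for b > 0. Being an extended integral, it is available
  in the scaling identity before finiteness is known.\<close>

definition subordination_const :: "real \<Rightarrow> ennreal" where
  "subordination_const b = (\<integral>\<^sup>+u. ennreal (power_weight b u * exp (- 1 / (2 * u))) \<partial>lborel)"

text \<open>Substitution of r^2 u for u: the Gaussian loses its dependence on r, and the Jacobian
  with the weight leaves r^2 (r^2)^(-b/2 - 1) = r^(-b).\<close>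

lemma subordination_integral:
  assumes r: "0 < r"
  shows "(\<integral>\<^sup>+u. ennreal (power_weight b u * exp (- r\<^sup>2 / (2 * u))) \<partial>lborel) = ennreal (r powr (- b)) * subordination_const b"
proof -
  have "(\<integral>\<^sup>+u. ennreal (power_weight b u * exp (- r\<^sup>2 / (2 * u))) \<partial>lborel)
     = ennreal \<bar>r\<^sup>2\<bar> * (\<integral>\<^sup>+u. ennreal (power_weight b (0 + r\<^sup>2 * u) * exp (- r\<^sup>2 / (2 * (0 + r\<^sup>2 * u)))) \<partial>lborel)"
    using r by (intro nn_integral_real_affine) auto
  also have "\<dots> = (\<integral>\<^sup>+u. ennreal (r\<^sup>2 * (power_weight b (r\<^sup>2 * u) * exp (- r\<^sup>2 / (2 * (r\<^sup>2 * u))))) \<partial>lborel)"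
    by (subst nn_integral_cmult[symmetric]) (auto simp: ennreal_mult power_weight_nonneg)
  also have "\<dots> = (\<integral>\<^sup>+u. ennreal (r powr (- b)) * ennreal (power_weight b u * exp (- 1 / (2 * u))) \<partial>lborel)"
  proof (intro nn_integral_cong)
    fix u :: real
    show "ennreal (r\<^sup>2 * (power_weight b (r\<^sup>2 * u) * exp (- r\<^sup>2 / (2 * (r\<^sup>2 * u)))))
       = ennreal (r powr (- b)) * ennreal (power_weight b u * exp (- 1 / (2 * u)))"
    proof (cases "0 < u")
      case True
      have "r\<^sup>2 * (r\<^sup>2) powr (- (b / 2) - 1) = r powr (- b)"
      proof -
        have "r\<^sup>2 * (r\<^sup>2) powr (- (b / 2) - 1) = r powr 2 * r powr (2 * (- (b / 2) - 1))"
          using r by (simp add: powr_powr flip: powr_numeral)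
        also have "\<dots> = r powr (2 + 2 * (- (b / 2) - 1))" by (rule powr_add[symmetric])
        finally show ?thesis by (simp add: algebra_simps)
      qed
      then have "r\<^sup>2 * power_weight b (r\<^sup>2 * u) = r powr (- b) * power_weight b u"
        using True r by (simp add: power_weight_def powr_mult mult.assoc[symmetric])
      moreover have "r\<^sup>2 / (2 * (r\<^sup>2 * u)) = 1 / (2 * u)" using r by simp
      ultimately have "r\<^sup>2 * (power_weight b (r\<^sup>2 * u) * exp (- r\<^sup>2 / (2 * (r\<^sup>2 * u)))) = r powr (- b) * (power_weight b u * exp (- 1 / (2 * u)))"
        by (simp add: mult.assoc[symmetric])
      then show ?thesis by (simp add: ennreal_mult power_weight_nonneg)
    next
      case False
      then show ?thesis using r by (simp add: power_weight_def zero_less_mult_iff)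
    qed
  qed
  also have "\<dots> = ennreal (r powr (- b)) * subordination_const b"
    unfolding subordination_const_def by (rule nn_integral_cmult) measurable
  finally show ?thesis .
qed

lemma subordination_const_pos: "subordination_const b \<noteq> 0"
proof
  assume "subordination_const b = 0"
  then have "AE u in lborel. ennreal (power_weight b u * exp (- 1 / (2 * u))) = 0"
    unfolding subordination_const_def by (subst (asm) nn_integral_0_iff_AE) auto
  then have "AE u in lborel. u \<notin> {1..2 :: real}"
  proof eventually_elim
    case (elim u)
    show ?case
    proof
      assume "u \<in> {1..2}"
      then have "0 < power_weight b u * exp (- 1 / (2 * u))" by (simp add: power_weight_def)
      moreover have "power_weight b u * exp (- 1 / (2 * u)) \<le> 0"
        using elim by (rule iffD1[OF ennreal_eq_0_iff])
      ultimately show False by linarith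
    qed
  qed
  then have "emeasure lborel {u :: real. 1 \<le> u \<and> u \<le> 2} = 0"
    by (simp add: AE_iff_measurable[OF _ refl])
  moreover have "{u :: real. 1 \<le> u \<and> u \<le> 2} = {1..2}" by auto
  ultimately show False by simp
qed

lemma power_divide_fact_le_exp:
  fixes x :: real
  assumes "0 \<le> x" shows "x ^ N / fact N \<le> exp x"
proof -
  have "(\<Sum>i\<in>{N}. x ^ i /\<^sub>R fact i) \<le> exp x"
    unfolding exp_def using assms by (intro sum_le_suminf sums_summable[OF exp_converges]) auto
  then have "x ^ N /\<^sub>R fact N \<le> exp x" by (simp only: sum.insert sum.empty finite.emptyI empty_iff not_False_eq_True add_0_right)
  moreover have "x ^ N / fact N = x ^ N /\<^sub>R fact N" by (simp only: real_scaleR_def divide_real_def mult.commute)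
  ultimately show ?thesis by linarith
qed

text \<open>On (0, 1] the factor exp (-1 / (2 u)) beats the negative power of u; beyond 1 that
  factor is at most 1 and the power is integrable because b > 0.\<close>

lemma subordination_const_finite:
  assumes b: "0 < b" shows "subordination_const b < \<infinity>"
proof -
  \<comment> \<open>Rounding the exponent up is allowed since v = 1 / u \<ge> 1 on (0, 1]; then v^N
    exp (- v / 2) \<le> N! 2^N follows from a single term of the exponential series.\<close>
  define N where "N = nat \<lceil>b / 2 + 1\<rceil>"
  have N: "b / 2 + 1 \<le> real N" unfolding N_def by linarith
  define C :: real where "C = fact N * 2 ^ N"
  have le: "ennreal (power_weight b u * exp (- 1 / (2 * u))) \<le> ennreal C * indicator {0..1} u + ennreal (u powr (- (b / 2) - 1)) * indicator {1..} u" for u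
  proof (cases "0 < u \<and> u \<le> 1")
    case True
    define v where "v = 1 / u"
    have v: "1 \<le> v" using True by (simp add: v_def)
    have "u powr (- (b / 2) - 1) = v powr (b / 2 + 1)"
    proof -
      have "- (b / 2) - 1 = - (b / 2 + 1)" by simp
      then show ?thesis
        by (simp only: v_def powr_minus_divide powr_divide powr_one_eq_one)
    qed
    also have "\<dots> \<le> v powr real N" using v N by (intro powr_mono) auto
    also have "\<dots> = v ^ N" using v by (simp add: powr_realpow)
    also have "\<dots> = C * ((v / 2) ^ N / fact N)" by (simp add: C_def power_divide)
    also have "(v / 2) ^ N / fact N \<le> exp (v / 2)"
      using v by (intro power_divide_fact_le_exp) simp
    finally have "u powr (- (b / 2) - 1) \<le> C * exp (v / 2)" by (simp add: C_def)
    then have "u powr (- (b / 2) - 1) * exp (- (v / 2)) \<le> C"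
      by (simp add: exp_minus field_simps)
    then have "power_weight b u * exp (- 1 / (2 * u)) \<le> C"
      using True by (simp add: power_weight_def v_def mult.commute)
    then have "ennreal (power_weight b u * exp (- 1 / (2 * u))) \<le> ennreal C * indicator {0..1} u"
      using True by (simp add: ennreal_leI)
    then show ?thesis by (rule order_trans) simp
  next
    case False
    show ?thesis
    proof (cases "0 < u")
      case True
      then have "1 < u" using False by simp
      moreover have "u powr (- (b / 2) - 1) * exp (- 1 / (2 * u)) \<le> u powr (- (b / 2) - 1) * 1"
        using True by (intro mult_left_mono) auto
      ultimately show ?thesis by (simp add: power_weight_def ennreal_leI)
    qed (simp add: power_weight_def)
  qed
  have "subordination_const b \<le> (\<integral>\<^sup>+u. ennreal C * indicator {0..1} u + ennreal (u powr (- (b / 2) - 1)) * indicator {1..} u \<partial>lborel)"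
    unfolding subordination_const_def by (intro nn_integral_mono le)
  also have "\<dots> = ennreal C * emeasure lborel {0..1 :: real} + (\<integral>\<^sup>+u. ennreal (u powr (- (b / 2) - 1)) * indicator {1..} u \<partial>lborel)"
    by (subst nn_integral_add) (auto simp: nn_integral_cmult_indicator)
  also have "(\<integral>\<^sup>+u. ennreal (u powr (- (b / 2) - 1)) * indicator {1..} u \<partial>lborel) = ennreal (0 - (- (2 / b) * 1 powr (- (b / 2))))"
  proof (rule nn_integral_FTC_atLeast)
    show "((\<lambda>u. - (2 / b) * u powr (- (b / 2))) \<longlongrightarrow> 0) at_top"
    proof -
      have "((\<lambda>u :: real. u powr (- (b / 2))) \<longlongrightarrow> 0) at_top"
        using b by (intro tendsto_neg_powr filterlim_ident) auto
      from tendsto_mult[OF tendsto_const this, of "- (2 / b)"] show ?thesis by simp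
    qed
    show "((\<lambda>u. - (2 / b) * u powr (- (b / 2))) has_real_derivative x powr (- (b / 2) - 1)) (at x)" if "1 \<le> x" for x
      using that b by (auto intro!: derivative_eq_intros simp: field_simps)
  qed auto
  finally show ?thesis by (auto simp: ennreal_mult_less_top elim!: le_less_trans)
qed

section \<open>The weighted radial integral\<close>

text \<open>All terms of the series are nonnegative, so it may be integrated termwise, and each term
  is an Euler integral for Gamma.\<close>

lemma weber_sum_nn_integral:
  assumes d: "2 \<le> d" and p: "0 < p" and less: "p < (real d - 1) / 2"
  shows "(\<integral>\<^sup>+u. ennreal (indicator {0<..} u * u powr (p - 1) * exp (- u) * harmonic_bessel d k u) \<partial>lborel) = ennreal (weber_sum d p k)"
proof -
  have c: "0 < harmonic_coeff d k j" for j using d by (intro harmonic_coeff_pos) simp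
  have d0: "0 < d" using d by simp
  let ?f = "\<lambda>j u. ennreal (harmonic_coeff d k j) * ennreal (indicator {0..} u * u powr ((real k + 2 * real j + p) - 1) / exp u)"
  have "(\<integral>\<^sup>+u. ennreal (indicator {0<..} u * u powr (p - 1) * exp (- u) * harmonic_bessel d k u) \<partial>lborel) = (\<integral>\<^sup>+u. (\<Sum>j. ?f j u) \<partial>lborel)"
  proof (intro nn_integral_cong_AE, use AE_lborel_singleton[of "0 :: real"] in eventually_elim)
    case (elim u)
    show ?case
    proof (cases "0 < u")
      case True
      let ?w = "u powr (p - 1) * exp (- u)"
      have "(\<lambda>j. ?w * (harmonic_coeff d k j * u ^ (k + 2 * j))) sums (?w * harmonic_bessel d k u)"
        using harmonic_bessel_sums[OF d, of k u] by (intro sums_mult) simp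
      then have "(\<Sum>j. ennreal (?w * (harmonic_coeff d k j * u ^ (k + 2 * j)))) = ennreal (?w * harmonic_bessel d k u)"
        using True c by (intro suminf_ennreal_eq) (auto simp: less_imp_le)
      moreover have "ennreal (?w * (harmonic_coeff d k j * u ^ (k + 2 * j))) = ?f j u" for j
      proof -
        have "u powr ((real k + 2 * real j + p) - 1) = u powr (p - 1) * u powr real (k + 2 * j)"
          by (simp add: algebra_simps flip: powr_add)
        also have "u powr real (k + 2 * j) = u ^ (k + 2 * j)" by (rule powr_realpow[OF True])
        finally show ?thesis
          using True c[of j] by (simp add: exp_minus divide_inverse mult_ac flip: ennreal_mult)
      qed
      ultimately show ?thesis using True by (simp add: mult.assoc)
    next
      case False
      then show ?thesis using elim by simp
    qed
  qed
  also have "\<dots> = (\<Sum>j. \<integral>\<^sup>+u. ?f j u \<partial>lborel)"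
    by (rule nn_integral_suminf) measurable
  also have "\<dots> = (\<Sum>j. ennreal (weber_term d p k j))"
  proof (intro suminf_cong)
    fix j
    have "0 < real k + 2 * real j + p" using p by (auto intro!: add_nonneg_pos)
    then have G: "ennreal (Gamma (real k + 2 * real j + p)) = (\<integral>\<^sup>+u. ennreal (indicator {0..} u * u powr ((real k + 2 * real j + p) - 1) / exp u) \<partial>lborel)"
      by (rule Gamma_conv_nn_integral_real)
    have "(\<integral>\<^sup>+u. ?f j u \<partial>lborel) = ennreal (harmonic_coeff d k j) * ennreal (Gamma (real k + 2 * real j + p))"
      unfolding G by (rule nn_integral_cmult) measurable
    then show "(\<integral>\<^sup>+u. ?f j u \<partial>lborel) = ennreal (weber_term d p k j)"
      using c[of j] by (simp add: weber_term_def ennreal_mult')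
  qed
  also have "\<dots> = ennreal (weber_sum d p k)"
    unfolding weber_sum_def using weber_term_pos[OF d0 p] weber_term_summable[OF d0 p less]
    by (intro suminf_ennreal2) (auto intro: less_imp_le)
  finally show ?thesis .
qed

text \<open>r^(-b) is written as the superposition of Gaussians, and Tonelli puts the integral over
  r inside, where the Gaussian energy is known. The constant stays on the left as an extended factor
  until its finiteness is brought in.\<close>

lemma radial_profile_integral:
  fixes Y :: "real ^ 'n \<Rightarrow> complex"
  assumes n: "2 \<le> CARD('n)" and Y: "Y \<in> spherical_harmonics k" and nz: "surface_nsq Y \<noteq> 0"
    and b: "1 < b" "b < real CARD('n)"
  shows "subordination_const b * (\<integral>\<^sup>+r. ennreal (r powr (- b) * (cmod (radial_profile TYPE('n) k r))\<^sup>2) \<partial>radial_measure CARD('n))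
    = ennreal (gauss_mass TYPE('n) * sphere_area TYPE('n) * weber_sum CARD('n) ((real CARD('n) - b) / 2) k)"
proof -
  let ?P = "radial_profile TYPE('n) k" and ?R = "radial_measure CARD('n)" and ?d = "CARD('n)"
  let ?c = "gauss_mass TYPE('n) * sphere_area TYPE('n)"
  interpret R: sigma_finite_measure ?R by (rule sigma_finite_radial_measure)
  interpret RL: pair_sigma_finite ?R "lborel :: real measure" ..
  have c: "0 \<le> ?c" using gauss_mass_pos[where 'n = 'n] sphere_area_pos[where 'n = 'n] by simp
  have [measurable]: "?P \<in> borel_measurable ?R" by (simp add: measurable_cong_sets[OF sets_radial_measure refl])
  have [measurable]: "(\<lambda>r. r) \<in> borel_measurable ?R" by (simp add: measurable_cong_sets[OF sets_radial_measure refl])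
  have "subordination_const b * (\<integral>\<^sup>+r. ennreal (r powr (- b) * (cmod (?P r))\<^sup>2) \<partial>?R)
     = (\<integral>\<^sup>+r. subordination_const b * ennreal (r powr (- b) * (cmod (?P r))\<^sup>2) \<partial>?R)"
    by (rule nn_integral_cmult[symmetric]) measurable
  also have "\<dots> = (\<integral>\<^sup>+r. \<integral>\<^sup>+u. ennreal (power_weight b u) * ennreal ((cmod (?P r))\<^sup>2 * exp (- r\<^sup>2 / (2 * u))) \<partial>lborel \<partial>?R)"
  proof (intro nn_integral_cong_AE, use AE_radial_measure in eventually_elim)
    case (elim r)
    have "subordination_const b * ennreal (r powr (- b) * (cmod (?P r))\<^sup>2) = ennreal ((cmod (?P r))\<^sup>2) * (ennreal (r powr (- b)) * subordination_const b)"
      by (simp add: ennreal_mult mult_ac)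
    also have "\<dots> = (\<integral>\<^sup>+u. ennreal ((cmod (?P r))\<^sup>2) * ennreal (power_weight b u * exp (- r\<^sup>2 / (2 * u))) \<partial>lborel)"
      unfolding subordination_integral[OF elim, symmetric] by (rule nn_integral_cmult[symmetric]) measurable
    also have "\<dots> = (\<integral>\<^sup>+u. ennreal (power_weight b u) * ennreal ((cmod (?P r))\<^sup>2 * exp (- r\<^sup>2 / (2 * u))) \<partial>lborel)"
      by (intro nn_integral_cong) (simp add: power_weight_nonneg mult_ac flip: ennreal_mult)
    finally show ?case .
  qed
  also have "\<dots> = (\<integral>\<^sup>+u. \<integral>\<^sup>+r. ennreal (power_weight b u) * ennreal ((cmod (?P r))\<^sup>2 * exp (- r\<^sup>2 / (2 * u))) \<partial>?R \<partial>lborel)"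
    by (rule RL.Fubini'[symmetric]) measurable
  also have "\<dots> = (\<integral>\<^sup>+u. ennreal ?c * ennreal (indicator {0<..} u * u powr ((real ?d - b) / 2 - 1) * exp (- u) * harmonic_bessel ?d k u) \<partial>lborel)"
  proof (intro nn_integral_cong)
    fix u :: real
    have "(\<integral>\<^sup>+r. ennreal (power_weight b u) * ennreal ((cmod (?P r))\<^sup>2 * exp (- r\<^sup>2 / (2 * u))) \<partial>?R)
       = ennreal (power_weight b u) * (\<integral>\<^sup>+r. ennreal ((cmod (?P r))\<^sup>2 * exp (- r\<^sup>2 / (2 * u))) \<partial>?R)"
      by (rule nn_integral_cmult) measurable
    also have "\<dots> = ennreal ?c * ennreal (indicator {0<..} u * u powr ((real ?d - b) / 2 - 1) * exp (- u) * harmonic_bessel ?d k u)"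
    proof (cases "0 < u")
      case True
      have "sqrt u ^ ?d = u powr (real ?d / 2)"
        using True by (simp add: powr_half_sqrt[symmetric] powr_powr flip: powr_realpow)
      \<comment> \<open>The weight contributes -b/2 - 1 and the Gaussian energy n/2, which add up to
        p - 1 for p = (n - b) / 2.\<close>
      moreover have "u powr ((real ?d - b) / 2 - 1) = u powr (- (b / 2) - 1) * u powr (real ?d / 2)"
        by (simp add: diff_divide_distrib algebra_simps flip: powr_add)
      ultimately show ?thesis
        unfolding radial_profile_gauss_energy[OF n Y nz True]
        using True c harmonic_bessel_nonneg[OF n, of u k] gauss_mass_pos[where 'n = 'n] sphere_area_pos[where 'n = 'n]
        by (simp add: power_weight_def mult_ac flip: ennreal_mult)
    qed (simp add: power_weight_def)
    finally show "(\<integral>\<^sup>+r. ennreal (power_weight b u) * ennreal ((cmod (?P r))\<^sup>2 * exp (- r\<^sup>2 / (2 * u))) \<partial>?R) = \<dots>" .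
  qed
  also have "\<dots> = ennreal ?c * (\<integral>\<^sup>+u. ennreal (indicator {0<..} u * u powr ((real ?d - b) / 2 - 1) * exp (- u) * harmonic_bessel ?d k u) \<partial>lborel)"
    unfolding harmonic_bessel_def by (rule nn_integral_cmult) measurable
  also have "\<dots> = ennreal ?c * ennreal (weber_sum ?d ((real ?d - b) / 2) k)"
    using b by (subst weber_sum_nn_integral[OF n]) auto
  also have "\<dots> = ennreal (?c * weber_sum ?d ((real ?d - b) / 2) k)"
    using c by (simp add: ennreal_mult')
  finally show ?thesis .
qed

section \<open>The angular multiplier\<close>

lemma integrable_fourier_kernel_mult:
  fixes g :: "real ^ 'n \<Rightarrow> complex"
  assumes "integrable surface_measure g"
  shows "integrable surface_measure (\<lambda>\<omega>. exp (- \<i> * complex_of_real (x \<bullet> \<omega>)) * g \<omega>)"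
proof (rule Bochner_Integration.integrable_bound[OF assms])
  have "(\<lambda>\<omega>. exp (- \<i> * complex_of_real (x \<bullet> \<omega>))) \<in> borel_measurable surface_measure"
    by (intro borel_measurable_surface_measure borel_measurable_continuous_onI continuous_intros)
  then show "(\<lambda>\<omega>. exp (- \<i> * complex_of_real (x \<bullet> \<omega>)) * g \<omega>) \<in> borel_measurable surface_measure"
    using borel_measurable_integrable[OF assms] by (rule borel_measurable_times)
qed (simp add: norm_mult)

lemma sphere_fourier_diff:
  assumes "integrable surface_measure f" "integrable surface_measure g"
  shows "sphere_fourier (\<lambda>\<omega>. f \<omega> - g \<omega>) x = sphere_fourier f x - sphere_fourier g x"
  unfolding sphere_fourier_def right_diff_distrib
  by (intro Bochner_Integration.integral_diff integrable_fourier_kernel_mult assms)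

lemma sphere_fourier_sum:
  assumes "\<And>i. i \<in> I \<Longrightarrow> integrable surface_measure (f i)"
  shows "sphere_fourier (\<lambda>\<omega>. \<Sum>i\<in>I. f i \<omega>) x = (\<Sum>i\<in>I. sphere_fourier (f i) x)"
  unfolding sphere_fourier_def sum_distrib_left
  by (intro Bochner_Integration.integral_sum integrable_fourier_kernel_mult assms)

text \<open>Y is reproduced by the kernel (\<omega> . \<eta>)^k up to its eigenvalue, so its
  supremum is controlled by its first moment. The eigenvalue is kept on the left: its factors
  reappear in the bound for the profile and cancel there, leaving r^k / k!.\<close>

lemma cmod_harmonic_le:
  fixes Y :: "real ^ 'n \<Rightarrow> complex"
  assumes Y: "Y \<in> spherical_harmonics k" and \<omega>: "norm \<omega> = 1"
  shows "fact k * (sphere_area TYPE('n) * harmonic_coeff CARD('n) k 0) * cmod (Y \<omega>) \<le> sphere_area TYPE('n) + surface_nsq Y"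
proof -
  let ?c = "fact k * (sphere_area TYPE('n) * harmonic_coeff CARD('n) k 0)"
  have c: "0 \<le> ?c"
    using sphere_area_pos[where 'n = 'n] harmonic_coeff_pos[of "CARD('n)" k 0] by simp
  have YL: "Y \<in> L2 surface_measure" by (rule L2_surface_harmonic[OF Y])
  have "complex_of_real ?c * Y \<omega> = (\<integral>\<eta>. complex_of_real (\<omega> \<bullet> \<eta>) ^ k * Y \<eta> \<partial>surface_measure)"
    using sphere_integral_inner_power[OF Y, of \<omega> 0] by simp
  then have "?c * cmod (Y \<omega>) = cmod (\<integral>\<eta>. complex_of_real (\<omega> \<bullet> \<eta>) ^ k * Y \<eta> \<partial>surface_measure)"
    using c by (metis abs_of_nonneg norm_mult norm_of_real)
  also have "\<dots> \<le> (\<integral>\<eta>. norm (complex_of_real (\<omega> \<bullet> \<eta>) ^ k * Y \<eta>) \<partial>surface_measure)"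
    by (rule integral_norm_bound)
  also have "\<dots> \<le> (\<integral>\<eta>. cmod (Y \<eta>) \<partial>surface_measure)"
  proof (rule integral_mono)
    show "integrable surface_measure (\<lambda>\<eta>. norm (complex_of_real (\<omega> \<bullet> \<eta>) ^ k * Y \<eta>))"
      by (intro integrable_norm integrable_surface_cpoly cpoly.mult cpoly_power cpoly_inner spherical_harmonicsD(1)[OF Y])
    show "integrable surface_measure (\<lambda>\<eta>. cmod (Y \<eta>))"
      by (intro integrable_norm L2_surface_integrable YL)
    fix \<eta> :: "real ^ 'n" assume "\<eta> \<in> space surface_measure"
    then have "cmod (complex_of_real (\<omega> \<bullet> \<eta>) ^ k) \<le> 1"
      by (intro inner_power_kernel(2) \<omega>) (simp add: space_surface_measure)
    then show "norm (complex_of_real (\<omega> \<bullet> \<eta>) ^ k * Y \<eta>) \<le> cmod (Y \<eta>)"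
      unfolding norm_mult by (rule mult_left_le_one_le[OF norm_ge_zero norm_ge_zero])
  qed
  also have "\<dots> \<le> sphere_area TYPE('n) + surface_nsq Y"
    using integral_cmod_surface_le(2)[OF YL, of 1] by simp
  finally show ?thesis .
qed

lemma radial_profile_harmonic_le:
  fixes Y :: "real ^ 'n \<Rightarrow> complex"
  assumes n: "2 \<le> CARD('n)" and Y: "Y \<in> spherical_harmonics k" and \<omega>: "norm \<omega> = 1" and r: "0 \<le> r"
  shows "cmod (radial_profile TYPE('n) k r * Y \<omega>) \<le> exp (r\<^sup>2 / 4) * (r ^ k / fact k) * (sphere_area TYPE('n) + surface_nsq Y)"
proof -
  have A: "0 < sphere_area TYPE('n)" by (rule sphere_area_pos)
  have "cmod (radial_profile TYPE('n) k r) \<le> sphere_area TYPE('n) * (harmonic_coeff CARD('n) k 0 * r ^ k * exp (r\<^sup>2 / 4))"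
    unfolding radial_profile_def norm_mult
    using norm_harmonic_bessel_le[OF n, of k "- \<i> * complex_of_real r"] A r by (simp add: norm_mult)
  then have "cmod (radial_profile TYPE('n) k r * Y \<omega>) \<le> sphere_area TYPE('n) * (harmonic_coeff CARD('n) k 0 * r ^ k * exp (r\<^sup>2 / 4)) * cmod (Y \<omega>)"
    unfolding norm_mult by (intro mult_right_mono) auto
  also have "\<dots> = exp (r\<^sup>2 / 4) * (r ^ k / fact k) * (fact k * (sphere_area TYPE('n) * harmonic_coeff CARD('n) k 0) * cmod (Y \<omega>))"
    by simp
  also have "\<dots> \<le> exp (r\<^sup>2 / 4) * (r ^ k / fact k) * (sphere_area TYPE('n) + surface_nsq Y)"
    using r by (intro mult_left_mono cmod_harmonic_le[OF Y \<omega>]) auto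
  finally show ?thesis .
qed

lemma surface_nsq_uniform_limit:
  fixes f :: "real ^ 'n \<Rightarrow> complex"
  assumes [measurable]: "f \<in> borel_measurable surface_measure" "\<And>N. s N \<in> borel_measurable surface_measure"
    and le: "\<And>N \<omega>. norm \<omega> = 1 \<Longrightarrow> cmod (f \<omega> - s N \<omega>) \<le> e N" and e: "e \<longlonglongrightarrow> 0"
  shows "(\<lambda>N. surface_nsq (\<lambda>\<omega>. f \<omega> - s N \<omega>)) \<longlonglongrightarrow> 0"
proof (rule tendsto_sandwich[OF _ _ tendsto_const])
  show "\<forall>\<^sub>F N in sequentially. surface_nsq (\<lambda>\<omega>. f \<omega> - s N \<omega>) \<le> (e N)\<^sup>2 * sphere_area TYPE('n)"
    using le by (intro always_eventually allI L2_surface_bounded(2)) auto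
  have "(\<lambda>N. (e N)\<^sup>2 * sphere_area TYPE('n)) \<longlonglongrightarrow> 0\<^sup>2 * sphere_area TYPE('n)"
    by (intro tendsto_intros e)
  then show "(\<lambda>N. (e N)\<^sup>2 * sphere_area TYPE('n)) \<longlonglongrightarrow> 0" by simp
qed (auto simp: surface_nsq_nonneg)

definition eigenvalue :: "nat \<Rightarrow> nat \<Rightarrow> real" where
  "eigenvalue d k = real (k * (k + d - 2))"

text \<open>A crude geometric bound in k, chosen so that multiplication by r^k / k! still gives a
  term of an exponential series.\<close>

lemma Lambda_factor_le:
  assumes d: "2 \<le> d" and s: "0 \<le> s"
  shows "sqrt (1 + eigenvalue d k) powr s \<le> real d powr s * (2 powr s) ^ k"
proof -
  have "1 + eigenvalue d k \<le> (real d * 2 ^ k)\<^sup>2"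
  proof -
    have k: "real k + 1 \<le> 2 ^ k"
      using of_nat_mono[OF Suc_leI[OF less_exp[of k]], where 'a = real] by simp
    have "real k * (real k + real d - 2) + 1 \<le> (real d * (real k + 1))\<^sup>2"
    proof -
      have "0 \<le> real k * real k * (real d * real d - 1)" "0 \<le> real k * (real d * real d * 2 - real d)" "1 \<le> real d * real d"
        using d mult_mono[of 1 "real d" 1 "real d"] by (auto intro!: mult_nonneg_nonneg)
      then show ?thesis by (simp add: power2_eq_square algebra_simps)
    qed
    also have "\<dots> \<le> (real d * 2 ^ k)\<^sup>2" using k by (intro power_mono mult_left_mono) auto
    finally show ?thesis using d by (simp add: eigenvalue_def of_nat_diff add.commute)
  qed
  then have "sqrt (1 + eigenvalue d k) \<le> real d * 2 ^ k"
    by (intro real_le_lsqrt) auto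
  then have "sqrt (1 + eigenvalue d k) powr s \<le> (real d * 2 ^ k) powr s"
    using s by (intro powr_mono2) (auto simp: eigenvalue_def)
  also have "\<dots> = real d powr s * (2 powr s) ^ k"
    by (simp add: powr_mult powr_power powr_realpow[symmetric] powr_powr mult.commute)
  finally show ?thesis .
qed

lemma Lambda_factor_power2:
  "0 \<le> m \<Longrightarrow> (sqrt (1 + m) powr s)\<^sup>2 = (1 + m) powr s"
  by (simp add: powr_half_sqrt[symmetric] powr_powr power2_eq_square flip: powr_add)

lemma measurable_slice:
  assumes [measurable]: "f \<in> borel_measurable borel"
  shows "(\<lambda>\<omega> :: real ^ 'n. f (r *\<^sub>R \<omega>)) \<in> borel_measurable surface_measure"
  by (rule borel_measurable_surface_measure) measurable

abbreviation Lambda_factor :: "nat \<Rightarrow> real \<Rightarrow> nat \<Rightarrow> real" where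
  "Lambda_factor d b k \<equiv> sqrt (1 + eigenvalue d k) powr ((b - 1) / 2)"

definition weighted_fourier :: "real \<Rightarrow> (real ^ 'n \<Rightarrow> complex) \<Rightarrow> real ^ 'n \<Rightarrow> complex" where
  "weighted_fourier b g = (\<lambda>x. complex_of_real (norm x powr (- (b / 2))) * sphere_fourier g x)"

definition radial_coeff :: "'n::finite itself \<Rightarrow> real \<Rightarrow> real \<Rightarrow> nat \<Rightarrow> complex" where
  "radial_coeff t b r k = complex_of_real (r powr (- (b / 2))) * radial_profile t k r"

section \<open>A fixed function with its harmonic expansion\<close>

context
  fixes g :: "real ^ 'n \<Rightarrow> complex" and Y :: "nat \<Rightarrow> real ^ 'n \<Rightarrow> complex" and b :: real
  assumes n: "2 \<le> CARD('n)" and b: "1 < b" "b < real CARD('n)"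
    and g: "g \<in> L2 surface_measure" and Y: "\<And>k. Y k \<in> spherical_harmonics k"
    and lim: "(\<lambda>N. surface_nsq (\<lambda>\<omega>. g \<omega> - (\<Sum>k<N. Y k \<omega>))) \<longlonglongrightarrow> 0"
begin

lemma nsq_Y_sums: "(\<lambda>k. surface_nsq (Y k)) sums surface_nsq g"
  by (rule parseval_harmonics[OF g Y lim])

lemma nsq_Y_le: "surface_nsq (Y k) \<le> surface_nsq g"
  using sum_le_suminf[OF sums_summable[OF nsq_Y_sums], of "{k}"] nsq_Y_sums
  by (simp add: surface_nsq_nonneg sums_iff)

lemma weighted_fourier_measurable: "weighted_fourier b g \<in> borel_measurable borel"
proof -
  have [measurable]: "sphere_fourier g \<in> borel_measurable borel"
    by (rule sphere_fourier_measurable[OF L2D(1)[OF g]])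
  show ?thesis unfolding weighted_fourier_def by measurable
qed

lemma partial_sum_measurable: "(\<lambda>\<omega>. \<Sum>k<N. c k * Y k \<omega>) \<in> borel_measurable surface_measure"
  by (intro cpoly_measurable_surface cpoly_sum cpoly.mult cpoly.const spherical_harmonicsD(1)[OF Y])

text \<open>Convergence in squared norm gives convergence in first moment, and the transform is
  bounded by the first moment. Hence the transforms of the partial sums converge uniformly, on the
  sphere of any radius r.\<close>

lemma weighted_fourier_expansion:
  assumes r: "0 < r"
  shows "(\<lambda>N. surface_nsq (\<lambda>\<omega>. weighted_fourier b g (r *\<^sub>R \<omega>) - (\<Sum>k<N. radial_coeff TYPE('n) b r k * Y k \<omega>))) \<longlonglongrightarrow> 0"
    and "(\<lambda>\<omega>. weighted_fourier b g (r *\<^sub>R \<omega>)) \<in> L2 surface_measure"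
proof -
  let ?S = "\<lambda>N \<omega>. \<Sum>k<N. Y k \<omega>"
  let ?e = "\<lambda>N. \<integral>\<omega>. cmod (g \<omega> - ?S N \<omega>) \<partial>surface_measure"
  have SL: "?S N \<in> L2 surface_measure" for N by (intro L2_sum L2_surface_harmonic[OF Y]) auto
  have iY: "integrable surface_measure (Y k)" for k by (intro L2_surface_integrable L2_surface_harmonic[OF Y])
  have iS: "integrable surface_measure (?S N)" for N by (intro Bochner_Integration.integrable_sum iY)
  have ig: "integrable surface_measure g" by (rule L2_surface_integrable[OF g])
  have e: "?e \<longlonglongrightarrow> 0"
  proof (rule LIMSEQ_I)
    fix \<epsilon> :: real assume \<epsilon>: "0 < \<epsilon>"
    \<comment> \<open>Chosen so that d times the area is \<epsilon> / 2; the remaining \<epsilon> /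
      2 is left for the squared norm divided by d.\<close>
    define d where "d = \<epsilon> / (2 * sphere_area TYPE('n))"
    have A: "0 < sphere_area TYPE('n)" by (rule sphere_area_pos)
    have d: "0 < d" "d * sphere_area TYPE('n) = \<epsilon> / 2" using \<epsilon> A by (simp_all add: d_def)
    have "\<forall>\<^sub>F N in sequentially. surface_nsq (\<lambda>\<omega>. g \<omega> - ?S N \<omega>) < \<epsilon> / 2 * d"
      using \<epsilon> d by (intro order_tendstoD(2)[OF lim]) auto
    then obtain M where M: "\<And>N. M \<le> N \<Longrightarrow> surface_nsq (\<lambda>\<omega>. g \<omega> - ?S N \<omega>) < \<epsilon> / 2 * d"
      by (auto simp: eventually_sequentially)
    have "norm (?e N - 0) < \<epsilon>" if "M \<le> N" for N
    proof -
      have "?e N \<le> d * sphere_area TYPE('n) + surface_nsq (\<lambda>\<omega>. g \<omega> - ?S N \<omega>) / d"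
        by (rule integral_cmod_surface_le(2)[OF L2_diff[OF g SL] d(1)])
      moreover have "surface_nsq (\<lambda>\<omega>. g \<omega> - ?S N \<omega>) / d < \<epsilon> / 2"
        using M[OF that] d(1) by (simp add: pos_divide_less_eq)
      ultimately have "?e N < \<epsilon>" using d(2) by linarith
      then show ?thesis by simp
    qed
    then show "\<exists>no. \<forall>N\<ge>no. norm (?e N - 0) < \<epsilon>" by blast
  qed
  have eq: "weighted_fourier b g (r *\<^sub>R \<omega>) - (\<Sum>k<N. radial_coeff TYPE('n) b r k * Y k \<omega>)
      = complex_of_real (r powr (- (b / 2))) * sphere_fourier (\<lambda>\<omega>. g \<omega> - ?S N \<omega>) (r *\<^sub>R \<omega>)"
    if "norm \<omega> = 1" for \<omega> N
  proof -
    have "sphere_fourier (?S N) (r *\<^sub>R \<omega>) = (\<Sum>k<N. radial_profile TYPE('n) k r * Y k \<omega>)"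
      by (simp add: sphere_fourier_sum iY sphere_fourier_radial_profile[OF n Y that])
    then show ?thesis
      using r that by (simp add: weighted_fourier_def radial_coeff_def sphere_fourier_diff[OF ig iS] right_diff_distrib sum_distrib_left mult.assoc)
  qed
  show "(\<lambda>N. surface_nsq (\<lambda>\<omega>. weighted_fourier b g (r *\<^sub>R \<omega>) - (\<Sum>k<N. radial_coeff TYPE('n) b r k * Y k \<omega>))) \<longlonglongrightarrow> 0"
  proof (rule surface_nsq_uniform_limit[where e = "\<lambda>N. r powr (- (b / 2)) * ?e N"])
    show "cmod (weighted_fourier b g (r *\<^sub>R \<omega>) - (\<Sum>k<N. radial_coeff TYPE('n) b r k * Y k \<omega>)) \<le> r powr (- (b / 2)) * ?e N" if "norm \<omega> = 1" for \<omega> N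
      unfolding eq[OF that] norm_mult
      using cmod_sphere_fourier_le[OF Bochner_Integration.integrable_diff[OF ig iS], of N "r *\<^sub>R \<omega>"]
      by (simp add: mult_left_mono)
    show "(\<lambda>N. r powr (- (b / 2)) * ?e N) \<longlonglongrightarrow> 0" using tendsto_mult_left[OF e, of "r powr (- (b / 2))"] by simp
  qed (intro measurable_slice weighted_fourier_measurable partial_sum_measurable)+
  show "(\<lambda>\<omega>. weighted_fourier b g (r *\<^sub>R \<omega>)) \<in> L2 surface_measure"
  proof (rule L2_surface_bounded(1)[OF measurable_slice[OF weighted_fourier_measurable]])
    show "cmod (weighted_fourier b g (r *\<^sub>R \<omega>)) \<le> r powr (- (b / 2)) * (\<integral>\<omega>. cmod (g \<omega>) \<partial>surface_measure)" if "norm \<omega> = 1" for \<omega>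
      using that r cmod_sphere_fourier_le[OF ig, of "r *\<^sub>R \<omega>"] by (simp add: weighted_fourier_def norm_mult mult_left_mono)
  qed
qed

lemma radial_coeff_harmonic: "(\<lambda>\<omega>. radial_coeff TYPE('n) b r k * Y k \<omega>) \<in> spherical_harmonics k"
  by (rule spherical_harmonics_cmult[OF Y])

text \<open>For fixed r the degree-k part of the transform is bounded by a multiple of r^k / k!,
  which outweighs the growth of the multiplier. The multiplied series therefore converges uniformly
  on every sphere of positive radius, for each square-integrable g.\<close>

lemma Lambda_exists: "\<exists>H. angular_Lambda_power ((b - 1) / 2) (weighted_fourier b g) H"
proof -
  \<comment> \<open>\<open>norm\<close> and \<open>sgn\<close> recover radius and angle, so H is a
    pointwise series of Borel functions on the whole space; choosing a limit separately for each r
    would not yield joint measurability.\<close>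
  define H where "H x = (\<Sum>k. complex_of_real (Lambda_factor CARD('n) b k) * (radial_coeff TYPE('n) b (norm x) k * Y k (sgn x)))" for x
  have [measurable]: "Y k \<in> borel_measurable borel" for k by (intro cpoly_measurable spherical_harmonicsD(1)[OF Y])
  note sgn_borel_measurable[measurable]
  have mH: "H \<in> borel_measurable borel"
    unfolding H_def radial_coeff_def by measurable
  have "sphere_Lambda_power ((b - 1) / 2) (\<lambda>\<omega>. weighted_fourier b g (r *\<^sub>R \<omega>)) (\<lambda>\<omega>. H (r *\<^sub>R \<omega>))" if r: "0 < r" for r
  proof -
    let ?t = "\<lambda>k \<omega>. complex_of_real (Lambda_factor CARD('n) b k) * (radial_coeff TYPE('n) b r k * Y k \<omega>)"
    define D where "D = r powr (- (b / 2)) * exp (r\<^sup>2 / 4) * (sphere_area TYPE('n) + surface_nsq g) * real CARD('n) powr ((b - 1) / 2)"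
    define M where "M k = D * ((2 powr ((b - 1) / 2) * r) ^ k /\<^sub>R fact k)" for k
    have s0: "0 \<le> ((b - 1) / 2)" using b by simp
    have tM: "norm (?t k \<omega>) \<le> M k" if \<omega>: "norm \<omega> = 1" for k \<omega>
    proof -
      have "norm (?t k \<omega>) = Lambda_factor CARD('n) b k * (r powr (- (b / 2)) * cmod (radial_profile TYPE('n) k r * Y k \<omega>))"
        by (simp add: radial_coeff_def norm_mult mult.assoc)
      also have "\<dots> \<le> (real CARD('n) powr ((b - 1) / 2) * (2 powr ((b - 1) / 2)) ^ k) * (r powr (- (b / 2)) * (exp (r\<^sup>2 / 4) * (r ^ k / fact k) * (sphere_area TYPE('n) + surface_nsq g)))"
      proof (intro mult_mono Lambda_factor_le n s0)
        have "cmod (radial_profile TYPE('n) k r * Y k \<omega>) \<le> exp (r\<^sup>2 / 4) * (r ^ k / fact k) * (sphere_area TYPE('n) + surface_nsq (Y k))"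
          using r by (intro radial_profile_harmonic_le n Y \<omega>) simp
        also have "\<dots> \<le> exp (r\<^sup>2 / 4) * (r ^ k / fact k) * (sphere_area TYPE('n) + surface_nsq g)"
          using r nsq_Y_le[of k] by (intro mult_left_mono) auto
        finally show "cmod (radial_profile TYPE('n) k r * Y k \<omega>) \<le> exp (r\<^sup>2 / 4) * (r ^ k / fact k) * (sphere_area TYPE('n) + surface_nsq g)" .
      qed auto
      also have "\<dots> = M k"
        unfolding M_def D_def power_mult_distrib real_scaleR_def divide_real_def by (simp only: mult_ac)
      finally show ?thesis .
    qed
    have summM: "summable M" unfolding M_def by (intro summable_mult sums_summable[OF exp_converges])
    have Hr: "H (r *\<^sub>R \<omega>) = (\<Sum>k. ?t k \<omega>)" if "norm \<omega> = 1" for \<omega>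
    proof -
      have "sgn (r *\<^sub>R \<omega>) = \<omega>" using r that by (simp add: sgn_scaleR sgn_div_norm)
      then show ?thesis using r that by (simp add: H_def)
    qed
    have tail: "cmod (H (r *\<^sub>R \<omega>) - (\<Sum>k<N. ?t k \<omega>)) \<le> suminf M - (\<Sum>k<N. M k)" if \<omega>: "norm \<omega> = 1" for \<omega> N
    proof -
      have sn: "summable (\<lambda>k. norm (?t k \<omega>))"
        by (rule summable_comparison_test'[OF summM, of 0]) (use tM[OF \<omega>] in simp)
      have st: "summable (\<lambda>k. ?t k \<omega>)" by (rule summable_norm_cancel[OF sn])
      have "H (r *\<^sub>R \<omega>) - (\<Sum>k<N. ?t k \<omega>) = (\<Sum>k. ?t (k + N) \<omega>)"
        unfolding Hr[OF \<omega>] by (simp only: suminf_minus_initial_segment[OF st])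
      also have "norm \<dots> \<le> (\<Sum>k. norm (?t (k + N) \<omega>))"
        by (rule summable_norm[OF summable_ignore_initial_segment[OF sn]])
      also have "\<dots> \<le> (\<Sum>k. M (k + N))"
        by (intro suminf_le tM \<omega> summable_ignore_initial_segment[OF sn] summable_ignore_initial_segment[OF summM])
      also have "\<dots> = suminf M - (\<Sum>k<N. M k)" by (rule suminf_minus_initial_segment[OF summM])
      finally show ?thesis .
    qed
    have tail0: "(\<lambda>N. suminf M - (\<Sum>k<N. M k)) \<longlonglongrightarrow> 0"
      using tendsto_diff[OF tendsto_const summable_LIMSEQ[OF summM], of "suminf M"] by simp
    have limH: "(\<lambda>N. surface_nsq (\<lambda>\<omega>. H (r *\<^sub>R \<omega>) - (\<Sum>k<N. ?t k \<omega>))) \<longlonglongrightarrow> 0"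
    proof (rule surface_nsq_uniform_limit[OF measurable_slice[OF mH] _ tail tail0])
      show "(\<lambda>\<omega>. \<Sum>k<N. ?t k \<omega>) \<in> borel_measurable surface_measure" for N
        using partial_sum_measurable[of "\<lambda>k. complex_of_real (Lambda_factor CARD('n) b k) * radial_coeff TYPE('n) b r k"]
        by (simp only: mult.assoc)
    qed
    have HL: "(\<lambda>\<omega>. H (r *\<^sub>R \<omega>)) \<in> L2 surface_measure"
      by (rule L2_surface_bounded(1)[OF measurable_slice[OF mH]]) (use tail[of _ 0] in simp)
    have eig: "angular_laplacian (\<lambda>\<omega>. radial_coeff TYPE('n) b r k * Y k \<omega>) \<omega> = - complex_of_real (eigenvalue CARD('n) k) * (radial_coeff TYPE('n) b r k * Y k \<omega>)" for k \<omega>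
      using angular_laplacian_spherical_harmonics[OF radial_coeff_harmonic[of r k], of \<omega>] by (simp add: eigenvalue_def)
    have sq: "(\<lambda>N. sqrt (x N)) \<longlonglongrightarrow> 0" if "x \<longlonglongrightarrow> 0" for x
      using tendsto_real_sqrt[OF that] by simp
    show ?thesis
      unfolding sphere_Lambda_power_def L2_norm_surface
      using weighted_fourier_expansion[OF r] HL limH eig
      by (intro conjI exI[of _ "\<lambda>k \<omega>. radial_coeff TYPE('n) b r k * Y k \<omega>"] exI[of _ "eigenvalue CARD('n)"] allI ballI sq radial_coeff_harmonic) auto
  qed
  then show ?thesis
    unfolding angular_Lambda_power_def using mH by (intro exI[of _ H]) auto
qed

text \<open>The relation supplies some expansion \<open>Z\<close> with some eigenvalues. By
  uniqueness \<open>Z k\<close> has the norm of the k-th part of the transform. If this is nonzero,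
  then \<open>Z k\<close> is nonzero at a point of the sphere and the eigenvalue is forced;
  otherwise the term is 0 on both sides.\<close>

lemma Lambda_slice_norm:
  assumes r: "0 < r" and L: "sphere_Lambda_power ((b - 1) / 2) (\<lambda>\<omega>. weighted_fourier b g (r *\<^sub>R \<omega>)) h"
  shows "(\<lambda>k. (Lambda_factor CARD('n) b k)\<^sup>2 * ((cmod (radial_coeff TYPE('n) b r k))\<^sup>2 * surface_nsq (Y k))) sums surface_nsq h"
    and "h \<in> L2 surface_measure"
proof -
  from L obtain Z \<mu> where hL: "h \<in> L2 surface_measure"
    and Z: "\<And>k. Z k \<in> spherical_harmonics k"
    and eig: "\<And>k \<omega>. norm \<omega> = 1 \<Longrightarrow> angular_laplacian (Z k) \<omega> = - complex_of_real (\<mu> k) * Z k \<omega>"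
    and limF: "(\<lambda>N. sqrt (surface_nsq (\<lambda>\<omega>. weighted_fourier b g (r *\<^sub>R \<omega>) - (\<Sum>k<N. Z k \<omega>)))) \<longlonglongrightarrow> 0"
    and limh: "(\<lambda>N. sqrt (surface_nsq (\<lambda>\<omega>. h \<omega> - (\<Sum>k<N. complex_of_real (sqrt (1 + \<mu> k) powr ((b - 1) / 2)) * Z k \<omega>)))) \<longlonglongrightarrow> 0"
    unfolding sphere_Lambda_power_def L2_norm_surface by (elim conjE exE) (rule that, auto)
  show "h \<in> L2 surface_measure" by (rule hL)
  have sq: "x \<longlonglongrightarrow> 0" if "(\<lambda>N. sqrt (x N)) \<longlonglongrightarrow> 0" "\<And>N. 0 \<le> x N" for x
    using tendsto_power[OF that(1), of 2] that(2) by simp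
  have "(\<lambda>k. surface_nsq (\<lambda>\<omega>. complex_of_real (sqrt (1 + \<mu> k) powr ((b - 1) / 2)) * Z k \<omega>)) sums surface_nsq h"
    by (intro parseval_harmonics hL spherical_harmonics_cmult Z sq[OF limh] surface_nsq_nonneg)
  moreover have "surface_nsq (\<lambda>\<omega>. complex_of_real (sqrt (1 + \<mu> k) powr ((b - 1) / 2)) * Z k \<omega>) = (Lambda_factor CARD('n) b k)\<^sup>2 * ((cmod (radial_coeff TYPE('n) b r k))\<^sup>2 * surface_nsq (Y k))" for k
  proof -
    have "surface_nsq (Z k) = surface_nsq (\<lambda>\<omega>. radial_coeff TYPE('n) b r k * Y k \<omega>)"
      by (intro harmonic_expansion_unique[OF weighted_fourier_expansion(2)[OF r] Z radial_coeff_harmonic sq[OF limF] weighted_fourier_expansion(1)[OF r]] surface_nsq_nonneg)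
    then have nsq: "surface_nsq (Z k) = (cmod (radial_coeff TYPE('n) b r k))\<^sup>2 * surface_nsq (Y k)"
      by (simp add: surface_nsq_cmult)
    show ?thesis
    proof (cases "surface_nsq (Z k) = 0")
      case True
      then show ?thesis using nsq by (simp add: surface_nsq_cmult)
    next
      case False
      have "\<exists>\<omega>. norm \<omega> = 1 \<and> Z k \<omega> \<noteq> 0"
      proof (rule ccontr)
        assume "\<not> (\<exists>\<omega>. norm \<omega> = 1 \<and> Z k \<omega> \<noteq> 0)"
        then have "surface_nsq (Z k) = (\<integral>\<omega>. 0 \<partial>(surface_measure :: (real ^ 'n) measure))"
          unfolding surface_nsq_def by (intro Bochner_Integration.integral_cong) (auto simp: space_surface_measure)
        with False show False by simp
      qed
      then obtain \<omega> where \<omega>: "norm \<omega> = 1" "Z k \<omega> \<noteq> 0" by blast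
      have "- complex_of_real (eigenvalue CARD('n) k) * Z k \<omega> = - complex_of_real (\<mu> k) * Z k \<omega>"
        unfolding eig[OF \<omega>(1), symmetric] angular_laplacian_spherical_harmonics[OF Z] by (simp add: eigenvalue_def)
      then have "\<mu> k = eigenvalue CARD('n) k" using \<omega>(2) by simp
      then show ?thesis by (simp add: surface_nsq_cmult nsq)
    qed
  qed
  ultimately show "(\<lambda>k. (Lambda_factor CARD('n) b k)\<^sup>2 * ((cmod (radial_coeff TYPE('n) b r k))\<^sup>2 * surface_nsq (Y k))) sums surface_nsq h"
    by (simp only:)
qed

text \<open>Polar coordinates reduce to the slices, Parseval evaluates almost every slice, and
  Tonelli interchanges the sum over the degree with the radial integral. Working with extended
  values postpones integrability of H.\<close>

lemma Lambda_norm: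
  assumes L: "angular_Lambda_power ((b - 1) / 2) (weighted_fourier b g) H"
  shows "H \<in> borel_measurable borel"
    and "(\<integral>\<^sup>+x. ennreal ((cmod (H x))\<^sup>2) \<partial>lborel) = (\<Sum>k. ennreal ((1 + eigenvalue CARD('n) k) powr ((b - 1) / 2) * surface_nsq (Y k)) *
      (\<integral>\<^sup>+r. ennreal (r powr (- b) * (cmod (radial_profile TYPE('n) k r))\<^sup>2) \<partial>radial_measure CARD('n)))"
proof -
  let ?R = "radial_measure CARD('n)"
  show mH [measurable]: "H \<in> borel_measurable borel" using L by (simp add: angular_Lambda_power_def)
  have "AE r in lborel. 0 < r \<longrightarrow> sphere_Lambda_power ((b - 1) / 2) (\<lambda>\<omega>. weighted_fourier b g (r *\<^sub>R \<omega>)) (\<lambda>\<omega>. H (r *\<^sub>R \<omega>))"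
    using L by (simp add: angular_Lambda_power_def)
  \<comment> \<open>The radial measure has a density with respect to Lebesgue measure and ignores
    nonpositive radii, so the exceptional set stays null.\<close>
  then have AE: "AE r in ?R. 0 < r \<and> sphere_Lambda_power ((b - 1) / 2) (\<lambda>\<omega>. weighted_fourier b g (r *\<^sub>R \<omega>)) (\<lambda>\<omega>. H (r *\<^sub>R \<omega>))"
    unfolding radial_measure_def by (subst AE_density) (auto elim!: eventually_mono simp: indicator_def split: if_splits)
  let ?w = "\<lambda>k. (1 + eigenvalue CARD('n) k) powr ((b - 1) / 2) * surface_nsq (Y k)"
  let ?p = "\<lambda>k r. r powr (- b) * (cmod (radial_profile TYPE('n) k r))\<^sup>2"
  have "(\<integral>\<^sup>+x. ennreal ((cmod (H x))\<^sup>2) \<partial>lborel) = (\<integral>\<^sup>+r. \<integral>\<^sup>+\<omega>. ennreal ((cmod (H (r *\<^sub>R \<omega>)))\<^sup>2) \<partial>surface_measure \<partial>?R)"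
    by (rule nn_integral_polar) measurable
  also have "\<dots> = (\<integral>\<^sup>+r. (\<Sum>k. ennreal (?w k) * ennreal (?p k r)) \<partial>?R)"
  proof (rule nn_integral_cong_AE, use AE in eventually_elim)
    case (elim r)
    then have r: "0 < r" by simp
    from elim have sums: "(\<lambda>k. (Lambda_factor CARD('n) b k)\<^sup>2 * ((cmod (radial_coeff TYPE('n) b r k))\<^sup>2 * surface_nsq (Y k))) sums surface_nsq (\<lambda>\<omega>. H (r *\<^sub>R \<omega>))"
      and HL: "(\<lambda>\<omega>. H (r *\<^sub>R \<omega>)) \<in> L2 surface_measure"
      using Lambda_slice_norm[OF r] by auto
    have "(r powr (- (b / 2)))\<^sup>2 = r powr (- b)" by (simp add: power2_eq_square flip: powr_add)
    then have term_eq: "(Lambda_factor CARD('n) b k)\<^sup>2 * ((cmod (radial_coeff TYPE('n) b r k))\<^sup>2 * surface_nsq (Y k)) = ?w k * ?p k r" for k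
      using Lambda_factor_power2[of "eigenvalue CARD('n) k" "(b - 1) / 2"]
      by (simp add: radial_coeff_def norm_mult power_mult_distrib eigenvalue_def)
    have "(\<integral>\<^sup>+\<omega>. ennreal ((cmod (H (r *\<^sub>R \<omega>)))\<^sup>2) \<partial>surface_measure) = ennreal (surface_nsq (\<lambda>\<omega>. H (r *\<^sub>R \<omega>)))"
      by (rule nn_integral_surface_nsq[OF HL])
    also have "\<dots> = (\<Sum>k. ennreal (?w k * ?p k r))"
      using sums unfolding term_eq by (intro suminf_ennreal_eq[symmetric]) (auto simp: surface_nsq_nonneg)
    also have "\<dots> = (\<Sum>k. ennreal (?w k) * ennreal (?p k r))"
      by (simp add: ennreal_mult surface_nsq_nonneg)
    finally show ?case .
  qed
  also have "\<dots> = (\<Sum>k. \<integral>\<^sup>+r. ennreal (?w k) * ennreal (?p k r) \<partial>?R)"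
    by (rule nn_integral_suminf) (simp add: measurable_cong_sets[OF sets_radial_measure refl])
  also have "\<dots> = (\<Sum>k. ennreal (?w k) * (\<integral>\<^sup>+r. ennreal (?p k r) \<partial>?R))"
    by (intro suminf_cong nn_integral_cmult) (simp add: measurable_cong_sets[OF sets_radial_measure refl])
  finally show "(\<integral>\<^sup>+x. ennreal ((cmod (H x))\<^sup>2) \<partial>lborel) = (\<Sum>k. ennreal (?w k) * (\<integral>\<^sup>+r. ennreal (?p k r) \<partial>?R))" .
qed

text \<open>Degree k contributes \<kappa> times the product of multiplier and
  \<open>weber_sum\<close>, times the squared norm of \<open>Y k\<close>. Bounds on that product
  uniform in k therefore pass to the sum, and \<kappa> collects the constants of
  \<open>radial_profile_integral\<close>.\<close>

lemma Lambda_norm_bounds: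
  assumes L: "angular_Lambda_power ((b - 1) / 2) (weighted_fourier b g) H"
    and c: "0 < c" and C: "0 < C"
    and bounds: "\<And>k. c \<le> (1 + eigenvalue CARD('n) k) powr ((b - 1) / 2) * weber_sum CARD('n) ((real CARD('n) - b) / 2) k"
      "\<And>k. (1 + eigenvalue CARD('n) k) powr ((b - 1) / 2) * weber_sum CARD('n) ((real CARD('n) - b) / 2) k \<le> C"
  defines "\<kappa> \<equiv> gauss_mass TYPE('n) * sphere_area TYPE('n) / enn2real (subordination_const b)"
  shows "H \<in> L2 lborel" "sqrt (\<kappa> * c) * L2_norm surface_measure g \<le> L2_norm lborel H"
    "L2_norm lborel H \<le> sqrt (\<kappa> * C) * L2_norm surface_measure g"
proof -
  let ?K = "enn2real (subordination_const b)" and ?T = "weber_sum CARD('n) ((real CARD('n) - b) / 2)"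
  have K: "subordination_const b = ennreal ?K"
    using subordination_const_finite[of b] b by simp
  then have K0: "0 < ?K"
    using subordination_const_pos[of b] by (metis enn2real_nonneg ennreal_0 less_eq_real_def)
  have \<kappa>: "0 < \<kappa>" unfolding \<kappa>_def using K0 gauss_mass_pos[where 'n = 'n] sphere_area_pos[where 'n = 'n] by simp
  have T: "0 < ?T k" for k using b n by (intro weber_sum_pos) auto
  let ?v = "\<lambda>k. \<kappa> * ((1 + eigenvalue CARD('n) k) powr ((b - 1) / 2) * ?T k) * surface_nsq (Y k)"
  have v: "ennreal ((1 + eigenvalue CARD('n) k) powr ((b - 1) / 2) * surface_nsq (Y k)) *
      (\<integral>\<^sup>+r. ennreal (r powr (- b) * (cmod (radial_profile TYPE('n) k r))\<^sup>2) \<partial>radial_measure CARD('n)) = ennreal (?v k)" for k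
  \<comment> \<open>With \<open>Y k\<close> of norm 0 the extended product on the left is 0 whatever
    the integral is; otherwise \<open>Y k\<close> itself is the harmonic needed to evaluate the
    profile.\<close>
  proof (cases "surface_nsq (Y k) = 0")
    case False
    let ?I = "\<integral>\<^sup>+r. ennreal (r powr (- b) * (cmod (radial_profile TYPE('n) k r))\<^sup>2) \<partial>radial_measure CARD('n)"
    have "ennreal ?K * ?I = ennreal (?K * (\<kappa> * ?T k))"
      using radial_profile_integral[OF n Y False b] K0 unfolding K[symmetric] by (simp add: \<kappa>_def)
    also have "\<dots> = ennreal ?K * ennreal (\<kappa> * ?T k)" using K0 by (intro ennreal_mult') simp
    finally have "?I = ennreal (\<kappa> * ?T k)" using K0 by (auto simp: ennreal_mult_cancel_left)
    then show ?thesis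
      using \<kappa> T[of k] surface_nsq_nonneg[of "Y k"] by (simp add: mult_ac flip: ennreal_mult)
  qed simp
  have N: "(\<integral>\<^sup>+x. ennreal ((cmod (H x))\<^sup>2) \<partial>lborel) = (\<Sum>k. ennreal (?v k))"
    unfolding Lambda_norm(2)[OF L] v ..
  have v0: "0 \<le> ?v k" for k using \<kappa> T[of k] surface_nsq_nonneg[of "Y k"] by simp
  have vc: "\<kappa> * c * surface_nsq (Y k) \<le> ?v k" "?v k \<le> \<kappa> * C * surface_nsq (Y k)" for k
    using bounds[of k, THEN mult_right_mono, OF surface_nsq_nonneg[of "Y k"], THEN mult_left_mono, OF less_imp_le[OF \<kappa>]]
    by (simp_all only: mult.assoc)
  have sumY: "summable (\<lambda>k. surface_nsq (Y k))" "(\<Sum>k. surface_nsq (Y k)) = surface_nsq g"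
    using nsq_Y_sums by (auto simp: sums_iff)
  have sumv: "summable ?v"
    by (rule summable_comparison_test'[OF summable_mult[OF sumY(1), of "\<kappa> * C"], of 0]) (use v0 vc(2) in simp)
  have N2: "(\<integral>\<^sup>+x. ennreal ((cmod (H x))\<^sup>2) \<partial>lborel) = ennreal (suminf ?v)"
    unfolding N by (rule suminf_ennreal2[OF v0 sumv])
  have mH [measurable]: "H \<in> borel_measurable borel" by (rule Lambda_norm(1)[OF L])
  have int: "integrable lborel (\<lambda>x. (cmod (H x))\<^sup>2)"
    by (rule integrableI_nonneg) (auto simp: N2)
  then show "H \<in> L2 lborel" by (simp add: L2_def)
  have "ennreal (\<integral>x. (cmod (H x))\<^sup>2 \<partial>lborel) = ennreal (suminf ?v)"
    using nn_integral_eq_integral[OF int] N2 by simp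
  then have H: "(\<integral>x. (cmod (H x))\<^sup>2 \<partial>lborel) = suminf ?v"
    using suminf_nonneg[OF sumv v0] by simp
  have "\<kappa> * c * surface_nsq g \<le> suminf ?v"
    unfolding sumY(2)[symmetric] suminf_mult[OF sumY(1), symmetric]
    by (intro suminf_le vc(1) summable_mult sumY(1) sumv)
  then show "sqrt (\<kappa> * c) * L2_norm surface_measure g \<le> L2_norm lborel H"
    unfolding L2_norm_surface unfolding L2_norm_def H by (simp flip: real_sqrt_mult)
  have "suminf ?v \<le> \<kappa> * C * surface_nsq g"
    unfolding sumY(2)[symmetric] suminf_mult[OF sumY(1), symmetric]
    by (intro suminf_le vc(2) summable_mult sumY(1) sumv)
  then show "L2_norm lborel H \<le> sqrt (\<kappa> * C) * L2_norm surface_measure g"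
    unfolding L2_norm_surface unfolding L2_norm_def H by (simp flip: real_sqrt_mult)
qed

end

theorem theorem1p1:
  fixes b :: real
  assumes "CARD('n::finite) \<ge> 2" and "1 < b" and "b < real CARD('n)"
  shows "\<exists>c C :: real. 0 < c \<and> c < C \<and>
    (\<forall>g :: real ^ 'n \<Rightarrow> complex. g \<in> L2 surface_measure \<longrightarrow>
      (let F = (\<lambda>x. complex_of_real (norm x powr (- (b / 2))) * sphere_fourier g x)
       in (\<exists>H. angular_Lambda_power ((b - 1) / 2) F H) \<and>
          (\<forall>H. angular_Lambda_power ((b - 1) / 2) F H \<longrightarrow>
             H \<in> L2 lborel \<and>
             c * L2_norm surface_measure g \<le> L2_norm lborel H \<and>
             L2_norm lborel H \<le> C * L2_norm surface_measure g)))"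
proof -
  have "(real CARD('n) - 1) / 2 - (real CARD('n) - b) / 2 = (b - 1) / 2"
    by (simp add: field_simps)
  with weber_sum_bounds[of "CARD('n)" "(real CARD('n) - b) / 2"] assms
  obtain c C where c: "0 < c" "0 < C"
    and bounds: "\<And>k. c \<le> (1 + eigenvalue CARD('n) k) powr ((b - 1) / 2) * weber_sum CARD('n) ((real CARD('n) - b) / 2) k"
      "\<And>k. (1 + eigenvalue CARD('n) k) powr ((b - 1) / 2) * weber_sum CARD('n) ((real CARD('n) - b) / 2) k \<le> C"
    unfolding eigenvalue_def by auto
  define \<kappa> where "\<kappa> = gauss_mass TYPE('n) * sphere_area TYPE('n) / enn2real (subordination_const b)"
  have "0 < enn2real (subordination_const b)"
    using subordination_const_finite[of b] subordination_const_pos[of b] assms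
    by (simp add: enn2real_positive_iff less_top zero_less_iff_neq_zero)
  then have \<kappa>: "0 < \<kappa>"
    unfolding \<kappa>_def using gauss_mass_pos[where 'n = 'n] sphere_area_pos[where 'n = 'n] by simp
  \<comment> \<open>The upper constant is taken as a sum so that it is strictly larger than the
    lower one even if c = C.\<close>
  let ?c = "sqrt (\<kappa> * c)" and ?C = "sqrt (\<kappa> * c) + sqrt (\<kappa> * C)"
  show ?thesis
  proof (rule exI[of _ ?c], rule exI[of _ ?C], intro conjI allI impI)
    fix g :: "real ^ 'n \<Rightarrow> complex" assume g: "g \<in> L2 surface_measure"
    obtain Y where Y: "\<And>k. Y k \<in> spherical_harmonics k"
      and lim: "(\<lambda>N. surface_nsq (\<lambda>\<omega>. g \<omega> - (\<Sum>k<N. Y k \<omega>))) \<longlonglongrightarrow> 0"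
      using harmonic_expansion[OF g] by blast
    note ctx = assms g Y lim
    have mono: "sqrt (\<kappa> * C) * L2_norm surface_measure g \<le> ?C * L2_norm surface_measure g"
      using \<kappa> c surface_nsq_nonneg[of g] by (intro mult_right_mono) (auto simp: L2_norm_surface)
    show "let F = (\<lambda>x. complex_of_real (norm x powr (- (b / 2))) * sphere_fourier g x)
       in (\<exists>H. angular_Lambda_power ((b - 1) / 2) F H) \<and>
          (\<forall>H. angular_Lambda_power ((b - 1) / 2) F H \<longrightarrow>
             H \<in> L2 lborel \<and> ?c * L2_norm surface_measure g \<le> L2_norm lborel H \<and>
             L2_norm lborel H \<le> ?C * L2_norm surface_measure g)"
      using Lambda_exists[OF ctx, unfolded weighted_fourier_def]
        Lambda_norm_bounds[OF ctx _ c bounds, unfolded weighted_fourier_def \<kappa>_def[symmetric]] mono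
      by (auto simp: Let_def intro: order_trans)
  qed (use \<kappa> c in auto)
qed

end
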